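(* Let $P_0,P_1$ be probability measures on a measurable space $\mathcal X$ with $P_1\ll P_0$, $L:=dP_1/dP_0$, and $0<D<\infty$, where $D:=D_{\mathrm{KL}}(P_1\|P_0)$. Fix $\kappa\in(0,1)$ and let $N_\gamma\in\mathbb N$ satisfy, as $\gamma\to\infty$, $N_\gamma\to\infty$, $\log\gamma=o(N_\gamma)$, $N_\gamma=o(\gamma)$. With the notation of the context: 1. For each $\mathfrak T\in\{\mathfrak T_{\rm raw},\mathfrak T_{\rm rand}\}$, $$\liminf_{\gamma\to\infty}\frac{\mathcal R_\gamma^{\rm lin}(\mathfrak T;\kappa)}{\log\gamma}\ge\frac1D.$$ 2. In addition, suppose that the likelihood-ratio score $s^*(x):=L(x)$ has continuous $P_0$-distribution function $F_{s^*,P_0}$. Let $H$ be the law of $F_{s^*,P_0}(s^*(X))$ under $X\sim P_1$ and $U$ the uniform law on $[0,1]$, and suppose (local KL support of $(\mathcal F,\Pi)$) that $H\ll U$ with $h:=dH/dU$ and $D_{\mathrm{KL}}(H\|U)\in(0,\infty)$, that $\log h$ is bounded and Lipschitz, and that there are constants $a,c\ge0$ such that for every $r\ge1$ and all $z_1,\dots,z_r\in[0,1]$, $$\log\int_\Theta\prod_{i=1}^rf_\theta(z_i)\,d\Pi(\theta)\ge\sum_{i=1}^r\log h(z_i)-a\log r-c.$$ Fix $\rho\in(0,1)$, let $w_k=1$ for all $k\geq 1$, and define $$\overline M^{\rho}_{k,t}:=\rho+(1-\rho)M_{k,t},\qquad \overline S_t^{(w,\rho)}:=\sum_{k=1}^tw_k\overline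 M^{\rho}_{k,t},\qquad \bar\tau_{S,w}(b):=\inf\{t\ge1:\overline S_t^{(w,\rho)}\ge b\},$$ where $M_{k,t}$ is computed using the score $s^*$ (see context). Then $$\bar\tau_{S,w}(\gamma)\in\mathcal C_\gamma^{\rm lin}(\mathfrak T_{\rm rand}),\qquad \gamma\le\mathbb E_{P_0,\infty}\bar\tau_{S,w}(\gamma)\le\lceil\gamma/\rho\rceil,$$ $$\limsup_{\gamma\to\infty}\frac{\sup_{\nu\in I_{N_\gamma}(\kappa)}\mathbb E_{P_0,\nu,P_1}[\bar\tau_{S,w}(\gamma)-\nu\mid\bar\tau_{S,w}(\gamma)>\nu]}{\log\gamma}\le\frac1D,$$ and $$\lim_{\gamma\to\infty}\frac{\mathcal R_\gamma^{\rm lin}(\mathfrak T_{\rm rand};\kappa)}{\log\gamma}=\lim_{\gamma\to\infty}\frac{\mathcal J_\gamma^\kappa\{\bar\tau_{S,w}(\gamma)\}}{\log\gamma}=\frac1D.$$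
   Context: Under $\mathbb P_{P_0,\nu,P_1}$ (expectation $\mathbb E_{P_0,\nu,P_1}$) the $\mathcal X$-valued observations are independent with $X_1,\dots,X_\nu\sim P_0$ and $X_{\nu+1},X_{\nu+2},\dots\sim P_1$; under $\mathbb P_{P_0,\infty}$ they are iid $P_0$. External randomizers $\lambda_1,\lambda_2,\dots$ are iid $U(0,1)$ independent of the data, with the same law under all these measures. $\mathfrak T_{\rm raw}$ (resp. $\mathfrak T_{\rm rand}$) is the set of all stopping times for $\sigma(X_1,\dots,X_t)$ (resp. $\sigma(X_1,\dots,X_t,\lambda_1,\dots,\lambda_t)$), $t\geq 1$. $I_N(\kappa):=\{\lceil\kappa N\rceil,\dots,N\}$. For $\gamma>1$, $$\mathcal C_\gamma^{\rm lin}(\mathfrak T):=\Big\{\tau\in\mathfrak T:\gamma\le\mathbb E_{P_0,\infty}\tau<\infty,\ \mathbb P_{P_0,\infty}(\tau\le m)\le\tfrac m\gamma\ \ \forall m\in\mathbb N\Big\}.$$ For $N_\gamma<\gamma$ (which holds eventually), $\mathcal J_\gamma^\kappa(\tau):=\sup_{\nu\in I_{N_\gamma}(\kappa)}\mathbb E_{P_0,\nu,P_1}[\tau-\nu\mid\tau>\nu]$ for $\tau\in\mathcal C_\gamma^{\rm lin}(\mathfrak T)$, and $\mathcal R_\gamma^{\rm lin}(\mathfrak T;\kappa):=\inf_{\tau\in\mathcal C_\gamma^{\rm lin}(\mathfrak T)}\mathcal J_\gamma^\kappa(\tau)$. Conformal quantities with score $s^*$: $Z_i:=s^*(X_i)$,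 $p_t:=\frac1t\big(\sum_{i\le t}\mathbf 1\{Z_i<Z_t\}+\lambda_t\sum_{i\le t}\mathbf 1\{Z_i=Z_t\}\big)$; $\mathcal F=\{f_\theta:\theta\in\Theta\}$ is a jointly measurable family of probability densities on $[0,1]$, $\Pi$ a probability measure on $\Theta$; $M_{k,t}:=\int_\Theta\prod_{j=k}^tf_\theta(p_j)\,d\Pi(\theta)$. *)

theory Defs
  imports "HOL-Probability.Probability" "HOL-Library.Landau_Symbols"
begin

text \<open>
  Everything lives on the coordinate space of sequences
  \<open>\<omega> = (X\<^sub>i, \<lambda>\<^sub>i)\<^sub>i\<close>, \<open>i \<ge> 1\<close>, of observation/randomizer pairs.
  Values \<open>\<omega> 0\<close> play no role: the index set of all product measures is \<open>{1..}\<close>.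
\<close>

type_synonym 'a path = "nat \<Rightarrow> 'a \<times> real"

abbreviation obs :: "nat \<Rightarrow> 'a path \<Rightarrow> 'a" where
  "obs i \<omega> \<equiv> fst (\<omega> i)"

abbreviation rnd :: "nat \<Rightarrow> 'a path \<Rightarrow> real" where
  "rnd i \<omega> \<equiv> snd (\<omega> i)"

definition unif01 :: "real measure" where
  "unif01 = uniform_measure lborel {0..1}"

definition null_law :: "'a measure \<Rightarrow> 'a path measure" where
  "null_law P0 = (\<Pi>\<^sub>M i\<in>{1..}. P0 \<Otimes>\<^sub>M unif01)"

definition change_law :: "'a measure \<Rightarrow> nat \<Rightarrow> 'a measure \<Rightarrow> 'a path measure" where
  "change_law P0 \<nu> P1 = (\<Pi>\<^sub>M i\<in>{1..}. (if i \<le> \<nu> then P0 else P1) \<Otimes>\<^sub>M unif01)"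


section \<open>Stopping times\<close>

text \<open>
  Filtrations are indexed by \<^typ>\<open>enat\<close> so that the library's \<^const>\<open>stopping_time\<close>
  applies to times with values in \<open>{1, 2, \<dots>} \<union> {\<infinity>}\<close>; the index \<open>\<infinity>\<close> gives the \<sigma>-algebra
  of the whole sequence, where the stopping condition is vacuous.
\<close>

definition times_upto :: "enat \<Rightarrow> nat set" where
  "times_upto t = {i. 1 \<le> i \<and> enat i \<le> t}"

definition raw_filtration :: "'a measure \<Rightarrow> enat \<Rightarrow> 'a path measure" where
  "raw_filtration P0 t =
     vimage_algebra (space (null_law P0)) (\<lambda>\<omega>. \<lambda>i\<in>times_upto t. obs i \<omega>)
       (\<Pi>\<^sub>M i\<in>times_upto t. P0)"

definition rand_filtration :: "'a measure \<Rightarrow> enat \<Rightarrow> 'a path measure" where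
  "rand_filtration P0 t =
     vimage_algebra (space (null_law P0)) (\<lambda>\<omega>. \<lambda>i\<in>times_upto t. (obs i \<omega>, rnd i \<omega>))
       (\<Pi>\<^sub>M i\<in>times_upto t. P0 \<Otimes>\<^sub>M borel)"

definition T_raw :: "'a measure \<Rightarrow> ('a path \<Rightarrow> enat) set" where
  "T_raw P0 = {\<tau>. stopping_time (raw_filtration P0) \<tau> \<and> (\<forall>\<omega>\<in>space (null_law P0). 1 \<le> \<tau> \<omega>)}"

definition T_rand :: "'a measure \<Rightarrow> ('a path \<Rightarrow> enat) set" where
  "T_rand P0 = {\<tau>. stopping_time (rand_filtration P0) \<tau> \<and> (\<forall>\<omega>\<in>space (null_law P0). 1 \<le> \<tau> \<omega>)}"

definition null_mean :: "'a measure \<Rightarrow> ('a path \<Rightarrow> enat) \<Rightarrow> ennreal" where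
  "null_mean P0 \<tau> = (\<integral>\<^sup>+\<omega>. ennreal_of_enat (\<tau> \<omega>) \<partial>null_law P0)"

definition C_lin :: "'a measure \<Rightarrow> real \<Rightarrow> ('a path \<Rightarrow> enat) set \<Rightarrow> ('a path \<Rightarrow> enat) set" where
  "C_lin P0 \<gamma> T = {\<tau>\<in>T. ennreal \<gamma> \<le> null_mean P0 \<tau> \<and> null_mean P0 \<tau> < \<infinity> \<and>
     (\<forall>m::nat. \<P>(\<omega> in null_law P0. \<tau> \<omega> \<le> enat m) \<le> real m / \<gamma>)}"

text \<open>
  Elementary conditional expectation given the event \<open>\<tau> > \<nu>\<close>. It is \<open>0 / 0 = 0\<close> when that
  event is null, which does not occur for \<open>\<tau>\<close> in \<^const>\<open>C_lin\<close> and \<open>\<nu> < \<gamma>\<close>.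
\<close>
definition cond_delay ::
  "'a measure \<Rightarrow> nat \<Rightarrow> 'a measure \<Rightarrow> ('a path \<Rightarrow> enat) \<Rightarrow> ennreal" where
  "cond_delay P0 \<nu> P1 \<tau> =
     (\<integral>\<^sup>+\<omega>. ennreal_of_enat (\<tau> \<omega> - enat \<nu>) * indicator {\<omega>. enat \<nu> < \<tau> \<omega>} \<omega> \<partial>change_law P0 \<nu> P1)
       / emeasure (change_law P0 \<nu> P1) {\<omega>\<in>space (change_law P0 \<nu> P1). enat \<nu> < \<tau> \<omega>}"

definition change_window :: "nat \<Rightarrow> real \<Rightarrow> nat set" where
  "change_window n \<kappa> = {nat \<lceil>\<kappa> * real n\<rceil>..n}"

definition J_delay ::
  "'a measure \<Rightarrow> 'a measure \<Rightarrow> nat \<Rightarrow> real \<Rightarrow> ('a path \<Rightarrow> enat) \<Rightarrow> ennreal" where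
  "J_delay P0 P1 n \<kappa> \<tau> = (SUP \<nu>\<in>change_window n \<kappa>. cond_delay P0 \<nu> P1 \<tau>)"

definition R_lin ::
  "'a measure \<Rightarrow> 'a measure \<Rightarrow> nat \<Rightarrow> real \<Rightarrow> real \<Rightarrow> ('a path \<Rightarrow> enat) set \<Rightarrow> ennreal" where
  "R_lin P0 P1 n \<kappa> \<gamma> T = (INF \<tau>\<in>C_lin P0 \<gamma> T. J_delay P0 P1 n \<kappa> \<tau>)"


section \<open>Kullback--Leibler divergence\<close>

text \<open>
  \<open>0 < D\<^sub>K\<^sub>L(Q \<parallel> P) < \<infinity>\<close> for \<open>Q \<lless> P\<close>. The negative part of \<open>ln (dQ/dP)\<close> is always
  \<open>Q\<close>-integrable, so finiteness is integrability; without it the library's Bochner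
  integral would be \<open>0\<close>. Note the argument order of \<^const>\<open>KL_divergence\<close>.
\<close>

definition kl_div :: "'a measure \<Rightarrow> 'a measure \<Rightarrow> real" where
  "kl_div Q P = KL_divergence (exp 1) P Q"

definition kl_finite_pos :: "'a measure \<Rightarrow> 'a measure \<Rightarrow> bool" where
  "kl_finite_pos Q P \<longleftrightarrow>
     absolutely_continuous P Q \<and> integrable Q (entropy_density (exp 1) P Q) \<and> 0 < kl_div Q P"


section \<open>Conformal e-detector\<close>

definition conf_p :: "('a \<Rightarrow> real) \<Rightarrow> nat \<Rightarrow> 'a path \<Rightarrow> real" where
  "conf_p s t \<omega> =
     ((\<Sum>i=1..t. of_bool (s (obs i \<omega>) < s (obs t \<omega>)))
        + rnd t \<omega> * (\<Sum>i=1..t. of_bool (s (obs i \<omega>) = s (obs t \<omega>)))) / real t"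

text \<open>
  Densities on \<open>[0,1]\<close> are represented by measurable functions on the whole real line;
  values outside \<open>[0,1]\<close> matter only on the null event that some randomizer is outside \<open>[0,1]\<close>.
\<close>
definition density_family :: "'th measure \<Rightarrow> ('th \<Rightarrow> real \<Rightarrow> real) \<Rightarrow> bool" where
  "density_family Pr f \<longleftrightarrow>
     (\<lambda>(\<theta>, u). f \<theta> u) \<in> borel_measurable (Pr \<Otimes>\<^sub>M borel) \<and>
     (\<forall>\<theta>\<in>space Pr. (\<forall>u\<in>{0..1}. 0 \<le> f \<theta> u) \<and> (\<integral>\<^sup>+u\<in>{0..1}. ennreal (f \<theta> u) \<partial>lborel) = 1)"

definition mix_lik ::
  "'th measure \<Rightarrow> ('th \<Rightarrow> real \<Rightarrow> real) \<Rightarrow> nat set \<Rightarrow> (nat \<Rightarrow> real) \<Rightarrow> ennreal" where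
  "mix_lik Pr f I z = (\<integral>\<^sup>+\<theta>. ennreal (\<Prod>j\<in>I. f \<theta> (z j)) \<partial>Pr)"

definition M_stat :: "'th measure \<Rightarrow> ('th \<Rightarrow> real \<Rightarrow> real) \<Rightarrow> ('a \<Rightarrow> real)
    \<Rightarrow> nat \<Rightarrow> nat \<Rightarrow> 'a path \<Rightarrow> ennreal" where
  "M_stat Pr f s k t \<omega> = mix_lik Pr f {k..t} (\<lambda>j. conf_p s j \<omega>)"

definition M_bar :: "'th measure \<Rightarrow> ('th \<Rightarrow> real \<Rightarrow> real) \<Rightarrow> ('a \<Rightarrow> real) \<Rightarrow> real
    \<Rightarrow> nat \<Rightarrow> nat \<Rightarrow> 'a path \<Rightarrow> ennreal" where
  "M_bar Pr f s \<rho> k t \<omega> = ennreal \<rho> + ennreal (1 - \<rho>) * M_stat Pr f s k t \<omega>"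

definition S_bar :: "'th measure \<Rightarrow> ('th \<Rightarrow> real \<Rightarrow> real) \<Rightarrow> ('a \<Rightarrow> real) \<Rightarrow> (nat \<Rightarrow> real) \<Rightarrow> real
    \<Rightarrow> nat \<Rightarrow> 'a path \<Rightarrow> ennreal" where
  "S_bar Pr f s w \<rho> t \<omega> = (\<Sum>k=1..t. ennreal (w k) * M_bar Pr f s \<rho> k t \<omega>)"

definition tau_bar :: "'th measure \<Rightarrow> ('th \<Rightarrow> real \<Rightarrow> real) \<Rightarrow> ('a \<Rightarrow> real) \<Rightarrow> (nat \<Rightarrow> real) \<Rightarrow> real
    \<Rightarrow> real \<Rightarrow> 'a path \<Rightarrow> enat" where
  "tau_bar Pr f s w \<rho> b \<omega> = Inf (enat ` {t. 1 \<le> t \<and> ennreal b \<le> S_bar Pr f s w \<rho> t \<omega>})"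


section \<open>Local KL support\<close>

definition ln_ennreal :: "ennreal \<Rightarrow> ereal" where
  "ln_ennreal x = (if x = 0 then -\<infinity> else if x = \<infinity> then \<infinity> else ereal (ln (enn2real x)))"

text \<open>The law of \<open>F(s(X))\<close> under \<open>X \<sim> P1\<close>, with \<open>F\<close> the distribution function of \<open>s\<close> under \<open>P0\<close>.\<close>
definition pit_law :: "'a measure \<Rightarrow> 'a measure \<Rightarrow> ('a \<Rightarrow> real) \<Rightarrow> real measure" where
  "pit_law P0 P1 s = distr P1 borel (\<lambda>x. cdf (distr P0 borel s) (s x))"

text \<open>
  \<open>h\<close> is the version of \<open>dH/dU\<close> whose logarithm is bounded and Lipschitz on \<open>[0,1]\<close>;
  positivity is explicit because \<open>ln 0 = 0\<close>.
\<close>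
definition local_KL_support :: "real measure \<Rightarrow> 'th measure \<Rightarrow> ('th \<Rightarrow> real \<Rightarrow> real) \<Rightarrow> bool" where
  "local_KL_support H Pr f \<longleftrightarrow>
     kl_finite_pos H unif01 \<and>
     (\<exists>h \<in> borel_measurable borel.
        (\<forall>u\<in>{0..1}. 0 < h u) \<and> density unif01 (\<lambda>u. ennreal (h u)) = H \<and>
        bounded ((\<lambda>u. ln (h u)) ` {0..1}) \<and>
        (\<exists>K. K-lipschitz_on {0..1} (\<lambda>u. ln (h u))) \<and>
        (\<exists>a c :: real. 0 \<le> a \<and> 0 \<le> c \<and>
          (\<forall>r\<ge>1. \<forall>z :: nat \<Rightarrow> real. (\<forall>i\<in>{1..r}. z i \<in> {0..1}) \<longrightarrow>
             ereal ((\<Sum>i=1..r. ln (h (z i))) - a * ln (real r) - c)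
               \<le> ln_ennreal (mix_lik Pr f {1..r} z))))"

end

theory Submission
  imports Defs "HOL-Real_Asymp.Real_Asymp"
begin

text \<open>
  Lower bound: over windows of length \<open>m \<approx> (1 - \<epsilon>) ln \<gamma> / D\<close> the sum of
  \<open>P\<^sub>\<infinity>(\<nu> < \<tau> \<le> \<nu> + m)\<close>, \<open>\<nu>\<close> in the change window, is at most \<open>m P\<^sub>\<infinity>(\<tau> \<le> N + m) \<le> m (N + m) / \<gamma>\<close>, so
  some \<open>\<nu>\<close> has \<open>P\<^sub>\<infinity>(\<nu> < \<tau> \<le> \<nu> + m) = O(m / \<gamma>)\<close>. By the law of large numbers the likelihood ratio of
  \<open>m\<close> post-change observations stays below \<open>\<gamma>\<^sup>s\<close>, \<open>s < 1\<close>, with high probability, and a change of measure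
  makes stopping within \<open>m\<close> steps after \<open>\<nu>\<close> unlikely.

  False alarms: under the null law the conformal p-values are iid uniform, so each \<open>M\<^sub>k\<^sub>,\<^sub>t\<close> is a martingale
  started at \<open>1\<close>; optional stopping gives both \<open>\<gamma> \<le> E \<tau>\<close> and \<open>P(\<tau> \<le> m) \<le> m / \<gamma>\<close>, while
  the floor \<open>\<rho>\<close> forces \<open>\<tau> \<le> \<lceil>\<gamma> / \<rho>\<rceil>\<close> everywhere.

  Upper bound: the first \<open>\<nu> \<ge> \<kappa> N \<gg> ln \<gamma>\<close> scores calibrate the ranks, so for \<open>O(ln \<gamma>)\<close> steps after the change
  the p-values are uniformly close to the transformed scores, whose mean log density \<open>ln h\<close> is \<open>D\<close>
  because the transform of \<open>L\<close> determines \<open>L\<close>. Hoeffding's inequality at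
  \<open>(1 + \<epsilon>) ln \<gamma> / D\<close> steps, and again at a large multiple of \<open>ln \<gamma>\<close> where the tail
  is \<open>O(\<gamma>\<^sup>-\<^sup>2)\<close> and beats the deterministic bound on \<open>\<tau>\<close>, bounds the mean delay.
\<close>

section \<open>Resampling coordinates of a product measure\<close>

text \<open>Conditioning on \<tau> > \<nu> is harmless: the event is decided by time \<nu>, where
  both laws agree, so the linear false-alarm bound gives it probability at least 1 - \<nu> /
  \<gamma>, which tends to 1 since N = o(\<gamma>). The obstacle in the upper bound is that
  post-change conformal p-values are neither independent nor identically distributed: every rank
  involves all earlier scores, contaminated ones included. No limit theorem is applied to them;
  Lipschitz continuity of ln h replaces each by the transform of its own score, and these are iid.
  Because this must work at O(ln \<gamma>) times at once, the pre-change empirical distribution is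
  controlled on a fixed finite grid. The two halves use different laws of large numbers. In the
  lower bound ln L is only integrable, and a failure probability below a fixed \<eta> suffices. In
  the upper bound a rate is needed, since the only a priori bound on the delay is of order \<gamma>
  / \<rho>; boundedness of ln h supplies it. At (1 + \<epsilon>) ln \<gamma> / D steps the tail may
  be just a small power of 1 / \<gamma>, hence the second horizon.\<close>

lemma nn_integral_PiM_resample:
  assumes M: "\<And>i. i \<in> I \<Longrightarrow> prob_space (M i)" and l: "l \<in> I"
    and f[measurable]: "f \<in> borel_measurable (PiM I M)"
  shows "(\<integral>\<^sup>+\<omega>. f \<omega> \<partial>PiM I M) = (\<integral>\<^sup>+\<omega>. (\<integral>\<^sup>+x. f (fun_upd \<omega> l (x)) \<partial>M l) \<partial>PiM I M)"
proof -
  let ?J = "I - {l}"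
  interpret l: prob_space "M l" using M l by auto
  interpret J: prob_space "PiM ?J M" using M by (intro prob_space_PiM) auto
  interpret lJ: pair_sigma_finite "M l" "PiM ?J M" ..
  have I: "insert l ?J = I" using l by auto
  have D: "PiM I M = distr (M l \<Otimes>\<^sub>M PiM ?J M) (PiM I M) (\<lambda>(x, X). X(l := x))"
    using distr_pair_PiM_eq_PiM[of ?J M l] M l unfolding I by auto
  have upd[measurable]: "(\<lambda>(x, X). X(l := x)) \<in> M l \<Otimes>\<^sub>M PiM ?J M \<rightarrow>\<^sub>M PiM I M"
    using measurable_add_dim[of l ?J M] unfolding I
    by (subst measurable_split_conv) (simp add: measurable_pair_swap_iff[of _ "M l"])
  have upd2[measurable]: "(\<lambda>(X, x). X(l := x)) \<in> PiM I M \<Otimes>\<^sub>M M l \<rightarrow>\<^sub>M PiM I M"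
    by (subst measurable_split_conv, rule measurable_fun_upd[where J=I]) (use l in auto)
  have g: "(\<lambda>\<omega>. \<integral>\<^sup>+x. f (fun_upd \<omega> l (x)) \<partial>M l) \<in> borel_measurable (PiM I M)"
    by (intro l.borel_measurable_nn_integral) (use measurable_compose[OF upd2 f] in \<open>simp add: case_prod_beta' comp_def\<close>)
  \<comment> \<open>Fubini over the split of coordinate \<open>l\<close> from the rest. Applied to
    \<open>f\<close> and again to the inner integral, which ignores the old value at
    \<open>l\<close>, it lets the outer integral stay over the full product.\<close>
  have E: "(\<integral>\<^sup>+\<omega>. h \<omega> \<partial>PiM I M) = (\<integral>\<^sup>+X. (\<integral>\<^sup>+x. h (X(l := x)) \<partial>M l) \<partial>PiM ?J M)"
    if [measurable]: "h \<in> borel_measurable (PiM I M)" for h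
  proof -
    have "(\<integral>\<^sup>+\<omega>. h \<omega> \<partial>PiM I M) = (\<integral>\<^sup>+p. h ((snd p)(l := fst p)) \<partial>(M l \<Otimes>\<^sub>M PiM ?J M))"
      by (subst D, subst nn_integral_distr) (auto simp: case_prod_beta')
    also have "\<dots> = (\<integral>\<^sup>+X. (\<integral>\<^sup>+x. h (X(l := x)) \<partial>M l) \<partial>PiM ?J M)"
      by (subst lJ.nn_integral_snd[symmetric])
        (use measurable_compose[OF upd that] in \<open>auto simp: case_prod_beta' comp_def\<close>)
    finally show ?thesis .
  qed
  show ?thesis
    by (subst E[OF f], subst E[OF g]) (simp add: l.emeasure_space_1)
qed

text \<open>The whole pair is resampled first; the result is the resampling identity, read
  backwards, for the function that already averages over the second component.\<close>

lemma nn_integral_PiM_resample_snd: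
  assumes M: "\<And>i. i \<in> I \<Longrightarrow> prob_space (M i)" and l: "l \<in> I" and Ml: "M l = A \<Otimes>\<^sub>M B"
    and A: "prob_space A" and B: "prob_space B"
    and f[measurable]: "f \<in> borel_measurable (PiM I M)"
  shows "(\<integral>\<^sup>+\<omega>. f \<omega> \<partial>PiM I M) = (\<integral>\<^sup>+\<omega>. (\<integral>\<^sup>+u. f (fun_upd \<omega> l (fst (\<omega> l), u)) \<partial>B) \<partial>PiM I M)"
proof -
  interpret A: prob_space A by fact
  interpret B: prob_space B by fact
  interpret AB: pair_prob_space A B ..
  have upd: "(\<lambda>(X, x). X(l := x)) \<in> PiM I M \<Otimes>\<^sub>M M l \<rightarrow>\<^sub>M PiM I M"
    by (subst measurable_split_conv, rule measurable_fun_upd[where J=I]) (use l in auto)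
  have upd1: "\<omega> \<in> space (PiM I M) \<Longrightarrow> (\<lambda>x. fun_upd \<omega> l (x)) \<in> A \<Otimes>\<^sub>M B \<rightarrow>\<^sub>M PiM I M" for \<omega>
    using measurable_compose[OF measurable_Pair1' upd] by (simp add: Ml)
  have g: "(\<lambda>\<omega>. \<integral>\<^sup>+u. f (fun_upd \<omega> l (fst (\<omega> l), u)) \<partial>B) \<in> borel_measurable (PiM I M)"
  proof (intro B.borel_measurable_nn_integral, simp add: case_prod_beta')
    have "(\<lambda>p. (fst p, (fst (fst p l), snd p))) \<in> PiM I M \<Otimes>\<^sub>M B \<rightarrow>\<^sub>M PiM I M \<Otimes>\<^sub>M M l"
      using l unfolding Ml by (intro measurable_Pair measurable_fst measurable_snd
        measurable_compose[OF measurable_compose[OF measurable_fst measurable_component_singleton[OF l]]])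
        (auto simp: Ml)
    from measurable_compose[OF measurable_compose[OF this upd] f]
    show "(\<lambda>x. f ((fst x)(l := (fst (fst x l), snd x)))) \<in> borel_measurable (PiM I M \<Otimes>\<^sub>M B)"
      by (simp add: case_prod_beta')
  qed
  have "(\<integral>\<^sup>+\<omega>. f \<omega> \<partial>PiM I M) = (\<integral>\<^sup>+\<omega>. (\<integral>\<^sup>+a. \<integral>\<^sup>+u. f (fun_upd \<omega> l ((a, u))) \<partial>B \<partial>A) \<partial>PiM I M)"
    by (subst nn_integral_PiM_resample[OF M l f])
      (auto intro!: nn_integral_cong simp: Ml B.nn_integral_fst[symmetric] measurable_compose[OF upd1 f])
  also have "\<dots> = (\<integral>\<^sup>+\<omega>. (\<integral>\<^sup>+x. (\<integral>\<^sup>+u. f (fun_upd \<omega> l ((fst x, u))) \<partial>B) \<partial>(A \<Otimes>\<^sub>M B)) \<partial>PiM I M)"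
  proof (intro nn_integral_cong)
    fix \<omega> assume "\<omega> \<in> space (PiM I M)"
    from measurable_compose[OF upd1[OF this] f]
    have [measurable]: "(\<lambda>x. f (fun_upd \<omega> l (x))) \<in> borel_measurable (A \<Otimes>\<^sub>M B)" .
    show "(\<integral>\<^sup>+a. \<integral>\<^sup>+u. f (fun_upd \<omega> l ((a, u))) \<partial>B \<partial>A) = (\<integral>\<^sup>+x. (\<integral>\<^sup>+u. f (fun_upd \<omega> l ((fst x, u))) \<partial>B) \<partial>(A \<Otimes>\<^sub>M B))"
      by (subst B.nn_integral_fst[symmetric]) (simp_all add: B.emeasure_space_1)
  qed
  also have "\<dots> = (\<integral>\<^sup>+\<omega>. (\<integral>\<^sup>+u. f (fun_upd \<omega> l (fst (\<omega> l), u)) \<partial>B) \<partial>PiM I M)"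
    using nn_integral_PiM_resample[OF M l g] by (simp add: Ml)
  finally show ?thesis .
qed

lemma nn_integral_PiM_swap:
  assumes M: "\<And>i. i \<in> I \<Longrightarrow> prob_space (M i)" and ij: "i \<in> I" "j \<in> I" "M i = M j"
    and f[measurable]: "f \<in> borel_measurable (PiM I M)"
  shows "(\<integral>\<^sup>+\<omega>. f \<omega> \<partial>PiM I M) = (\<integral>\<^sup>+\<omega>. f (\<lambda>n\<in>I. \<omega> (Transposition.transpose i j n)) \<partial>PiM I M)"
proof -
  let ?t = "Transposition.transpose i j"
  have eq: "PiM I (\<lambda>n. M (?t n)) = PiM I M"
    using ij by (intro PiM_cong) (auto simp: Transposition.transpose_def)
  have "inj_on ?t I" by simp
  moreover have "?t \<in> I \<rightarrow> I" using ij by (auto simp: Transposition.transpose_def)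
  ultimately have "distr (PiM I M) (PiM I M) (\<lambda>\<omega>. \<lambda>n\<in>I. \<omega> (?t n)) = PiM I M"
    using distr_PiM_reindex[of I M ?t I, OF M] unfolding eq by blast
  moreover have "(\<lambda>\<omega>. \<lambda>n\<in>I. \<omega> (?t n)) \<in> PiM I M \<rightarrow>\<^sub>M PiM I M"
    by (subst (2) eq[symmetric], rule measurable_restrict)
      (use ij in \<open>auto intro!: measurable_component_singleton simp: Transposition.transpose_def\<close>)
  ultimately show ?thesis
    using nn_integral_distr[of "\<lambda>\<omega>. \<lambda>n\<in>I. \<omega> (?t n)" "PiM I M" "PiM I M" f] by simp
qed

section \<open>Conformal p-values under the null law\<close>

lemma prob_space_unif01: "prob_space unif01"
  unfolding unif01_def by (rule prob_space_uniform_measure) auto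

lemma space_unif01 [simp]: "space unif01 = UNIV"
  by (simp add: unif01_def)

lemma sets_unif01 [simp, measurable_cong]: "sets unif01 = sets borel"
  by (simp add: unif01_def)

lemma nn_integral_unif01:
  "g \<in> borel_measurable borel \<Longrightarrow> (\<integral>\<^sup>+u. g u \<partial>unif01) = (\<integral>\<^sup>+u. g u * indicator {0..1} u \<partial>lborel)"
  unfolding unif01_def by (subst nn_integral_uniform_measure) (auto simp: divide_ennreal_def)

lemma AE_unif01: "AE u in unif01. u \<in> {0..1}"
  unfolding unif01_def by (rule AE_uniform_measureI) auto

text \<open>A smaller value has a strictly smaller rank, so without ties the ranks are a permutation
  of 0, ..., t - 1.\<close>

lemma sum_rank:
  fixes z :: "nat \<Rightarrow> real" and q :: "nat \<Rightarrow> 'b::comm_monoid_add"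
  assumes "inj_on z {1..t}"
  shows "(\<Sum>l=1..t. q (card {i\<in>{1..t}. z i < z l})) = (\<Sum>n<t. q n)"
proof -
  let ?r = "\<lambda>l. card {i\<in>{1..t}. z i < z l}"
  have less: "?r l < ?r l'" if "l \<in> {1..t}" "z l < z l'" for l l'
  proof (rule psubset_card_mono)
    have "l \<in> {i\<in>{1..t}. z i < z l'} - {i\<in>{1..t}. z i < z l}" using that by simp
    moreover have "{i\<in>{1..t}. z i < z l} \<subseteq> {i\<in>{1..t}. z i < z l'}" using that(2) by fastforce
    ultimately show "{i\<in>{1..t}. z i < z l} \<subset> {i\<in>{1..t}. z i < z l'}" by blast
  qed simp
  have inj: "inj_on ?r {1..t}"
  proof (rule inj_onI, rule ccontr)
    fix l l' assume l: "l \<in> {1..t}" "l' \<in> {1..t}" "?r l = ?r l'" "l \<noteq> l'"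
    then have "z l \<noteq> z l'" using assms by (auto dest: inj_onD)
    then show False using less[of l l'] less[of l' l] l by linarith
  qed
  have sub: "?r ` {1..t} \<subseteq> {..<t}"
  proof safe
    fix l assume "l \<in> {1..t}"
    then have "{i\<in>{1..t}. z i < z l} \<subset> {1..t}" by blast
    then have "?r l < card {1..t}" by (rule psubset_card_mono[rotated]) simp
    then show "?r l < t" by simp
  qed
  have "?r ` {1..t} = {..<t}"
    by (rule card_subset_eq) (use sub inj in \<open>auto simp: card_image\<close>)
  then have "bij_betw ?r {1..t} {..<t}" using inj by (simp add: bij_betw_def)
  then show ?thesis by (rule sum.reindex_bij_betw)
qed

text \<open>The map u -> (n + u) / t carries [0,1] onto the n-th of t equal cells, and cells overlap
  only in null sets. This turns a uniform rank plus an independent randomizer into a uniform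
  variable.\<close>

lemma nn_integral_unif01_split:
  fixes g :: "real \<Rightarrow> ennreal"
  assumes [measurable]: "g \<in> borel_measurable borel" and t: "t \<ge> 1"
  shows "(\<Sum>n<t. \<integral>\<^sup>+u. g ((real n + u) / real t) \<partial>unif01) = of_nat t * (\<integral>\<^sup>+u. g u \<partial>unif01)"
proof -
  let ?A = "\<lambda>n. {real n / real t .. real (Suc n) / real t}"
  have t0: "real t > 0" using t by simp
  have *: "(\<integral>\<^sup>+u. g ((real n + u) / real t) \<partial>unif01) = of_nat t * (\<integral>\<^sup>+v. g v * indicator (?A n) v \<partial>lborel)" for n
  proof -
    have "(\<integral>\<^sup>+v. g v * indicator (?A n) v \<partial>lborel) =
      ennreal \<bar>1 / real t\<bar> * (\<integral>\<^sup>+u. g (real n / real t + 1 / real t * u) * indicator (?A n) (real n / real t + 1 / real t * u) \<partial>lborel)"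
      using t0 by (intro nn_integral_real_affine) auto
    also have "(\<lambda>u. g (real n / real t + 1 / real t * u) * indicator (?A n) (real n / real t + 1 / real t * u))
      = (\<lambda>u. g ((real n + u) / real t) * indicator {0..1} u)"
      using t0 by (intro ext arg_cong2[where f="(*)"]) (auto simp: field_simps indicator_def)
    finally have "(\<integral>\<^sup>+v. g v * indicator (?A n) v \<partial>lborel) = ennreal (1 / real t) * (\<integral>\<^sup>+u. g ((real n + u) / real t) \<partial>unif01)"
      by (simp add: nn_integral_unif01)
    moreover have "of_nat t * (ennreal (1 / real t) * x) = x" for x
      using t0 by (simp add: ennreal_of_nat_eq_real_of_nat mult.assoc[symmetric] ennreal_mult[symmetric])
    ultimately show ?thesis by simp
  qed
  have "(\<Sum>n<m. \<integral>\<^sup>+v. g v * indicator (?A n) v \<partial>lborel) = (\<integral>\<^sup>+v. g v * indicator {0..real m / real t} v \<partial>lborel)" for m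
  proof (induction m)
    case 0
    have "(\<integral>\<^sup>+v. g v * indicator {0..0} v \<partial>lborel) = (\<integral>\<^sup>+v. 0 \<partial>(lborel :: real measure))"
      by (rule nn_integral_cong_AE, rule eventually_mono[OF AE_lborel_singleton[of "0::real"]]) auto
    then show ?case by simp
  next
    case (Suc m)
    have "(\<integral>\<^sup>+v. g v * indicator {0..real (Suc m) / real t} v \<partial>lborel) =
      (\<integral>\<^sup>+v. g v * indicator {0..real m / real t} v + g v * indicator (?A m) v \<partial>lborel)"
    proof (rule nn_integral_cong_AE, rule eventually_mono[OF AE_lborel_singleton[of "real m / real t"]])
      fix v :: real assume v: "v \<noteq> real m / real t"
      have gen: "g v * indicator {0..b} v = g v * indicator {0..a} v + g v * indicator {a..b} v"
        if "0 \<le> a" "a \<le> b" "v \<noteq> a" for a b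
        using that by (auto simp: indicator_def)
      from t0 v show "g v * indicator {0..real (Suc m) / real t} v =
        g v * indicator {0..real m / real t} v + g v * indicator (?A m) v"
        by (intro gen) (auto simp: divide_right_mono)
    qed
    also have "\<dots> = (\<integral>\<^sup>+v. g v * indicator {0..real m / real t} v \<partial>lborel) + (\<integral>\<^sup>+v. g v * indicator (?A m) v \<partial>lborel)"
      by (rule nn_integral_add) auto
    finally show ?case using Suc.IH by simp
  qed
  from this[of t] show ?thesis
    using t0 by (simp add: * sum_distrib_left[symmetric] nn_integral_unif01)
qed

lemma space_null_law: "space (null_law P0) = (\<Pi>\<^sub>E i\<in>{1..}. space P0 \<times> UNIV)"
  by (simp add: null_law_def space_PiM space_pair_measure)

lemma measurable_obs [measurable]: "1 \<le> i \<Longrightarrow> obs i \<in> null_law P0 \<rightarrow>\<^sub>M P0"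
  unfolding null_law_def by measurable

lemma measurable_rnd [measurable]: "1 \<le> i \<Longrightarrow> rnd i \<in> null_law P0 \<rightarrow>\<^sub>M borel"
  unfolding null_law_def by measurable

text \<open>Kept free of the choice of \<open>M\<close> so that it serves both the null law and the
  finite-time \<open>rand_filtration\<close>.\<close>

lemma measurable_conf_p_general:
  assumes s: "s \<in> borel_measurable P" and t: "1 \<le> t"
    and obs: "\<And>i. 1 \<le> i \<Longrightarrow> i \<le> t \<Longrightarrow> obs i \<in> M \<rightarrow>\<^sub>M P" and rnd [measurable]: "rnd t \<in> borel_measurable M"
  shows "conf_p s t \<in> borel_measurable M"
proof -
  have so: "(\<lambda>\<omega>. s (obs i \<omega>)) \<in> borel_measurable M" if "1 \<le> i" "i \<le> t" for i
    using measurable_compose[OF obs[OF that] s] .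
  have [measurable]: "(\<lambda>\<omega>. s (obs i \<omega>)) \<in> borel_measurable M" if "i \<in> {1..t}" for i
    using that by (intro so) auto
  note [measurable] = so[OF t order.refl]
  show ?thesis
    unfolding conf_p_def of_bool_def by measurable
qed

lemma measurable_conf_p:
  assumes "s \<in> borel_measurable P0" and t: "1 \<le> t"
  shows "conf_p s t \<in> borel_measurable (null_law P0)"
  using assms(1) t measurable_obs measurable_rnd[OF t] by (rule measurable_conf_p_general)

lemma prob_space_pair_unif01: "prob_space P \<Longrightarrow> prob_space (P \<Otimes>\<^sub>M unif01)"
  by (intro prob_space_pair prob_space_unif01)

lemma prob_space_null_law: "prob_space P0 \<Longrightarrow> prob_space (null_law P0)"
  unfolding null_law_def by (intro prob_space_PiM prob_space_pair_unif01)

lemma nn_integral_null_law_resample: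
  assumes "prob_space P0" "1 \<le> l" "g \<in> borel_measurable (null_law P0)"
  shows "(\<integral>\<^sup>+\<omega>. g \<omega> \<partial>null_law P0) = (\<integral>\<^sup>+\<omega>. (\<integral>\<^sup>+x. g (fun_upd \<omega> l x) \<partial>(P0 \<Otimes>\<^sub>M unif01)) \<partial>null_law P0)"
  unfolding null_law_def
  by (rule nn_integral_PiM_resample)
    (use assms prob_space_pair_unif01 in \<open>auto simp: null_law_def\<close>)

lemma nn_integral_null_law_resample_rnd:
  assumes "prob_space P0" "1 \<le> l" "g \<in> borel_measurable (null_law P0)"
  shows "(\<integral>\<^sup>+\<omega>. g \<omega> \<partial>null_law P0) = (\<integral>\<^sup>+\<omega>. (\<integral>\<^sup>+u. g (fun_upd \<omega> l (obs l \<omega>, u)) \<partial>unif01) \<partial>null_law P0)"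
  unfolding null_law_def
  by (rule nn_integral_PiM_resample_snd)
    (use assms prob_space_pair_unif01 prob_space_unif01 in \<open>auto simp: null_law_def\<close>)

lemma nn_integral_null_law_swap:
  assumes "prob_space P0" "1 \<le> l" "1 \<le> k" "g \<in> borel_measurable (null_law P0)"
  shows "(\<integral>\<^sup>+\<omega>. g \<omega> \<partial>null_law P0) =
    (\<integral>\<^sup>+\<omega>. g (\<lambda>n\<in>{1..}. \<omega> (Transposition.transpose l k n)) \<partial>null_law P0)"
  unfolding null_law_def
  by (rule nn_integral_PiM_swap)
    (use assms prob_space_pair_unif01 in \<open>auto simp: null_law_def\<close>)

text \<open>With the i-th score fixed and coordinate \<open>j\<close> resampled, a tie means hitting
  a prescribed level, which has probability 0 because a continuous distribution function has no
  atoms.\<close>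

lemma AE_no_ties:
  assumes P0: "prob_space P0" and s[measurable]: "s \<in> borel_measurable P0"
    and cont: "continuous_on UNIV (cdf (distr P0 borel s))" and ij: "1 \<le> i" "1 \<le> j" "i \<noteq> j"
  shows "AE \<omega> in null_law P0. s (obs i \<omega>) \<noteq> s (obs j \<omega>)"
proof -
  interpret P0: prob_space P0 by fact
  interpret U: prob_space unif01 by (rule prob_space_unif01)
  interpret PU: pair_prob_space P0 unif01 ..
  interpret d: prob_space "distr P0 borel s" by (intro P0.prob_space_distr) simp
  interpret d: finite_borel_measure "distr P0 borel s" by standard simp
  have [measurable]: "(\<lambda>\<omega>. s (obs i \<omega>)) \<in> borel_measurable (null_law P0)" "(\<lambda>\<omega>. s (obs j \<omega>)) \<in> borel_measurable (null_law P0)"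
    using ij by measurable
  have c: "AE x in P0. s x \<noteq> c" for c
  proof -
    have "measure (distr P0 borel s) {c} = 0"
      using cont by (subst d.isCont_cdf[symmetric]) (simp add: continuous_on_eq_continuous_at)
    then have "emeasure P0 {x\<in>space P0. s x = c} = 0"
      by (simp add: P0.emeasure_eq_measure measure_distr vimage_def Int_def conj_commute)
    then show ?thesis by (intro AE_I[of _ _ "{x\<in>space P0. s x = c}"]) auto
  qed
  have c2: "AE x in P0 \<Otimes>\<^sub>M unif01. s (fst x) \<noteq> c" for c
  proof (rule AE_distrD[of fst _ P0])
    show "AE x in distr (P0 \<Otimes>\<^sub>M unif01) P0 fst. s x \<noteq> c"
      unfolding U.distr_pair_fst by (rule c)
  qed simp
  define E where "E = {\<omega>\<in>space (null_law P0). s (obs i \<omega>) = s (obs j \<omega>)}"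
  have E: "E \<in> sets (null_law P0)" unfolding E_def by measurable
  have "emeasure (null_law P0) E = (\<integral>\<^sup>+\<omega>. indicator E \<omega> \<partial>null_law P0)"
    using E by simp
  also have "\<dots> = (\<integral>\<^sup>+\<omega>. (\<integral>\<^sup>+x. indicator E (fun_upd \<omega> j x) \<partial>(P0 \<Otimes>\<^sub>M unif01)) \<partial>null_law P0)"
    using P0 ij(2) borel_measurable_indicator[OF E] by (rule nn_integral_null_law_resample)
  also have "\<dots> = (\<integral>\<^sup>+\<omega>. 0 \<partial>null_law P0)"
  proof (rule nn_integral_cong)
    fix \<omega>
    have "(\<integral>\<^sup>+x. indicator E (fun_upd \<omega> j x) \<partial>(P0 \<Otimes>\<^sub>M unif01)) = (\<integral>\<^sup>+x. 0 \<partial>(P0 \<Otimes>\<^sub>M unif01))"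
      using c2[of "s (obs i \<omega>)"]
      by (intro nn_integral_cong_AE) (auto simp: indicator_def E_def ij elim!: eventually_mono)
    then show "(\<integral>\<^sup>+x. indicator E (fun_upd \<omega> j x) \<partial>(P0 \<Otimes>\<^sub>M unif01)) = 0" by simp
  qed
  finally have "E \<in> null_sets (null_law P0)" using E by auto
  then show ?thesis
    by (rule AE_I') (auto simp: E_def)
qed

text \<open>The restriction keeps the permuted path extensional, hence inside the product
  space.\<close>

definition swap_coords :: "nat \<Rightarrow> nat \<Rightarrow> 'a path \<Rightarrow> 'a path" where
  "swap_coords l k \<omega> = (\<lambda>n\<in>{1..}. \<omega> (Transposition.transpose l k n))"

lemma bij_betw_transpose_upto:
  assumes "l \<in> {1..j}" "k \<in> {1..j}"
  shows "bij_betw (Transposition.transpose l k) {1..j} {1..j}"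
  unfolding bij_betw_def using assms by (simp add: transpose_image_eq)

lemma swap_coords_nth: "1 \<le> n \<Longrightarrow> swap_coords l k \<omega> n = \<omega> (Transposition.transpose l k n)"
  by (simp add: swap_coords_def)

lemma sum_swap_coords:
  assumes "l \<in> {1..j}" "k \<in> {1..j}"
  shows "(\<Sum>i=1..j. G (swap_coords l k \<omega> i)) = (\<Sum>i=1..j. G (\<omega> i))"
proof -
  have "(\<Sum>i=1..j. G (swap_coords l k \<omega> i)) = (\<Sum>i=1..j. G (\<omega> (Transposition.transpose l k i)))"
    by (intro sum.cong) (auto simp: swap_coords_nth)
  also have "\<dots> = (\<Sum>i=1..j. G (\<omega> i))"
    by (rule sum.reindex_bij_betw[OF bij_betw_transpose_upto[OF assms]])
  finally show ?thesis .
qed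

text \<open>A p-value after time \<open>k\<close> sees the first \<open>k\<close> observations only
  through symmetric sums. This invariance is what makes later p-values independent of the rank at
  time \<open>k\<close>.\<close>

lemma conf_p_swap_coords:
  assumes "l \<in> {1..k}" "1 \<le> k" "k < j"
  shows "conf_p s j (swap_coords l k \<omega>) = conf_p s j \<omega>"
proof -
  have j: "swap_coords l k \<omega> j = \<omega> j"
    using assms by (subst swap_coords_nth) (auto simp: Transposition.transpose_def)
  have lk: "l \<in> {1..j}" "k \<in> {1..j}" using assms by auto
  show ?thesis
    unfolding conf_p_def j
      sum_swap_coords[OF lk, where G="\<lambda>x. of_bool (s (fst x) < s (obs j \<omega>)) :: real"]
      sum_swap_coords[OF lk, where G="\<lambda>x. of_bool (s (fst x) = s (obs j \<omega>)) :: real"] ..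
qed

lemma conf_p_cong:
  assumes "\<And>i. 1 \<le> i \<Longrightarrow> i \<le> j \<Longrightarrow> obs i \<omega> = obs i \<omega>'" "rnd j \<omega> = rnd j \<omega>'" "1 \<le> j"
  shows "conf_p s j \<omega> = conf_p s j \<omega>'"
  unfolding conf_p_def using assms by simp

text \<open>Separate indices for the ranked observation and the comparison range let a swap move the
  rank of the k-th score to that of the l-th, both still taken among the first
  \<open>k\<close>.\<close>

definition count_below :: "('a \<Rightarrow> real) \<Rightarrow> nat \<Rightarrow> nat \<Rightarrow> 'a path \<Rightarrow> nat" where
  "count_below s k l \<omega> = card {i\<in>{1..k}. s (obs i \<omega>) < s (obs l \<omega>)}"

lemma count_below_sum: "real (count_below s k l \<omega>) = (\<Sum>i=1..k. of_bool (s (obs i \<omega>) < s (obs l \<omega>)))"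
  unfolding count_below_def by (simp add: sum.If_cases of_bool_def Int_def)

lemma conf_p_no_ties:
  assumes "inj_on (\<lambda>i. s (obs i \<omega>)) {1..k}" "1 \<le> k"
  shows "conf_p s k \<omega> = (real (count_below s k k \<omega>) + rnd k \<omega>) / real k"
proof -
  have "(\<Sum>i=1..k. of_bool (s (obs i \<omega>) = s (obs k \<omega>))) = (\<Sum>i=1..k. if k = i then 1 else (0::real))"
    using assms by (intro sum.cong) (auto dest: inj_onD)
  then show ?thesis using assms(2) by (simp add: conf_p_def count_below_sum)
qed

lemma measurable_count_below:
  assumes [measurable]: "s \<in> borel_measurable P0" and l: "1 \<le> l"
  shows "(\<lambda>\<omega>. real (count_below s k l \<omega>)) \<in> borel_measurable (null_law P0)"
proof -
  have [measurable]: "(\<lambda>\<omega>. s (obs i \<omega>)) \<in> borel_measurable (null_law P0)" if "1 \<le> i" for i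
    using that by measurable
  note [measurable] = this[OF l]
  show ?thesis unfolding count_below_sum of_bool_def by measurable
qed

lemma AE_inj_scores:
  assumes P0: "prob_space P0" and s[measurable]: "s \<in> borel_measurable P0"
    and cont: "continuous_on UNIV (cdf (distr P0 borel s))"
  shows "AE \<omega> in null_law P0. inj_on (\<lambda>i. s (obs i \<omega>)) {1..k}"
proof -
  have "AE \<omega> in null_law P0. \<forall>i\<in>{1..k}. \<forall>j\<in>{1..k}. i \<noteq> j \<longrightarrow> s (obs i \<omega>) \<noteq> s (obs j \<omega>)"
    using AE_no_ties[OF assms] by (intro AE_finite_allI AE_impI) auto
  then show ?thesis by (rule eventually_mono) (auto intro!: inj_onI)
qed

text \<open>
  Integrating out the randomizer of the \<open>k\<close>-th observation leaves a function of its rank among the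
  first \<open>k\<close> scores, and by exchangeability that rank may be averaged over all of them.
\<close>
lemma nn_integral_conf_p_mult:
  assumes P0: "prob_space P0" and s[measurable]: "s \<in> borel_measurable P0"
    and cont: "continuous_on UNIV (cdf (distr P0 borel s))" and k: "1 \<le> k"
    and g[measurable]: "g \<in> borel_measurable borel" and \<Phi>[measurable]: "\<Phi> \<in> borel_measurable (null_law P0)"
    and \<Phi>_rnd: "\<And>\<omega> u. \<Phi> (fun_upd \<omega> k (obs k \<omega>, u)) = \<Phi> \<omega>"
    and \<Phi>_swap: "\<And>\<omega> l. l \<in> {1..k} \<Longrightarrow> \<Phi> (swap_coords l k \<omega>) = \<Phi> \<omega>"
  shows "(\<integral>\<^sup>+\<omega>. g (conf_p s k \<omega>) * \<Phi> \<omega> \<partial>null_law P0) = (\<integral>\<^sup>+u. g u \<partial>unif01) * (\<integral>\<^sup>+\<omega>. \<Phi> \<omega> \<partial>null_law P0)"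
proof -
  let ?N = "null_law P0"
  interpret U: prob_space unif01 by (rule prob_space_unif01)
  note [measurable] = measurable_conf_p[OF s k] measurable_rnd[OF k]
  have [measurable]: "(\<lambda>\<omega>. real (count_below s k l \<omega>)) \<in> borel_measurable ?N" if "l \<in> {1..k}" for l
    using that by (intro measurable_count_below s) auto
  note [measurable] = measurable_count_below[OF s k]
  \<comment> \<open>\<open>q x\<close> is the mean of \<open>g\<close> at the p-value when the rank
    is \<open>x\<close> and only the randomizer is random.\<close>
  define q where "q x = (\<integral>\<^sup>+u. g ((x + u) / real k) \<partial>unif01)" for x :: real
  have [measurable]: "q \<in> borel_measurable borel" unfolding q_def by measurable
  have "(\<integral>\<^sup>+\<omega>. g (conf_p s k \<omega>) * \<Phi> \<omega> \<partial>?N) = (\<integral>\<^sup>+\<omega>. g ((real (count_below s k k \<omega>) + rnd k \<omega>) / real k) * \<Phi> \<omega> \<partial>?N)"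
    by (intro nn_integral_cong_AE, rule eventually_mono[OF AE_inj_scores[OF P0 s cont, of k]])
      (simp only: conf_p_no_ties[OF _ k])
  also have "\<dots> = (\<integral>\<^sup>+\<omega>. (\<integral>\<^sup>+u. g ((real (count_below s k k (fun_upd \<omega> k (obs k \<omega>, u))) + rnd k (fun_upd \<omega> k (obs k \<omega>, u))) / real k) *
      \<Phi> (fun_upd \<omega> k (obs k \<omega>, u)) \<partial>unif01) \<partial>?N)"
    by (rule nn_integral_null_law_resample_rnd[OF P0 k]) measurable
  also have "\<dots> = (\<integral>\<^sup>+\<omega>. q (real (count_below s k k \<omega>)) * \<Phi> \<omega> \<partial>?N)"
  proof (rule nn_integral_cong)
    fix \<omega>
    have "count_below s k k (fun_upd \<omega> k (obs k \<omega>, u)) = count_below s k k \<omega>" for u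
    proof -
      have "obs i (fun_upd \<omega> k (obs k \<omega>, u)) = obs i \<omega>" for i by simp
      then show ?thesis unfolding count_below_def by presburger
    qed
    then show "(\<integral>\<^sup>+u. g ((real (count_below s k k (fun_upd \<omega> k (obs k \<omega>, u))) + rnd k (fun_upd \<omega> k (obs k \<omega>, u))) / real k) *
      \<Phi> (fun_upd \<omega> k (obs k \<omega>, u)) \<partial>unif01) = q (real (count_below s k k \<omega>)) * \<Phi> \<omega>"
      by (simp add: \<Phi>_rnd q_def nn_integral_multc del: fun_upd_apply)
        (simp add: nn_integral_multc)
  qed
  finally have A: "(\<integral>\<^sup>+\<omega>. g (conf_p s k \<omega>) * \<Phi> \<omega> \<partial>?N) = (\<integral>\<^sup>+\<omega>. q (real (count_below s k k \<omega>)) * \<Phi> \<omega> \<partial>?N)" .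
  have B: "(\<integral>\<^sup>+\<omega>. q (real (count_below s k k \<omega>)) * \<Phi> \<omega> \<partial>?N) = (\<integral>\<^sup>+\<omega>. q (real (count_below s k l \<omega>)) * \<Phi> \<omega> \<partial>?N)"
    if l: "l \<in> {1..k}" for l
  proof -
    have "(\<integral>\<^sup>+\<omega>. q (real (count_below s k k \<omega>)) * \<Phi> \<omega> \<partial>?N) =
      (\<integral>\<^sup>+\<omega>. q (real (count_below s k k (swap_coords l k \<omega>))) * \<Phi> (swap_coords l k \<omega>) \<partial>?N)"
      unfolding swap_coords_def by (rule nn_integral_null_law_swap[OF P0 _ k]) (use l in \<open>simp, measurable\<close>)
    moreover have "real (count_below s k k (swap_coords l k \<omega>)) = real (count_below s k l \<omega>)" for \<omega>
    proof -
      have kk: "swap_coords l k \<omega> k = \<omega> l" using k by (simp add: swap_coords_nth)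
      show ?thesis
        unfolding count_below_sum kk using l
        by (intro sum_swap_coords[where G="\<lambda>x. of_bool (s (fst x) < s (obs l \<omega>))"]) auto
    qed
    ultimately show ?thesis by (simp add: \<Phi>_swap[OF l])
  qed
  \<comment> \<open>Multiplying by \<open>k\<close> turns the average over \<open>l\<close> into a
    sum over all ranks; the factor, nonzero and finite, is cancelled at the end.\<close>
  have "of_nat k * (\<integral>\<^sup>+\<omega>. g (conf_p s k \<omega>) * \<Phi> \<omega> \<partial>?N) = (\<Sum>l=1..k. \<integral>\<^sup>+\<omega>. q (real (count_below s k k \<omega>)) * \<Phi> \<omega> \<partial>?N)"
    by (simp add: A)
  also have "\<dots> = (\<Sum>l=1..k. \<integral>\<^sup>+\<omega>. q (real (count_below s k l \<omega>)) * \<Phi> \<omega> \<partial>?N)"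
    by (rule sum.cong[OF refl], rule B)
  also have "\<dots> = (\<integral>\<^sup>+\<omega>. (\<Sum>l=1..k. q (real (count_below s k l \<omega>)) * \<Phi> \<omega>) \<partial>?N)"
    by (rule nn_integral_sum[symmetric]) measurable
  also have "\<dots> = (\<integral>\<^sup>+\<omega>. (of_nat k * (\<integral>\<^sup>+u. g u \<partial>unif01)) * \<Phi> \<omega> \<partial>?N)"
  proof (intro nn_integral_cong_AE, rule eventually_mono[OF AE_inj_scores[OF P0 s cont, of k]])
    fix \<omega> assume inj: "inj_on (\<lambda>i. s (obs i \<omega>)) {1..k}"
    have "(\<Sum>l=1..k. q (real (count_below s k l \<omega>))) = (\<Sum>n<k. q (real n))"
      unfolding count_below_def using sum_rank[OF inj, of "\<lambda>n. q (real n)"] by simp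
    also have "\<dots> = of_nat k * (\<integral>\<^sup>+u. g u \<partial>unif01)"
      unfolding q_def by (rule nn_integral_unif01_split[OF g k])
    finally show "(\<Sum>l=1..k. q (real (count_below s k l \<omega>)) * \<Phi> \<omega>) = (of_nat k * (\<integral>\<^sup>+u. g u \<partial>unif01)) * \<Phi> \<omega>"
      by (simp add: sum_distrib_right[symmetric])
  qed
  also have "\<dots> = of_nat k * ((\<integral>\<^sup>+u. g u \<partial>unif01) * (\<integral>\<^sup>+\<omega>. \<Phi> \<omega> \<partial>?N))"
    by (simp add: nn_integral_cmult mult.assoc)
  finally show ?thesis
    using k by (subst (asm) ennreal_mult_cancel_left) auto
qed

text \<open>Downward induction peels off the earliest p-value: the remaining factors do not involve
  its randomizer and are symmetric in the first \<open>k\<close> observations, exactly what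
  \<open>nn_integral_conf_p_mult\<close> asks of its second factor. The base case is the empty
  product at k = T + 1.\<close>

lemma nn_integral_prod_conf_p:
  assumes P0: "prob_space P0" and s[measurable]: "s \<in> borel_measurable P0"
    and cont: "continuous_on UNIV (cdf (distr P0 borel s))"
    and g: "\<And>j. g j \<in> borel_measurable borel"
    and k: "1 \<le> k" "k \<le> Suc T"
  shows "(\<integral>\<^sup>+\<omega>. (\<Prod>j=k..T. g j (conf_p s j \<omega>)) \<partial>null_law P0) = (\<Prod>j=k..T. \<integral>\<^sup>+u. g j u \<partial>unif01)"
  using k(2,1)
proof (induction k rule: inc_induct)
  case base
  interpret prob_space "null_law P0" using P0 by (rule prob_space_null_law)
  show ?case by (simp add: emeasure_space_1)
next
  case (step k)
  then have k: "1 \<le> k" by simp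
  have split: "{k..T} = insert k {Suc k..T}" using step by auto
  define \<Phi> where "\<Phi> \<omega> = (\<Prod>j=Suc k..T. g j (conf_p s j \<omega>))" for \<omega>
  have [measurable]: "\<Phi> \<in> borel_measurable (null_law P0)"
    unfolding \<Phi>_def using k
    by (intro borel_measurable_prod_ennreal measurable_compose[OF measurable_conf_p[OF s] g]) auto
  have "(\<integral>\<^sup>+\<omega>. g k (conf_p s k \<omega>) * \<Phi> \<omega> \<partial>null_law P0) = (\<integral>\<^sup>+u. g k u \<partial>unif01) * (\<integral>\<^sup>+\<omega>. \<Phi> \<omega> \<partial>null_law P0)"
  proof (rule nn_integral_conf_p_mult[OF P0 s cont k g])
    fix \<omega> u
    have "conf_p s j (fun_upd \<omega> k (obs k \<omega>, u)) = conf_p s j \<omega>" if "j \<in> {Suc k..T}" for j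
      using that by (intro conf_p_cong) auto
    then show "\<Phi> (fun_upd \<omega> k (obs k \<omega>, u)) = \<Phi> \<omega>"
      unfolding \<Phi>_def by (intro prod.cong refl) metis
  next
    fix \<omega> :: "'a path" and l assume "l \<in> {1..k}"
    then have "conf_p s j (swap_coords l k \<omega>) = conf_p s j \<omega>" if "j \<in> {Suc k..T}" for j
      using that k by (intro conf_p_swap_coords) auto
    then show "\<Phi> (swap_coords l k \<omega>) = \<Phi> \<omega>"
      unfolding \<Phi>_def by (intro prod.cong refl) metis
  qed measurable
  then show ?case
    unfolding split using step.IH k by (simp add: \<Phi>_def)
qed

section \<open>The joint null law of the p-value sequence\<close>

definition conf_path :: "('a \<Rightarrow> real) \<Rightarrow> 'a path \<Rightarrow> nat \<Rightarrow> real" where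
  "conf_path s \<omega> = (\<lambda>j\<in>{1..}. conf_p s j \<omega>)"

definition unif_law :: "(nat \<Rightarrow> real) measure" where
  "unif_law = (\<Pi>\<^sub>M i\<in>{1..}. unif01)"

lemma measurable_conf_path:
  assumes "s \<in> borel_measurable P0"
  shows "conf_path s \<in> null_law P0 \<rightarrow>\<^sub>M unif_law"
  unfolding conf_path_def unif_law_def
  by (rule measurable_restrict) (use measurable_conf_p[OF assms] in auto)

theorem distr_conf_path:
  assumes P0: "prob_space P0" and s: "s \<in> borel_measurable P0"
    and cont: "continuous_on UNIV (cdf (distr P0 borel s))"
  shows "distr (null_law P0) unif_law (conf_path s) = unif_law"
proof -
  interpret U: prob_space unif01 by (rule prob_space_unif01)
  interpret UP: product_prob_space "\<lambda>_::nat. unif01" "{1..}" ..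
  interpret N: prob_space "null_law P0" using P0 by (rule prob_space_null_law)
  show ?thesis
    unfolding unif_law_def
  proof (rule UP.PiM_eq, simp)
    fix J F assume J: "finite J" "J \<subseteq> {1::nat..}" and F: "\<And>j. j \<in> J \<Longrightarrow> F j \<in> sets unif01"
    obtain T where T: "J \<subseteq> {1..T}"
      using finite_nat_set_iff_bounded_le[of J] J by (metis atLeastAtMost_iff atLeast_iff subset_eq)
    define G where "G j = (if j \<in> J then F j else UNIV)" for j
    have G: "G j \<in> sets borel" for j using F by (auto simp: G_def)
    let ?E = "prod_emb {1..} (\<lambda>_. unif01) J (Pi\<^sub>E J F)"
    have E: "?E \<in> sets (Pi\<^sub>M {1..} (\<lambda>_. unif01))" using J F by (intro sets_PiM_I) auto
    have "emeasure (distr (null_law P0) (Pi\<^sub>M {1..} (\<lambda>_. unif01)) (conf_path s)) ?E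
      = (\<integral>\<^sup>+\<omega>. indicator ?E (conf_path s \<omega>) \<partial>null_law P0)"
      using nn_integral_distr[OF measurable_conf_path[OF s, unfolded unif_law_def], of "indicator ?E"] E
      by simp
    also have "\<dots> = (\<integral>\<^sup>+\<omega>. (\<Prod>j=1..T. indicator (G j) (conf_p s j \<omega>)) \<partial>null_law P0)"
    proof (rule nn_integral_cong)
      fix \<omega>
      have "conf_path s \<omega> \<in> ?E \<longleftrightarrow> (\<forall>j\<in>J. conf_p s j \<omega> \<in> F j)"
        using J by (auto simp: prod_emb_def conf_path_def PiE_iff subset_eq)
      also have "\<dots> \<longleftrightarrow> (\<forall>j\<in>{1..T}. conf_p s j \<omega> \<in> G j)"
        using T by (auto simp: G_def)
      finally show "indicator ?E (conf_path s \<omega>) = (\<Prod>j=1..T. indicator (G j) (conf_p s j \<omega>) :: ennreal)"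
        by (auto simp: indicator_def)
    qed
    also have "\<dots> = (\<Prod>j=1..T. emeasure unif01 (G j))"
      using G by (subst nn_integral_prod_conf_p[OF P0 s cont]) auto
    also have "\<dots> = (\<Prod>j\<in>J. emeasure unif01 (G j))"
      using T U.emeasure_space_1 by (intro prod.mono_neutral_right) (auto simp: G_def)
    also have "\<dots> = (\<Prod>j\<in>J. emeasure unif01 (F j))"
      by (intro prod.cong) (auto simp: G_def)
    finally show "emeasure (distr (null_law P0) (Pi\<^sub>M {1..} (\<lambda>_. unif01)) (conf_path s)) ?E = (\<Prod>j\<in>J. emeasure unif01 (F j))" .
  qed
qed

section \<open>False alarms of the e-detector\<close>

text \<open>
  Optional stopping for a sum of e-processes started at the times \<open>k \<ge> 1\<close>;
  \<open>A t\<close> is the event that the detector has not stopped by time \<open>t\<close>.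
\<close>
lemma e_detector_bound:
  fixes W :: "nat \<Rightarrow> nat \<Rightarrow> 'a \<Rightarrow> ennreal"
  assumes A[measurable]: "\<And>t. A t \<in> sets M" and A0: "A 0 = space M" and decr: "\<And>t. A (Suc t) \<subseteq> A t"
    and W[measurable]: "\<And>k t. 1 \<le> k \<Longrightarrow> k \<le> t \<Longrightarrow> W k t \<in> borel_measurable M"
    and start: "\<And>k. (\<integral>\<^sup>+x. W (Suc k) (Suc k) x * indicator (A k) x \<partial>M) \<le> emeasure M (A k)"
    and step: "\<And>k t. 1 \<le> k \<Longrightarrow> k \<le> t \<Longrightarrow>
      (\<integral>\<^sup>+x. W k (Suc t) x * indicator (A t) x \<partial>M) \<le> (\<integral>\<^sup>+x. W k t x * indicator (A t) x \<partial>M)"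
    and stop: "\<And>t x. x \<in> A t - A (Suc t) \<Longrightarrow> \<gamma> \<le> (\<Sum>k=1..Suc t. W k (Suc t) x)"
  shows "\<gamma> * emeasure M (space M - A m) \<le> (\<Sum>k<m. emeasure M (A k))"
proof -
  \<comment> \<open>\<open>a k t\<close> is what the process started at \<open>Suc k\<close>
    contributes on the event of stopping at time \<open>Suc t\<close>; its index is shifted so that
    \<open>A k\<close> is the event of running just before the start.\<close>
  define a where "a k t = (\<integral>\<^sup>+x. W (Suc k) (Suc t) x * indicator (A t - A (Suc t)) x \<partial>M)" for k t
  have split: "a k t + (\<integral>\<^sup>+x. W (Suc k) (Suc t) x * indicator (A (Suc t)) x \<partial>M)
      = (\<integral>\<^sup>+x. W (Suc k) (Suc t) x * indicator (A t) x \<partial>M)" if "k \<le> t" for k t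
  proof -
    have [measurable]: "W (Suc k) (Suc t) \<in> borel_measurable M" using that by (intro W) auto
    have "a k t + (\<integral>\<^sup>+x. W (Suc k) (Suc t) x * indicator (A (Suc t)) x \<partial>M)
      = (\<integral>\<^sup>+x. W (Suc k) (Suc t) x * indicator (A t - A (Suc t)) x + W (Suc k) (Suc t) x * indicator (A (Suc t)) x \<partial>M)"
      unfolding a_def by (rule nn_integral_add[symmetric]) measurable
    also have "\<dots> = (\<integral>\<^sup>+x. W (Suc k) (Suc t) x * indicator (A t) x \<partial>M)"
      using decr[of t] by (intro nn_integral_cong) (auto simp: indicator_def)
    finally show ?thesis .
  qed
  \<comment> \<open>Mass collected so far plus mass still running never exceeds the initial mass:
    optional stopping for a single process.\<close>
  have *: "(\<Sum>t=k..n. a k t) + (\<integral>\<^sup>+x. W (Suc k) (Suc n) x * indicator (A (Suc n)) x \<partial>M) \<le> emeasure M (A k)"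
    if "k \<le> n" for k n
    using that
  proof (induction n rule: dec_induct)
    case base
    show ?case using split[of k k] start[of k] by simp
  next
    case (step n)
    have "(\<Sum>t=k..Suc n. a k t) = (\<Sum>t=k..n. a k t) + a k (Suc n)"
      using step.hyps by simp
    then have "(\<Sum>t=k..Suc n. a k t) + (\<integral>\<^sup>+x. W (Suc k) (Suc (Suc n)) x * indicator (A (Suc (Suc n))) x \<partial>M)
       = (\<Sum>t=k..n. a k t) + (\<integral>\<^sup>+x. W (Suc k) (Suc (Suc n)) x * indicator (A (Suc n)) x \<partial>M)"
      using split[of k "Suc n"] step.hyps by (simp add: add.assoc)
    also have "\<dots> \<le> (\<Sum>t=k..n. a k t) + (\<integral>\<^sup>+x. W (Suc k) (Suc n) x * indicator (A (Suc n)) x \<partial>M)"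
      using assms(6)[of "Suc k" "Suc n"] step.hyps by (intro add_left_mono) auto
    finally show ?case using step.IH by (rule order.trans)
  qed
  have telescope: "emeasure M (space M - A m) = (\<Sum>t<m. emeasure M (A t - A (Suc t)))" for m
  proof (induction m)
    case 0
    then show ?case by (simp add: A0)
  next
    case (Suc m)
    have "space M - A (Suc m) = (space M - A m) \<union> (A m - A (Suc m))"
      using decr[of m] sets.sets_into_space[OF A[of m]] by auto
    then have "emeasure M (space M - A (Suc m)) = emeasure M (space M - A m) + emeasure M (A m - A (Suc m))"
      by (simp only:, intro plus_emeasure[symmetric]) auto
    then show ?case using Suc by simp
  qed
  have "\<gamma> * emeasure M (A t - A (Suc t)) \<le> (\<Sum>k\<le>t. a k t)" for t
  proof -
    have "\<gamma> * emeasure M (A t - A (Suc t)) = (\<integral>\<^sup>+x. \<gamma> * indicator (A t - A (Suc t)) x \<partial>M)"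
      by (subst nn_integral_cmult_indicator) auto
    also have "\<dots> \<le> (\<integral>\<^sup>+x. (\<Sum>k=1..Suc t. W k (Suc t) x * indicator (A t - A (Suc t)) x) \<partial>M)"
    proof (rule nn_integral_mono)
      fix x
      have "\<gamma> * indicator (A t - A (Suc t)) x \<le> (\<Sum>k=1..Suc t. W k (Suc t) x) * indicator (A t - A (Suc t)) x"
        using stop[of x t] by (auto simp: indicator_def)
      then show "\<gamma> * indicator (A t - A (Suc t)) x \<le> (\<Sum>k=1..Suc t. W k (Suc t) x * indicator (A t - A (Suc t)) x)"
        by (simp only: sum_distrib_right)
    qed
    also have "\<dots> = (\<Sum>k=1..Suc t. \<integral>\<^sup>+x. W k (Suc t) x * indicator (A t - A (Suc t)) x \<partial>M)"
      by (rule nn_integral_sum) (intro borel_measurable_times_ennreal W, auto)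
    also have "\<dots> = (\<Sum>k\<le>t. a k t)"
      unfolding a_def by (simp only: One_nat_def sum.shift_bounds_cl_Suc_ivl atLeast0AtMost)
    finally show ?thesis .
  qed
  then have "\<gamma> * emeasure M (space M - A m) \<le> (\<Sum>t<m. \<Sum>k\<le>t. a k t)"
    by (simp add: telescope sum_distrib_left sum_mono)
  \<comment> \<open>The triangle k \<le> t < m is now summed over \<open>t\<close> first, so that
    each \<open>k\<close> contributes at most the bound in \<open>*\<close>.\<close>
  also have "(\<Sum>t<m. \<Sum>k\<le>t. a k t) = (\<Sum>t<m. \<Sum>k\<in>{k\<in>{..<m}. k \<le> t}. a k t)"
    by (intro sum.cong) auto
  also have "\<dots> = (\<Sum>k<m. \<Sum>t\<in>{t\<in>{..<m}. k \<le> t}. a k t)"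
    by (rule sum.swap_restrict) auto
  also have "\<dots> = (\<Sum>k<m. \<Sum>t=k..m-1. a k t)"
    by (intro sum.cong) auto
  also have "\<dots> \<le> (\<Sum>k<m. emeasure M (A k))"
  proof (rule sum_mono)
    fix k assume "k \<in> {..<m}"
    then have "k \<le> m - 1" by auto
    from *[OF this] show "(\<Sum>t=k..m-1. a k t) \<le> emeasure M (A k)"
      by (rule order.trans[rotated]) simp
  qed
  finally show ?thesis .
qed

lemma prob_space_unif_law: "prob_space unif_law"
  unfolding unif_law_def by (intro prob_space_PiM prob_space_unif01)

lemma measurable_unif_law_component: "1 \<le> j \<Longrightarrow> (\<lambda>z. z j) \<in> unif_law \<rightarrow>\<^sub>M borel"
  unfolding unif_law_def by measurable

text \<open>Nonnegativity of the densities is known on [0,1] only; off this null set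
  \<open>ennreal\<close> would not commute with the products of densities.\<close>

lemma AE_unif_law_interval: "AE z in unif_law. \<forall>j\<ge>1. z j \<in> {0..1}"
proof -
  have "AE z in unif_law. z j \<in> {0..1}" if "1 \<le> j" for j
    unfolding unif_law_def
    by (rule AE_PiM_component) (use that prob_space_unif01 AE_unif01 in auto)
  then show ?thesis by (subst AE_all_countable) (auto intro: AE_impI)
qed

context
  fixes Pr :: "'th measure" and f :: "'th \<Rightarrow> real \<Rightarrow> real"
  assumes Pr: "prob_space Pr" and fam: "density_family Pr f"
begin

lemma density_measurable_pair: "(\<lambda>(\<theta>, u). f \<theta> u) \<in> borel_measurable (Pr \<Otimes>\<^sub>M borel)"
  using fam by (simp add: density_family_def)

lemma mix_lik_prod_measurable:
  assumes "1 \<le> k"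
  shows "(\<lambda>(z, \<theta>). ennreal (\<Prod>j=k..t. f \<theta> (z j))) \<in> borel_measurable (unif_law \<Otimes>\<^sub>M Pr)"
proof -
  have "(\<lambda>p. f (snd p) (fst p j)) \<in> borel_measurable (unif_law \<Otimes>\<^sub>M Pr)" if "1 \<le> j" for j
  proof -
    have "(\<lambda>p. (snd p, fst p j)) \<in> unif_law \<Otimes>\<^sub>M Pr \<rightarrow>\<^sub>M Pr \<Otimes>\<^sub>M borel"
      using that by (intro measurable_Pair measurable_snd measurable_compose[OF measurable_fst measurable_unif_law_component])
    from measurable_compose[OF this density_measurable_pair] show ?thesis by simp
  qed
  then show ?thesis unfolding case_prod_beta'
    using assms by (intro measurable_compose[OF _ measurable_ennreal] borel_measurable_prod) auto
qed

lemma mix_lik_measurable: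
  assumes "1 \<le> k" shows "mix_lik Pr f {k..t} \<in> borel_measurable unif_law"
proof -
  interpret Pr: prob_space Pr by (rule Pr)
  show ?thesis unfolding mix_lik_def
    by (rule Pr.borel_measurable_nn_integral[OF mix_lik_prod_measurable[OF assms]])
qed

text \<open>The martingale property: after exchanging the integrals over the path and over \<theta>,
  resampling coordinate \<open>Suc t\<close>, which \<open>B\<close> ignores, integrates the last
  density to 1. The case k = Suc t starts from an empty product and gives the initial value
  1.\<close>

lemma nn_integral_mix_lik_Suc:
  assumes k: "1 \<le> k" "k \<le> Suc t" and B[measurable]: "B \<in> sets unif_law"
    and B_upd: "\<And>z u. z \<in> space unif_law \<Longrightarrow> fun_upd z (Suc t) u \<in> B \<longleftrightarrow> z \<in> B"
  shows "(\<integral>\<^sup>+z. mix_lik Pr f {k..Suc t} z * indicator B z \<partial>unif_law)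
       = (\<integral>\<^sup>+z. mix_lik Pr f {k..t} z * indicator B z \<partial>unif_law)"
proof -
  interpret Pr: prob_space Pr by (rule Pr)
  interpret U: prob_space unif_law by (rule prob_space_unif_law)
  interpret P: pair_sigma_finite unif_law Pr ..
  let ?h = "\<lambda>t (z, \<theta>). ennreal (\<Prod>j=k..t. f \<theta> (z j)) * indicator B z"
  have h: "?h t \<in> borel_measurable (unif_law \<Otimes>\<^sub>M Pr)" for t
    using mix_lik_prod_measurable[OF k(1), of t] unfolding case_prod_beta'
    by (intro borel_measurable_times_ennreal) (auto intro: measurable_compose[OF measurable_fst])
  have swap: "(\<integral>\<^sup>+z. mix_lik Pr f {k..t} z * indicator B z \<partial>unif_law)
     = (\<integral>\<^sup>+\<theta>. (\<integral>\<^sup>+z. ?h t (z, \<theta>) \<partial>unif_law) \<partial>Pr)" for t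
  proof -
    have "(\<integral>\<^sup>+z. mix_lik Pr f {k..t} z * indicator B z \<partial>unif_law) = (\<integral>\<^sup>+z. (\<integral>\<^sup>+\<theta>. ?h t (z, \<theta>) \<partial>Pr) \<partial>unif_law)"
    proof (intro nn_integral_cong)
      fix z assume z: "z \<in> space unif_law"
      show "mix_lik Pr f {k..t} z * indicator B z = (\<integral>\<^sup>+\<theta>. ?h t (z, \<theta>) \<partial>Pr)"
        unfolding mix_lik_def
        using measurable_compose[OF measurable_Pair1'[OF z] mix_lik_prod_measurable[OF k(1), of t]]
        by (simp add: nn_integral_multc)
    qed
    also have "\<dots> = (\<integral>\<^sup>+\<theta>. (\<integral>\<^sup>+z. ?h t (z, \<theta>) \<partial>unif_law) \<partial>Pr)"
      using P.Fubini[OF h] by simp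
    finally show ?thesis .
  qed
  have "(\<integral>\<^sup>+z. ?h (Suc t) (z, \<theta>) \<partial>unif_law) = (\<integral>\<^sup>+z. ?h t (z, \<theta>) \<partial>unif_law)" if \<theta>: "\<theta> \<in> space Pr" for \<theta>
  proof -
    have f0: "f \<theta> u \<ge> 0" if "u \<in> {0..1}" for u
      using fam \<theta> that by (auto simp: density_family_def)
    have f_meas[measurable]: "f \<theta> \<in> borel_measurable borel"
      using measurable_compose[OF measurable_Pair1'[OF \<theta>] density_measurable_pair] by simp
    have fm: "(\<lambda>u. ennreal (f \<theta> u)) \<in> borel_measurable unif01"
      using measurable_compose[OF f_meas measurable_ennreal] by (simp cong: measurable_cong_sets)
    have "(\<integral>\<^sup>+u. ennreal (f \<theta> u) \<partial>unif01) = (\<integral>\<^sup>+u\<in>{0..1}. ennreal (f \<theta> u) \<partial>lborel)"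
      by (rule nn_integral_unif01) measurable
    then have f1: "(\<integral>\<^sup>+u. ennreal (f \<theta> u) \<partial>unif01) = 1"
      using fam \<theta> by (simp add: density_family_def)
    have "(\<integral>\<^sup>+z. ?h (Suc t) (z, \<theta>) \<partial>unif_law) =
      (\<integral>\<^sup>+z. (\<integral>\<^sup>+u. ?h (Suc t) (fun_upd z (Suc t) u, \<theta>) \<partial>unif01) \<partial>unif_law)"
      using measurable_compose[OF measurable_Pair2'[OF \<theta>] h[of "Suc t"]] unfolding unif_law_def
      by (intro nn_integral_PiM_resample prob_space_unif01) auto
    also have "\<dots> = (\<integral>\<^sup>+z. ?h t (z, \<theta>) \<partial>unif_law)"
    proof (intro nn_integral_cong_AE, use AE_unif_law_interval AE_space in eventually_elim)
      fix z assume z: "\<forall>j\<ge>1. z j \<in> {0..1}" "z \<in> space unif_law"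
      have P0: "0 \<le> (\<Prod>j=k..t. f \<theta> (z j))"
        using z k by (intro prod_nonneg f0) auto
      have "?h (Suc t) (fun_upd z (Suc t) u, \<theta>) = ennreal (\<Prod>j=k..t. f \<theta> (z j)) * ennreal (f \<theta> u) * indicator B z" for u
      proof -
        have "(\<Prod>j=k..t. f \<theta> (fun_upd z (Suc t) u j)) = (\<Prod>j=k..t. f \<theta> (z j))"
          by (intro prod.cong) auto
        then have "(\<Prod>j=k..Suc t. f \<theta> (fun_upd z (Suc t) u j)) = (\<Prod>j=k..t. f \<theta> (z j)) * f \<theta> u"
          using k by (simp add: prod.nat_ivl_Suc')
        then show ?thesis using P0 k B_upd[OF z(2), of u] by (simp add: ennreal_mult' indicator_def)
      qed
      then have "(\<integral>\<^sup>+u. ?h (Suc t) (fun_upd z (Suc t) u, \<theta>) \<partial>unif01)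
          = (\<integral>\<^sup>+u. (ennreal (\<Prod>j=k..t. f \<theta> (z j)) * indicator B z) * ennreal (f \<theta> u) \<partial>unif01)"
        by (simp only: ac_simps)
      also have "\<dots> = ?h t (z, \<theta>)"
        by (subst nn_integral_cmult[OF fm]) (simp add: f1)
      finally show "(\<integral>\<^sup>+u. ?h (Suc t) (fun_upd z (Suc t) u, \<theta>) \<partial>unif01) = ?h t (z, \<theta>)" .
    qed
    finally show ?thesis .
  qed
  then show ?thesis unfolding swap by (rule nn_integral_cong)
qed

end

section \<open>The detector as a functional of the p-value sequence\<close>

text \<open>This is \<open>S_bar\<close> with unit weights, read off the p-values alone, so that the
  false-alarm analysis can take place under \<open>unif_law\<close>.\<close>

definition e_sum :: "'th measure \<Rightarrow> ('th \<Rightarrow> real \<Rightarrow> real) \<Rightarrow> real \<Rightarrow> nat \<Rightarrow> (nat \<Rightarrow> real) \<Rightarrow> ennreal" where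
  "e_sum Pr f \<rho> t z = (\<Sum>k=1..t. ennreal \<rho> + ennreal (1 - \<rho>) * mix_lik Pr f {k..t} z)"

definition running :: "'th measure \<Rightarrow> ('th \<Rightarrow> real \<Rightarrow> real) \<Rightarrow> real \<Rightarrow> real \<Rightarrow> nat \<Rightarrow> (nat \<Rightarrow> real) set" where
  "running Pr f \<rho> b m = {z\<in>space unif_law. \<forall>t\<in>{1..m}. e_sum Pr f \<rho> t z < ennreal b}"

lemma mix_lik_cong: "(\<And>j. j \<in> I \<Longrightarrow> z j = z' j) \<Longrightarrow> mix_lik Pr f I z = mix_lik Pr f I z'"
  unfolding mix_lik_def by (intro nn_integral_cong arg_cong[where f=ennreal] prod.cong) auto

lemma e_sum_cong:
  assumes "\<And>j. 1 \<le> j \<Longrightarrow> j \<le> t \<Longrightarrow> z j = z' j"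
  shows "e_sum Pr f \<rho> t z = e_sum Pr f \<rho> t z'"
proof -
  have "mix_lik Pr f {k..t} z = mix_lik Pr f {k..t} z'" if "k \<in> {1..t}" for k
    using assms that by (intro mix_lik_cong) auto
  then show ?thesis unfolding e_sum_def by (intro sum.cong) auto
qed

lemma S_bar_eq_e_sum:
  assumes "\<forall>k\<ge>1. w k = 1"
  shows "S_bar Pr f s w \<rho> t \<omega> = e_sum Pr f \<rho> t (conf_path s \<omega>)"
proof -
  have "M_stat Pr f s k t \<omega> = mix_lik Pr f {k..t} (conf_path s \<omega>)" if "k \<in> {1..t}" for k
    unfolding M_stat_def using that by (intro mix_lik_cong) (auto simp: conf_path_def)
  then show ?thesis
    unfolding S_bar_def e_sum_def M_bar_def using assms by (intro sum.cong) auto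
qed

lemma less_tau_bar_iff:
  "enat m < tau_bar Pr f s w \<rho> b \<omega> \<longleftrightarrow> (\<forall>t\<in>{1..m}. S_bar Pr f s w \<rho> t \<omega> < ennreal b)"
proof -
  let ?X = "{t. 1 \<le> t \<and> ennreal b \<le> S_bar Pr f s w \<rho> t \<omega>}"
  have "enat m < Inf (enat ` ?X) \<longleftrightarrow> (\<forall>t\<in>?X. m < t)"
    by (simp add: Suc_ile_eq[symmetric] le_Inf_iff Suc_le_eq)
  also have "\<dots> \<longleftrightarrow> (\<forall>t\<in>{1..m}. S_bar Pr f s w \<rho> t \<omega> < ennreal b)"
    by (auto simp: not_le[symmetric])
  finally show ?thesis unfolding tau_bar_def .
qed

lemma less_tau_bar_iff_running:
  assumes "\<forall>k\<ge>1. w k = 1" "s \<in> borel_measurable P0" "\<omega> \<in> space (null_law P0)"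
  shows "enat m < tau_bar Pr f s w \<rho> b \<omega> \<longleftrightarrow> conf_path s \<omega> \<in> running Pr f \<rho> b m"
  using measurable_space[OF measurable_conf_path[OF assms(2)] assms(3)]
  by (simp add: less_tau_bar_iff running_def S_bar_eq_e_sum[OF assms(1)])

lemma e_sum_ge:
  assumes "0 \<le> \<rho>"
  shows "ennreal (\<rho> * real t) \<le> e_sum Pr f \<rho> t z"
proof -
  have "ennreal (\<rho> * real t) = (\<Sum>k=1..t. ennreal \<rho>)"
    using assms by (simp add: ennreal_of_nat_eq_real_of_nat ennreal_mult[symmetric] mult.commute)
  also have "\<dots> \<le> e_sum Pr f \<rho> t z" unfolding e_sum_def by (intro sum_mono) simp
  finally show ?thesis .
qed

lemma running_empty:
  assumes "0 < \<rho>" "1 \<le> m" "b \<le> \<rho> * real m"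
  shows "running Pr f \<rho> b m = {}"
proof -
  have "ennreal b \<le> e_sum Pr f \<rho> m z" for z
    using e_sum_ge[of \<rho> m Pr f z] assms by (meson ennreal_leI less_imp_le order_trans)
  then show ?thesis using assms(2) by (force simp: running_def not_less[symmetric])
qed

text \<open>Tail-sum formula; its expectation expresses the mean of a bounded time through survival
  probabilities.\<close>

lemma ennreal_of_enat_eq_sum:
  assumes "x \<le> enat T"
  shows "ennreal_of_enat x = (\<Sum>m<T. of_bool (enat m < x))"
proof -
  obtain n where n: "x = enat n" "n \<le> T" using assms by (cases x) auto
  have "(\<Sum>m<T. of_bool (enat m < x)) = (\<Sum>m\<in>{..<n}. (1::ennreal))"
    using n by (intro sum.mono_neutral_cong_right) auto
  then show ?thesis using n by simp
qed

context
  fixes Pr :: "'th measure" and f :: "'th \<Rightarrow> real \<Rightarrow> real" and \<rho> :: real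
  assumes Pr: "prob_space Pr" and fam: "density_family Pr f" and \<rho>: "0 < \<rho>" "\<rho> < 1"
begin

lemma e_sum_measurable [measurable]: "e_sum Pr f \<rho> t \<in> borel_measurable unif_law"
  unfolding e_sum_def
  by (intro borel_measurable_sum borel_measurable_add borel_measurable_times_ennreal
      mix_lik_measurable[OF Pr fam] measurable_const) auto

lemma running_sets [measurable]: "running Pr f \<rho> b m \<in> sets unif_law"
  unfolding running_def by measurable

lemma running_upd:
  assumes "z \<in> space unif_law" shows "fun_upd z (Suc m) u \<in> running Pr f \<rho> b m \<longleftrightarrow> z \<in> running Pr f \<rho> b m"
proof -
  have "fun_upd z (Suc m) u \<in> space unif_law"
    using assms by (auto simp: unif_law_def space_PiM PiE_iff extensional_def)
  moreover have "e_sum Pr f \<rho> t (fun_upd z (Suc m) u) = e_sum Pr f \<rho> t z" if "t \<in> {1..m}" for t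
    using that by (intro e_sum_cong) auto
  ultimately show ?thesis using assms unfolding running_def by auto
qed

text \<open>The constant 1 is itself a martingale, so the mixture with weights \<rho> and 1 - \<rho>
  remains one started at 1 and the floor costs nothing in the false-alarm bound.\<close>

lemma running_bound:
  "ennreal b * emeasure unif_law (space unif_law - running Pr f \<rho> b m)
     \<le> (\<Sum>k<m. emeasure unif_law (running Pr f \<rho> b k))"
proof -
  interpret Pr: prob_space Pr by (rule Pr)
  interpret U: prob_space unif_law by (rule prob_space_unif_law)
  let ?W = "\<lambda>k t z. ennreal \<rho> + ennreal (1 - \<rho>) * mix_lik Pr f {k..t} z"
  let ?A = "\<lambda>m. running Pr f \<rho> b m"
  note [measurable] = mix_lik_measurable[OF Pr fam]
  have int: "(\<integral>\<^sup>+z. ?W k t z * indicator B z \<partial>unif_law) =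
      ennreal \<rho> * emeasure unif_law B + ennreal (1 - \<rho>) * (\<integral>\<^sup>+z. mix_lik Pr f {k..t} z * indicator B z \<partial>unif_law)"
    if k: "1 \<le> k" and B[measurable]: "B \<in> sets unif_law" for k t B
  proof -
    note [measurable] = mix_lik_measurable[OF Pr fam k, of t]
    show ?thesis
      by (simp add: distrib_right nn_integral_add mult.assoc nn_integral_cmult)
  qed
  have eq: "(\<integral>\<^sup>+z. mix_lik Pr f {k..Suc t} z * indicator (?A t) z \<partial>unif_law)
      = (\<integral>\<^sup>+z. mix_lik Pr f {k..t} z * indicator (?A t) z \<partial>unif_law)" if "1 \<le> k" "k \<le> Suc t" for k t
    by (rule nn_integral_mix_lik_Suc[OF Pr fam that running_sets running_upd])
  show ?thesis
  proof (rule e_detector_bound[where W = ?W])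
    show "?A 0 = space unif_law" by (simp add: running_def)
    show "?A (Suc t) \<subseteq> ?A t" for t by (auto simp: running_def)
    show "?W k t \<in> borel_measurable unif_law" if "1 \<le> k" for k t
      using mix_lik_measurable[OF Pr fam that, of t] by measurable
    have mass: "ennreal \<rho> * x + ennreal (1 - \<rho>) * x = x" for x
      using \<rho> by (simp add: distrib_right[symmetric] ennreal_plus[symmetric] del: ennreal_plus)
    show "(\<integral>\<^sup>+z. ?W (Suc k) (Suc k) z * indicator (?A k) z \<partial>unif_law) \<le> emeasure unif_law (?A k)" for k
    proof -
      have "(\<integral>\<^sup>+z. mix_lik Pr f {Suc k..Suc k} z * indicator (?A k) z \<partial>unif_law) = emeasure unif_law (?A k)"
        by (subst eq) (simp_all add: mix_lik_def Pr.emeasure_space_1)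
      then show ?thesis
        by (subst int) (simp_all only: mass running_sets order.refl One_nat_def Suc_le_mono le0)
    qed
    show "(\<integral>\<^sup>+z. ?W k (Suc t) z * indicator (?A t) z \<partial>unif_law) \<le> (\<integral>\<^sup>+z. ?W k t z * indicator (?A t) z \<partial>unif_law)"
      if "1 \<le> k" "k \<le> t" for k t
      using that by (simp add: int eq)
    show "ennreal b \<le> (\<Sum>k=1..Suc t. ?W k (Suc t) z)" if "z \<in> ?A t - ?A (Suc t)" for t z
    proof -
      have "\<not> e_sum Pr f \<rho> (Suc t) z < ennreal b"
        using that by (auto simp: running_def atLeastAtMostSuc_conv)
      then show ?thesis by (simp only: e_sum_def not_less)
    qed
  qed measurable
qed

context
  fixes P0 :: "'a measure" and s :: "'a \<Rightarrow> real" and w :: "nat \<Rightarrow> real" and b :: real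
  assumes P0: "prob_space P0" and s: "s \<in> borel_measurable P0"
    and cont: "continuous_on UNIV (cdf (distr P0 borel s))"
    and w: "\<forall>k\<ge>1. w k = 1"
begin

abbreviation detector :: "'a path \<Rightarrow> enat" where
  "detector \<equiv> tau_bar Pr f s w \<rho> b"

abbreviation alive :: "nat \<Rightarrow> (nat \<Rightarrow> real) set" where
  "alive \<equiv> running Pr f \<rho> b"

lemma emeasure_less_tau_bar:
  "emeasure (null_law P0) {\<omega>\<in>space (null_law P0). enat m < detector \<omega>} = emeasure unif_law (alive m)"
proof -
  have "emeasure unif_law (alive m) = emeasure (distr (null_law P0) unif_law (conf_path s)) (alive m)"
    by (simp only: distr_conf_path[OF P0 s cont])
  also have "\<dots> = emeasure (null_law P0) (conf_path s -` alive m \<inter> space (null_law P0))"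
    by (rule emeasure_distr[OF measurable_conf_path[OF s] running_sets])
  also have "conf_path s -` alive m \<inter> space (null_law P0) = {\<omega>\<in>space (null_law P0). enat m < detector \<omega>}"
    by (auto simp: less_tau_bar_iff_running[OF w s])
  finally show ?thesis by simp
qed

lemma sets_less_tau_bar:
  "{\<omega>\<in>space (null_law P0). enat m < detector \<omega>} \<in> sets (null_law P0)"
proof -
  have "conf_path s -` alive m \<inter> space (null_law P0) = {\<omega>\<in>space (null_law P0). enat m < detector \<omega>}"
    by (auto simp: less_tau_bar_iff_running[OF w s])
  then show ?thesis
    using measurable_sets[OF measurable_conf_path[OF s] running_sets] by metis
qed

lemma tau_bar_le:
  assumes "1 \<le> T" "b \<le> \<rho> * real T"
  shows "detector \<omega> \<le> enat T"
proof -
  have "ennreal b \<le> S_bar Pr f s w \<rho> T \<omega>"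
    using e_sum_ge[of \<rho> T Pr f "conf_path s \<omega>"] \<rho> assms
    by (simp add: S_bar_eq_e_sum[OF w]) (meson ennreal_leI order_trans)
  then have "\<not> enat T < detector \<omega>"
    unfolding less_tau_bar_iff using assms(1) by (auto simp: not_less)
  then show ?thesis by simp
qed

lemma null_mean_tau_bar:
  assumes "1 \<le> T" "b \<le> \<rho> * real T"
  shows "null_mean P0 (detector) = (\<Sum>m<T. emeasure unif_law (alive m))"
proof -
  have "null_mean P0 (detector) =
    (\<integral>\<^sup>+\<omega>. (\<Sum>m<T. indicator {\<omega>\<in>space (null_law P0). enat m < detector \<omega>} \<omega>) \<partial>null_law P0)"
    unfolding null_mean_def
    by (intro nn_integral_cong) (auto simp: ennreal_of_enat_eq_sum[OF tau_bar_le[OF assms]] indicator_def of_bool_def intro!: sum.cong)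
  also have "\<dots> = (\<Sum>m<T. emeasure unif_law (alive m))"
    using sets_less_tau_bar emeasure_less_tau_bar by (subst nn_integral_sum) auto
  finally show ?thesis .
qed

lemma tau_bar_null:
  assumes b: "1 < b"
  shows "ennreal b \<le> null_mean P0 (detector)"
    and "null_mean P0 (detector) \<le> ennreal (of_int \<lceil>b / \<rho>\<rceil>)"
    and "\<P>(\<omega> in null_law P0. detector \<omega> \<le> enat m) \<le> real m / b"
proof -
  interpret U: prob_space unif_law by (rule prob_space_unif_law)
  interpret N: prob_space "null_law P0" using P0 by (rule prob_space_null_law)
  define T where "T = nat \<lceil>b / \<rho>\<rceil>"
  have bp: "b / \<rho> > 0" using b \<rho> by simp
  then have Ti: "real T = of_int \<lceil>b / \<rho>\<rceil>" unfolding T_def by (simp add: less_imp_le)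
  have "b / \<rho> \<le> real T" unfolding Ti by (rule le_of_int_ceiling)
  then have "b \<le> \<rho> * real T" using \<rho> by (simp add: pos_divide_le_eq mult.commute)
  moreover have "1 \<le> T" using bp \<open>b / \<rho> \<le> real T\<close> by linarith
  ultimately have T: "1 \<le> T" "b \<le> \<rho> * real T" by auto
  note mean = null_mean_tau_bar[OF T]
  \<comment> \<open>By time \<open>T\<close> every path has stopped, so the left side of
    \<open>running_bound\<close> carries full mass, while its right side is the tail sum for the
    mean.\<close>
  have "ennreal b = ennreal b * emeasure unif_law (space unif_law - alive T)"
    using running_empty[OF \<rho>(1) T, of Pr f] by (simp add: U.emeasure_space_1)
  also have "\<dots> \<le> null_mean P0 (detector)"
    unfolding mean by (rule running_bound)
  finally show "ennreal b \<le> null_mean P0 (detector)" .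
  have sum_le: "(\<Sum>k<n. emeasure unif_law (alive k)) \<le> ennreal (real n)" for n
  proof -
    have "(\<Sum>k<n. emeasure unif_law (alive k)) \<le> (\<Sum>k<n. 1)"
      by (intro sum_mono U.emeasure_le_1)
    then show ?thesis by (simp add: ennreal_of_nat_eq_real_of_nat)
  qed
  show "null_mean P0 (detector) \<le> ennreal (of_int \<lceil>b / \<rho>\<rceil>)"
    unfolding mean Ti[symmetric] by (rule sum_le)
  let ?E = "{\<omega>\<in>space (null_law P0). enat m < detector \<omega>}"
  have "\<P>(\<omega> in null_law P0. detector \<omega> \<le> enat m) = N.prob (space (null_law P0) - ?E)"
    by (intro arg_cong[where f=N.prob]) auto
  also have "\<dots> = 1 - N.prob ?E" using sets_less_tau_bar by (rule N.prob_compl)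
  also have "N.prob ?E = U.prob (alive m)"
    using emeasure_less_tau_bar[of m] by (simp add: measure_def)
  also have "1 - \<dots> = U.prob (space unif_law - alive m)"
    using running_sets by (rule U.prob_compl[symmetric])
  finally have p: "\<P>(\<omega> in null_law P0. detector \<omega> \<le> enat m) = U.prob (space unif_law - alive m)" .
  \<comment> \<open>The same bound at time \<open>m\<close>, now with each survival probability
    estimated by 1.\<close>
  have "ennreal (b * U.prob (space unif_law - alive m)) \<le> ennreal (real m)"
    using order.trans[OF running_bound[of b m] sum_le[of m]] b
    by (simp add: U.emeasure_eq_measure ennreal_mult)
  then have "b * U.prob (space unif_law - alive m) \<le> real m" by simp
  then show "\<P>(\<omega> in null_law P0. detector \<omega> \<le> enat m) \<le> real m / b"
    unfolding p using b by (simp add: field_simps)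
qed

end

end

section \<open>Change of measure and the likelihood ratio\<close>

lemma indep_vars_PiM:
  assumes M: "\<And>i. i \<in> I \<Longrightarrow> prob_space (M i)" and J: "finite J" "J \<noteq> {}" "J \<subseteq> I"
  shows "prob_space.indep_vars (PiM I M) M (\<lambda>i x. x i) J"
proof -
  interpret prob_space "PiM I M" using M by (rule prob_space_PiM)
  \<comment> \<open>Nothing is assumed of \<open>M\<close> outside \<open>I\<close>; a one-point
    space fills the gap so that all indices carry probability measures.\<close>
  let ?M = "\<lambda>i. if i \<in> I then M i else count_space {undefined}"
  interpret M': prob_space "?M i" for i
    using M by (cases "i \<in> I") (auto intro!: prob_spaceI)
  interpret P: product_prob_space ?M I ..
  have I: "PiM I ?M = PiM I M" by (intro PiM_cong) auto
  have JM: "PiM J ?M = PiM J M" using J by (intro PiM_cong) auto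
  have "distr (PiM I M) (PiM J M) (\<lambda>x. \<lambda>i\<in>J. x i) = PiM J M"
    using P.distr_PiM_restrict_finite[OF J(1,3)] unfolding I JM .
  also have "\<dots> = PiM J (\<lambda>i. distr (PiM I M) (M i) (\<lambda>x. x i))"
    using M J by (intro PiM_cong) (auto simp: distr_PiM_component)
  finally show ?thesis
    using J by (subst indep_vars_iff_distr_eq_PiM') auto
qed

text \<open>Only the coordinates in \<open>J\<close> share a law, so this covers both the pre-change
  counts and the post-change sums under \<open>change_law\<close>.\<close>

lemma Hoeffding_PiM:
  fixes g :: "'b \<Rightarrow> real" and M :: "'i \<Rightarrow> 'b measure"
  assumes M: "\<And>i. i \<in> I \<Longrightarrow> prob_space (M i)" and J: "finite J" "J \<noteq> {}" "J \<subseteq> I"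
    and Q: "\<And>i. i \<in> J \<Longrightarrow> M i = Q" and g: "g \<in> borel_measurable Q"
    and bd: "\<And>x. x \<in> space Q \<Longrightarrow> a \<le> g x \<and> g x \<le> b" and ab: "a < b" and \<epsilon>: "0 \<le> \<epsilon>"
  shows "measure (PiM I M) {\<omega>\<in>space (PiM I M). (\<Sum>i\<in>J. g (\<omega> i)) \<ge> real (card J) * ((\<integral>x. g x \<partial>Q) + \<epsilon>)}
      \<le> exp (- 2 * real (card J) * \<epsilon>\<^sup>2 / (b - a)\<^sup>2)" (is ?ge)
    and "measure (PiM I M) {\<omega>\<in>space (PiM I M). (\<Sum>i\<in>J. g (\<omega> i)) \<le> real (card J) * ((\<integral>x. g x \<partial>Q) - \<epsilon>)}
      \<le> exp (- 2 * real (card J) * \<epsilon>\<^sup>2 / (b - a)\<^sup>2)" (is ?le)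
proof -
  interpret prob_space "PiM I M" using M by (rule prob_space_PiM)
  have comp: "(\<lambda>\<omega>. \<omega> i) \<in> PiM I M \<rightarrow>\<^sub>M Q" if "i \<in> J" for i
    using measurable_component_singleton[of i I M] Q[OF that] J that by auto
  have ind: "indep_vars (\<lambda>_. borel) (\<lambda>i \<omega>. g (\<omega> i)) J"
    by (rule indep_vars_compose2[OF indep_vars_PiM[OF M J]]) (use g Q in auto)
  have ex: "expectation (\<lambda>\<omega>. g (\<omega> i)) = (\<integral>x. g x \<partial>Q)" if "i \<in> J" for i
  proof -
    have "distr (PiM I M) Q (\<lambda>\<omega>. \<omega> i) = Q"
      using distr_PiM_component[of I M i] M Q[OF that] J that by auto
    then show ?thesis using integral_distr[OF comp[OF that] g] by simp
  qed
  interpret H: Hoeffding_ineq "PiM I M" J "\<lambda>i \<omega>. g (\<omega> i)" "\<lambda>_. a" "\<lambda>_. b" "\<Sum>i\<in>J. expectation (\<lambda>\<omega>. g (\<omega> i))"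
  proof (unfold_locales, rule J, rule ind)
    show "AE \<omega> in PiM I M. g (\<omega> i) \<in> {a..b}" if "i \<in> J" for i
      using bd measurable_space[OF comp[OF that]] by (intro AE_I2) auto
  qed simp
  have \<mu>: "(\<Sum>i\<in>J. expectation (\<lambda>\<omega>. g (\<omega> i))) = real (card J) * (\<integral>x. g x \<partial>Q)"
    using ex by simp
  have c: "real (card J) > 0" using J by (simp add: card_gt_0_iff)
  have pos: "(\<Sum>i\<in>J. (b - a)\<^sup>2) > 0" using c ab by simp
  have e: "- 2 * (real (card J) * \<epsilon>)\<^sup>2 / (\<Sum>i\<in>J. (b - a)\<^sup>2) = - 2 * real (card J) * \<epsilon>\<^sup>2 / (b - a)\<^sup>2"
    using c ab by (simp add: power2_eq_square)
  show ?ge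
    using H.Hoeffding_ineq_ge[of "real (card J) * \<epsilon>"] \<epsilon> pos unfolding e \<mu> by (simp add: distrib_left)
  show ?le
    using H.Hoeffding_ineq_le[of "real (card J) * \<epsilon>"] \<epsilon> pos unfolding e \<mu> by (simp add: right_diff_distrib)
qed

text \<open>Both sides agree on rectangles, where the integral of a product factorizes. Letting the
  factors depend on the index allows the factor 1 before the change.\<close>

lemma density_PiM:
  fixes M :: "'i \<Rightarrow> 'b measure"
  assumes I: "finite I" and M: "\<And>i. prob_space (M i)" and l: "\<And>i. i \<in> I \<Longrightarrow> l i \<in> borel_measurable (M i)"
    and Q: "\<And>i. i \<in> I \<Longrightarrow> Q i = density (M i) (l i)" and Qp: "\<And>i. prob_space (Q i)"
  shows "density (PiM I M) (\<lambda>\<omega>. \<Prod>i\<in>I. l i (\<omega> i)) = PiM I Q"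
proof -
  interpret M: prob_space "M i" for i by (rule M)
  interpret Q: prob_space "Q i" for i by (rule Qp)
  interpret PM: product_prob_space M I ..
  interpret PQ: product_prob_space Q I ..
  have sQ: "sets (Q i) = sets (M i)" if "i \<in> I" for i using Q[OF that] by simp
  have meas: "(\<lambda>\<omega>. \<Prod>i\<in>I. l i (\<omega> i)) \<in> borel_measurable (PiM I M)"
    using l by (intro borel_measurable_prod_ennreal) (auto intro: measurable_compose[OF measurable_component_singleton])
  show ?thesis
  proof (rule PQ.PiM_eqI[OF I])
    show "sets (density (PiM I M) (\<lambda>\<omega>. \<Prod>i\<in>I. l i (\<omega> i))) = sets (PiM I Q)"
      using sQ by (simp cong: sets_PiM_cong)
    fix A assume "\<And>i. i \<in> I \<Longrightarrow> A i \<in> sets (Q i)"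
    then have A: "\<And>i. i \<in> I \<Longrightarrow> A i \<in> sets (M i)" using sQ by auto
    have "Pi\<^sub>E I A \<in> sets (PiM I M)" using A I by (intro sets_PiM_I_finite) auto
    then have "emeasure (density (PiM I M) (\<lambda>\<omega>. \<Prod>i\<in>I. l i (\<omega> i))) (Pi\<^sub>E I A)
      = (\<integral>\<^sup>+\<omega>. (\<Prod>i\<in>I. l i (\<omega> i)) * indicator (Pi\<^sub>E I A) \<omega> \<partial>PiM I M)"
      by (rule emeasure_density[OF meas])
    also have "\<dots> = (\<integral>\<^sup>+\<omega>. (\<Prod>i\<in>I. l i (\<omega> i) * indicator (A i) (\<omega> i)) \<partial>PiM I M)"
    proof (rule nn_integral_cong)
      fix \<omega> assume "\<omega> \<in> space (PiM I M)"
      then have "indicator (Pi\<^sub>E I A) \<omega> = (\<Prod>i\<in>I. indicator (A i) (\<omega> i) :: ennreal)"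
        using I by (auto simp: indicator_def space_PiM PiE_iff)
      then show "(\<Prod>i\<in>I. l i (\<omega> i)) * indicator (Pi\<^sub>E I A) \<omega> = (\<Prod>i\<in>I. l i (\<omega> i) * indicator (A i) (\<omega> i))"
        by (simp add: prod.distrib)
    qed
    also have "\<dots> = (\<Prod>i\<in>I. \<integral>\<^sup>+x. l i x * indicator (A i) x \<partial>M i)"
      using A l by (intro PM.product_nn_integral_prod[OF I]) auto
    also have "\<dots> = (\<Prod>i\<in>I. emeasure (Q i) (A i))"
      using A l Q by (intro prod.cong) (auto simp: emeasure_density)
    finally show "emeasure (density (PiM I M) (\<lambda>\<omega>. \<Prod>i\<in>I. l i (\<omega> i))) (Pi\<^sub>E I A) = (\<Prod>i\<in>I. emeasure (Q i) (A i))" .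
  qed
qed

lemma times_upto_enat: "times_upto (enat n) = {1..n}"
  by (auto simp: times_upto_def)

text \<open>Finite-time events are cylinders over the first \<open>n\<close> pairs;
  \<open>unif01\<close> may replace \<open>borel\<close> because only the sigma-algebra
  enters.\<close>

lemma sets_rand_filtration:
  "sets (rand_filtration P0 (enat n)) =
     (\<lambda>B. (\<lambda>\<omega>. restrict \<omega> {1..n}) -` B \<inter> space (null_law P0)) ` sets (PiM {1..n} (\<lambda>_. P0 \<Otimes>\<^sub>M unif01))"
proof -
  have "sets (PiM {1..n} (\<lambda>_. P0 \<Otimes>\<^sub>M unif01)) = sets (PiM {1..n} (\<lambda>_. P0 \<Otimes>\<^sub>M borel))"
    by (intro sets_PiM_cong sets_pair_measure_cong refl) auto
  moreover have "(\<lambda>\<omega>. \<lambda>i\<in>{1..n}. (obs i \<omega>, rnd i \<omega>)) \<in> space (null_law P0) \<rightarrow> space (PiM {1..n} (\<lambda>_. P0 \<Otimes>\<^sub>M borel))"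
    by (auto simp: space_null_law space_PiM PiE_iff space_pair_measure)
  ultimately show ?thesis
    unfolding rand_filtration_def times_upto_enat
    by (auto simp: sets_vimage_algebra2)
qed

lemma measurable_restrict_null_law:
  "(\<lambda>\<omega>. restrict \<omega> {1..n}) \<in> null_law P0 \<rightarrow>\<^sub>M PiM {1..n} (\<lambda>_. P0 \<Otimes>\<^sub>M unif01)"
  unfolding null_law_def by (rule measurable_restrict_subset) auto

lemma sets_rand_filtration_subset: "sets (rand_filtration P0 (enat n)) \<subseteq> sets (null_law P0)"
  unfolding sets_rand_filtration using measurable_sets[OF measurable_restrict_null_law] by auto

lemma space_rand_filtration [simp]: "space (rand_filtration P0 t) = space (null_law P0)"
  by (simp add: rand_filtration_def)

locale change_point =
  fixes P0 P1 :: "'a measure" and L :: "'a \<Rightarrow> real"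
  assumes P0: "prob_space P0" and P1: "prob_space P1" and sets_eq: "sets P1 = sets P0"
    and L_meas [measurable]: "L \<in> borel_measurable P0" and L_nonneg: "\<And>x. x \<in> space P0 \<Longrightarrow> 0 \<le> L x"
    and L_dens: "density P0 (\<lambda>x. ennreal (L x)) = P1"
begin

abbreviation law :: "nat \<Rightarrow> 'a path measure" where
  "law \<nu> \<equiv> change_law P0 \<nu> P1"

lemma sets_change_law [measurable_cong]: "sets (law \<nu>) = sets (null_law P0)"
  unfolding change_law_def null_law_def
  by (intro sets_PiM_cong refl sets_pair_measure_cong) (auto simp: sets_eq)

lemma space_change_law: "space (law \<nu>) = space (null_law P0)"
  using sets_change_law by (rule sets_eq_imp_space_eq)

lemma prob_space_change_law: "prob_space (law \<nu>)"
  unfolding change_law_def by (intro prob_space_PiM prob_space_pair_unif01) (simp add: P0 P1)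

lemma pair_density: "density (P0 \<Otimes>\<^sub>M unif01) (\<lambda>x. ennreal (L (fst x))) = P1 \<Otimes>\<^sub>M unif01"
proof -
  interpret U: prob_space unif01 by (rule prob_space_unif01)
  have "P1 \<Otimes>\<^sub>M unif01 = density P0 (\<lambda>x. ennreal (L x)) \<Otimes>\<^sub>M density unif01 (\<lambda>_. 1)"
    by (simp add: L_dens density_1)
  also have "\<dots> = density (P0 \<Otimes>\<^sub>M unif01) (\<lambda>(x, y). ennreal (L x) * 1)"
    by (rule pair_measure_density) (auto simp: density_1 intro: U.sigma_finite_measure_axioms)
  finally show ?thesis by (simp add: case_prod_beta')
qed

text \<open>Infinite product laws are in general mutually singular, so a density exists only on
  events determined by time \<open>n\<close>. There the claim reduces to the finite product of the
  first \<open>n\<close> pairs, with density factor 1 up to \<nu> and \<open>L\<close>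
  afterwards.\<close>

lemma change_of_measure:
  assumes A: "A \<in> sets (rand_filtration P0 (enat n))" and \<nu>: "\<nu> \<le> n"
  shows "emeasure (law \<nu>) A
    = (\<integral>\<^sup>+\<omega>. (\<Prod>i=Suc \<nu>..n. ennreal (L (obs i \<omega>))) * indicator A \<omega> \<partial>null_law P0)"
proof -
  let ?R = "P0 \<Otimes>\<^sub>M unif01" and ?I = "{1..n}"
  let ?Q = "\<lambda>i. (if i \<le> \<nu> then P0 else P1) \<Otimes>\<^sub>M unif01"
  let ?l = "\<lambda>i x. if i \<le> \<nu> then 1 else ennreal (L (fst x))"
  let ?r = "\<lambda>\<omega>. restrict \<omega> ?I"
  interpret R: prob_space ?R by (intro prob_space_pair_unif01 P0)
  interpret Q: prob_space "?Q i" for i by (intro prob_space_pair_unif01) (simp add: P0 P1)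
  interpret PR: product_prob_space "\<lambda>_::nat. ?R" "{1..}" ..
  interpret PQ: product_prob_space ?Q "{1..}" ..
  have dens: "density (PiM ?I (\<lambda>_. ?R)) (\<lambda>\<omega>. \<Prod>i\<in>?I. ?l i (\<omega> i)) = PiM ?I ?Q"
  proof (rule density_PiM)
    show "?l i \<in> borel_measurable ?R" for i :: nat
      by (cases "i \<le> \<nu>") simp_all
    show "?Q i = density ?R (?l i)" for i :: nat
      by (cases "i \<le> \<nu>") (simp_all only: pair_density density_1 if_True if_False)
    show "prob_space ?R" by (rule R.prob_space_axioms)
    show "prob_space (?Q i)" for i by (rule Q.prob_space_axioms)
  qed simp
  have rR: "distr (null_law P0) (PiM ?I (\<lambda>_. ?R)) ?r = PiM ?I (\<lambda>_. ?R)"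
    unfolding null_law_def by (rule PR.distr_PiM_restrict_finite) auto
  have rQ': "distr (law \<nu>) (PiM ?I ?Q) ?r = PiM ?I ?Q"
    unfolding change_law_def by (rule PQ.distr_PiM_restrict_finite) simp_all
  have sQR: "sets (PiM ?I ?Q) = sets (PiM ?I (\<lambda>_. ?R))"
    by (intro sets_PiM_cong refl sets_pair_measure_cong) (simp add: sets_eq)
  have rQ: "distr (law \<nu>) (PiM ?I (\<lambda>_. ?R)) ?r = PiM ?I ?Q"
    by (rule trans[OF distr_cong[OF refl sQR[symmetric] refl] rQ'])
  obtain B where B: "B \<in> sets (PiM ?I (\<lambda>_. ?R))" "A = ?r -` B \<inter> space (null_law P0)"
    using A unfolding sets_rand_filtration by auto
  have rm: "?r \<in> law \<nu> \<rightarrow>\<^sub>M PiM ?I (\<lambda>_. ?R)"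
    using measurable_restrict_null_law[of n P0] by (simp cong: measurable_cong_sets add: sets_change_law)
  have lm: "(\<lambda>\<omega>. \<Prod>i\<in>?I. ?l i (\<omega> i)) \<in> borel_measurable (PiM ?I (\<lambda>_. ?R))"
    by measurable
  have "emeasure (law \<nu>) A = emeasure (distr (law \<nu>) (PiM ?I (\<lambda>_. ?R)) ?r) B"
    using B rm by (simp add: emeasure_distr space_change_law)
  also have "\<dots> = emeasure (density (PiM ?I (\<lambda>_. ?R)) (\<lambda>\<omega>. \<Prod>i\<in>?I. ?l i (\<omega> i))) B"
    by (simp only: rQ dens)
  also have "\<dots> = (\<integral>\<^sup>+\<omega>. (\<Prod>i\<in>?I. ?l i (\<omega> i)) * indicator B \<omega> \<partial>PiM ?I (\<lambda>_. ?R))"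
    using B lm by (intro emeasure_density) auto
  also have "\<dots> = (\<integral>\<^sup>+\<omega>. (\<Prod>i\<in>?I. ?l i (\<omega> i)) * indicator B \<omega> \<partial>distr (null_law P0) (PiM ?I (\<lambda>_. ?R)) ?r)"
    by (simp only: rR)
  also have "\<dots> = (\<integral>\<^sup>+\<omega>. (\<Prod>i\<in>?I. ?l i (?r \<omega> i)) * indicator B (?r \<omega>) \<partial>null_law P0)"
    using B lm by (intro nn_integral_distr measurable_restrict_null_law) auto
  also have "\<dots> = (\<integral>\<^sup>+\<omega>. (\<Prod>i=Suc \<nu>..n. ennreal (L (obs i \<omega>))) * indicator A \<omega> \<partial>null_law P0)"
  proof (rule nn_integral_cong)
    fix \<omega> assume \<omega>: "\<omega> \<in> space (null_law P0)"
    have "(\<Prod>i\<in>?I. ?l i (?r \<omega> i)) = (\<Prod>i=Suc \<nu>..n. ennreal (L (obs i \<omega>)))"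
      using \<nu> by (intro prod.mono_neutral_cong_right) auto
    then show "(\<Prod>i\<in>?I. ?l i (?r \<omega> i)) * indicator B (?r \<omega>) = (\<Prod>i=Suc \<nu>..n. ennreal (L (obs i \<omega>))) * indicator A \<omega>"
      using \<omega> B by (simp add: indicator_def)
  qed
  finally show ?thesis .
qed

text \<open>The case n = \<nu>, where the likelihood ratio is an empty product.\<close>

lemma change_law_before:
  assumes A: "A \<in> sets (rand_filtration P0 (enat \<nu>))"
  shows "emeasure (law \<nu>) A = emeasure (null_law P0) A"
  using change_of_measure[OF A order.refl] A sets_rand_filtration_subset[of P0 \<nu>] by auto

end

lemma integral_fst_unif01:
  fixes g :: "'a \<Rightarrow> real"
  assumes "g \<in> borel_measurable P"
  shows "(\<integral>x. g (fst x) \<partial>(P \<Otimes>\<^sub>M unif01)) = (\<integral>x. g x \<partial>P)"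
proof -
  interpret U: prob_space unif01 by (rule prob_space_unif01)
  show ?thesis
    using integral_distr[OF measurable_fst assms, of unif01] U.distr_pair_fst[of P] by simp
qed

lemma nn_integral_fst_unif01:
  assumes "g \<in> borel_measurable P"
  shows "(\<integral>\<^sup>+x. g (fst x) \<partial>(P \<Otimes>\<^sub>M unif01)) = (\<integral>\<^sup>+x. g x \<partial>P)"
proof -
  interpret U: prob_space unif01 by (rule prob_space_unif01)
  show ?thesis
    using nn_integral_distr[OF measurable_fst[of P unif01], of g] assms U.distr_pair_fst[of P] by simp
qed

section \<open>The log-likelihood ratio after the change\<close>

locale change_point_kl = change_point +
  fixes D :: real
  assumes int_lnL: "integrable P1 (\<lambda>x. ln (L x))" and D_eq: "(\<integral>x. ln (L x) \<partial>P1) = D" and D_pos: "0 < D"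
begin

lemma L_meas1 [measurable]: "L \<in> borel_measurable P1"
  using L_meas sets_eq by (simp cong: measurable_cong_sets)

lemma nn_integral_change_law_obs:
  assumes g: "g \<in> borel_measurable P1" and i: "\<nu> < i"
  shows "(\<integral>\<^sup>+\<omega>. g (obs i \<omega>) \<partial>law \<nu>) = (\<integral>\<^sup>+x. g x \<partial>P1)"
proof -
  let ?Q = "\<lambda>i. (if i \<le> \<nu> then P0 else P1) \<Otimes>\<^sub>M unif01"
  have i1: "i \<in> {1..}" using i by auto
  have "distr (law \<nu>) (?Q i) (\<lambda>\<omega>. \<omega> i) = ?Q i"
    unfolding change_law_def
    by (rule distr_PiM_component[of "{1..}" ?Q i, OF _ i1]) (simp add: prob_space_pair_unif01 P0 P1)
  moreover have "?Q i = P1 \<Otimes>\<^sub>M unif01" using i by simp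
  ultimately have d: "distr (law \<nu>) (P1 \<Otimes>\<^sub>M unif01) (\<lambda>\<omega>. \<omega> i) = P1 \<Otimes>\<^sub>M unif01" by metis
  have m: "(\<lambda>\<omega>. \<omega> i) \<in> law \<nu> \<rightarrow>\<^sub>M P1 \<Otimes>\<^sub>M unif01"
    unfolding change_law_def using measurable_component_singleton[OF i1, of ?Q] i by simp
  have "(\<integral>\<^sup>+x. g (fst x) \<partial>distr (law \<nu>) (P1 \<Otimes>\<^sub>M unif01) (\<lambda>\<omega>. \<omega> i)) = (\<integral>\<^sup>+\<omega>. g (obs i \<omega>) \<partial>law \<nu>)"
    by (rule nn_integral_distr[OF m]) (use measurable_compose[OF measurable_fst g] in simp)
  then show ?thesis by (simp only: d nn_integral_fst_unif01[OF g])
qed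

lemma AE_L_pos: "AE x in P1. 0 < L x"
proof -
  have "AE x in density P0 (\<lambda>x. ennreal (L x)). 0 < L x"
    by (subst AE_density) simp_all
  then show ?thesis by (simp only: L_dens)
qed

text \<open>As \<open>ln 0 = 0\<close> here, a product of likelihood ratios is the exponential of
  the sum of logarithms only where all factors are positive.\<close>

lemma AE_change_law_L_pos: "AE \<omega> in law \<nu>. \<forall>i>\<nu>. 0 < L (obs i \<omega>)"
proof -
  have "AE \<omega> in law \<nu>. 0 < L (obs i \<omega>)" if i: "\<nu> < i" for i
  proof -
    interpret U: prob_space unif01 by (rule prob_space_unif01)
    have "AE x in P1 \<Otimes>\<^sub>M unif01. 0 < L (fst x)"
    proof (rule AE_distrD[of fst _ P1])
      show "AE x in distr (P1 \<Otimes>\<^sub>M unif01) P1 fst. 0 < L x"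
        unfolding U.distr_pair_fst by (rule AE_L_pos)
    qed simp
    then have "AE x in (if i \<le> \<nu> then P0 else P1) \<Otimes>\<^sub>M unif01. 0 < L (fst x)" using i by simp
    then show ?thesis
      unfolding change_law_def using i
      by (intro AE_PiM_component[of "{1..}" "\<lambda>i. (if i \<le> \<nu> then P0 else P1) \<Otimes>\<^sub>M unif01" i "\<lambda>x. 0 < L (fst x)"]
          prob_space_pair_unif01) (simp_all add: P0 P1)
  qed
  then show ?thesis by (subst AE_all_countable) (auto intro: AE_impI)
qed

lemma Hoeffding_change_law:
  fixes g :: "'a \<Rightarrow> real"
  assumes g[measurable]: "g \<in> borel_measurable P1" and bd: "\<And>x. a \<le> g x \<and> g x \<le> b" and ab: "a < b"
    and \<epsilon>: "0 \<le> \<epsilon>" and m: "1 \<le> m"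
  shows "measure (law \<nu>) {\<omega>\<in>space (law \<nu>). (\<Sum>i=Suc \<nu>..\<nu>+m. g (obs i \<omega>)) \<ge> real m * ((\<integral>x. g x \<partial>P1) + \<epsilon>)}
      \<le> exp (- 2 * real m * \<epsilon>\<^sup>2 / (b - a)\<^sup>2)" (is ?ge)
    and "measure (law \<nu>) {\<omega>\<in>space (law \<nu>). (\<Sum>i=Suc \<nu>..\<nu>+m. g (obs i \<omega>)) \<le> real m * ((\<integral>x. g x \<partial>P1) - \<epsilon>)}
      \<le> exp (- 2 * real m * \<epsilon>\<^sup>2 / (b - a)\<^sup>2)" (is ?le)
proof -
  let ?Q = "\<lambda>i. (if i \<le> \<nu> then P0 else P1) \<Otimes>\<^sub>M unif01"
  have c: "card {Suc \<nu>..\<nu>+m} = m" by simp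
  have Qp: "prob_space (?Q i)" for i by (simp add: prob_space_pair_unif01 P0 P1)
  have J: "finite {Suc \<nu>..\<nu>+m}" "{Suc \<nu>..\<nu>+m} \<noteq> {}" "{Suc \<nu>..\<nu>+m} \<subseteq> {1..}" using m by auto
  have Q: "?Q i = P1 \<Otimes>\<^sub>M unif01" if "i \<in> {Suc \<nu>..\<nu>+m}" for i using that by auto
  have gm: "(\<lambda>x. g (fst x)) \<in> borel_measurable (P1 \<Otimes>\<^sub>M unif01)" by measurable
  have bd': "a \<le> g (fst x) \<and> g (fst x) \<le> b" for x :: "'a \<times> real" by (rule bd)
  note H = Hoeffding_PiM[of "{1..}" ?Q "{Suc \<nu>..\<nu>+m}", OF Qp J Q gm bd' ab \<epsilon>,
      unfolded c integral_fst_unif01[OF g], folded change_law_def]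
  show ?ge by (rule H(1))
  show ?le by (rule H(2))
qed

text \<open>No variance is available, only integrability: Hoeffding handles ln L truncated at level
  \<open>A\<close>, Markov's inequality handles the excess above \<open>A\<close>. Both bounds
  depend on the block length alone, which makes the result uniform in \<nu>.\<close>

lemma lr_tail:
  assumes \<delta>: "0 < \<delta>" and \<eta>: "0 < \<eta>"
  shows "\<exists>m0. \<forall>m\<ge>m0. \<forall>\<nu>. measure (law \<nu>)
     {\<omega>\<in>space (law \<nu>). (\<Sum>i=Suc \<nu>..\<nu>+m. ln (L (obs i \<omega>))) \<ge> real m * (D + \<delta>)} \<le> \<eta>"
proof -
  let ?Y = "\<lambda>x. ln (L x)"
  let ?clip = "\<lambda>A x. max (- real A) (min (real A) (?Y x))" and ?exc = "\<lambda>A x. max 0 (?Y x - real A)"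
  have large: "eventually (\<lambda>A. \<bar>?Y x\<bar> \<le> real A) sequentially" for x
  proof -
    obtain n where n: "\<bar>?Y x\<bar> \<le> real n" using real_arch_simple by blast
    show ?thesis
      using eventually_ge_at_top[of n] by eventually_elim (use n in linarith)
  qed
  have "(\<lambda>A. \<integral>x. ?clip A x \<partial>P1) \<longlonglongrightarrow> (\<integral>x. ?Y x \<partial>P1)"
  proof (rule integral_dominated_convergence[where w="\<lambda>x. \<bar>?Y x\<bar>"])
    show "AE x in P1. (\<lambda>A. ?clip A x) \<longlonglongrightarrow> ?Y x"
    proof (rule AE_I2)
      fix x
      have "eventually (\<lambda>A. ?clip A x = ?Y x) sequentially"
        using large[of x] by eventually_elim (auto simp: max_def min_def)
      then show "(\<lambda>A. ?clip A x) \<longlonglongrightarrow> ?Y x" by (rule tendsto_eventually)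
    qed
    show "AE x in P1. norm (?clip A x) \<le> \<bar>?Y x\<bar>" for A by (intro AE_I2) (auto simp: max_def min_def)
  qed (use int_lnL in auto)
  then have 1: "eventually (\<lambda>A. (\<integral>x. ?clip A x \<partial>P1) < D + \<delta>/4) sequentially"
    using \<delta> by (intro order_tendstoD) (auto simp: D_eq)
  have "(\<lambda>A. \<integral>x. ?exc A x \<partial>P1) \<longlonglongrightarrow> (\<integral>x. 0 \<partial>P1)"
  proof (rule integral_dominated_convergence[where w="\<lambda>x. \<bar>?Y x\<bar>"])
    show "AE x in P1. (\<lambda>A. ?exc A x) \<longlonglongrightarrow> 0"
    proof (rule AE_I2)
      fix x
      have "eventually (\<lambda>A. ?exc A x = 0) sequentially"
        using large[of x] by eventually_elim (auto simp: max_def)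
      then show "(\<lambda>A. ?exc A x) \<longlonglongrightarrow> 0" by (rule tendsto_eventually)
    qed
    show "AE x in P1. norm (?exc A x) \<le> \<bar>?Y x\<bar>" for A by (intro AE_I2) (auto simp: max_def)
  qed (use int_lnL in auto)
  then have 2: "eventually (\<lambda>A. (\<integral>x. ?exc A x \<partial>P1) < \<eta> * \<delta> / 4) sequentially"
    using \<delta> \<eta> by (intro order_tendstoD) auto
  obtain A where A: "(\<integral>x. ?clip A x \<partial>P1) < D + \<delta>/4" "(\<integral>x. ?exc A x \<partial>P1) < \<eta> * \<delta> / 4" "1 \<le> A"
    using eventually_happens[OF eventually_conj[OF 1 eventually_conj[OF 2 eventually_ge_at_top[of 1]]]] by auto
  \<comment> \<open>Hoeffding's rate for deviation \<delta>/4 and a range of length 2 A.\<close>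
  define r where "r = 2 * (\<delta>/4)\<^sup>2 / (real A - - real A)\<^sup>2"
  have r: "r > 0" using \<delta> A(3) by (simp add: r_def)
  have "((\<lambda>m. exp (- r * real m)) \<longlongrightarrow> 0) sequentially" using r by real_asymp
  then have "eventually (\<lambda>m. exp (- r * real m) < \<eta> / 2) sequentially"
    using \<eta> by (intro order_tendstoD) auto
  then obtain m0 where m0: "\<And>m. m \<ge> m0 \<Longrightarrow> exp (- r * real m) < \<eta> / 2"
    by (auto simp: eventually_sequentially)
  show ?thesis
  proof (intro exI[of _ "max 1 m0"] allI impI)
    fix m \<nu> assume "max 1 m0 \<le> m"
    then have m: "1 \<le> m" "m0 \<le> m" by auto
    let ?M = "law \<nu>"
    interpret M: prob_space ?M by (rule prob_space_change_law)
    have obs[measurable]: "obs i \<in> ?M \<rightarrow>\<^sub>M P1" if "Suc \<nu> \<le> i" for i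
      using measurable_obs[of i P0] that sets_change_law[of \<nu>] sets_eq by (simp cong: measurable_cong_sets)
    let ?E1 = "{\<omega>\<in>space ?M. (\<Sum>i=Suc \<nu>..\<nu>+m. ?clip A (obs i \<omega>)) \<ge> real m * ((\<integral>x. ?clip A x \<partial>P1) + \<delta>/4)}"
    let ?E2 = "{\<omega>\<in>space ?M. (\<Sum>i=Suc \<nu>..\<nu>+m. ?exc A (obs i \<omega>)) \<ge> real m * (\<delta>/2)}"
    have sum_exc: "(\<lambda>\<omega>. \<Sum>i=Suc \<nu>..\<nu>+m. ?exc A (obs i \<omega>)) \<in> borel_measurable ?M"
      by (intro borel_measurable_sum measurable_compose[OF obs]) auto
    have sum_clip: "(\<lambda>\<omega>. \<Sum>i=Suc \<nu>..\<nu>+m. ?clip A (obs i \<omega>)) \<in> borel_measurable ?M"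
      by (intro borel_measurable_sum measurable_compose[OF obs]) auto
    have E: "?E1 \<in> sets ?M" "?E2 \<in> sets ?M"
      using sum_exc sum_clip by simp_all
    have "{\<omega>\<in>space ?M. (\<Sum>i=Suc \<nu>..\<nu>+m. ?Y (obs i \<omega>)) \<ge> real m * (D + \<delta>)} \<subseteq> ?E1 \<union> ?E2"
    proof safe
      fix \<omega> assume \<omega>: "(\<Sum>i=Suc \<nu>..\<nu>+m. ?Y (obs i \<omega>)) \<ge> real m * (D + \<delta>)"
        and not: "\<not> real m * (\<delta>/2) \<le> (\<Sum>i=Suc \<nu>..\<nu>+m. ?exc A (obs i \<omega>))"
      \<comment> \<open>Clipping from below only raises the sum, so the lower tail of ln L needs no
        correction. The budget \<delta> splits into \<delta>/4 for the truncated mean, \<delta>/4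
        for Hoeffding and \<delta>/2 for the excess.\<close>
      have "(\<Sum>i=Suc \<nu>..\<nu>+m. ?Y (obs i \<omega>)) \<le> (\<Sum>i=Suc \<nu>..\<nu>+m. ?clip A (obs i \<omega>) + ?exc A (obs i \<omega>))"
        by (intro sum_mono) (auto simp: max_def min_def)
      then have "real m * (D + \<delta>) \<le> (\<Sum>i=Suc \<nu>..\<nu>+m. ?clip A (obs i \<omega>)) + real m * (\<delta>/2)"
        using \<omega> not by (simp add: sum.distrib)
      moreover have "real m * ((\<integral>x. ?clip A x \<partial>P1) + \<delta>/4) \<le> real m * (D + \<delta>/4 + \<delta>/4)"
        using A(1) by (intro mult_left_mono) auto
      ultimately show "real m * ((\<integral>x. ?clip A x \<partial>P1) + \<delta>/4) \<le> (\<Sum>i=Suc \<nu>..\<nu>+m. ?clip A (obs i \<omega>))"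
        by (simp add: algebra_simps)
    qed
    then have "measure ?M {\<omega>\<in>space ?M. (\<Sum>i=Suc \<nu>..\<nu>+m. ?Y (obs i \<omega>)) \<ge> real m * (D + \<delta>)} \<le> M.prob ?E1 + M.prob ?E2"
      using E by (intro order.trans[OF M.finite_measure_mono measure_Un_le]) auto
    also have "M.prob ?E1 \<le> \<eta> / 2"
    proof -
      have "M.prob ?E1 \<le> exp (- 2 * real m * (\<delta>/4)\<^sup>2 / (real A - - real A)\<^sup>2)"
        by (rule Hoeffding_change_law) (use A(3) \<delta> m in auto)
      also have "\<dots> = exp (- r * real m)" by (simp add: r_def)
      finally show ?thesis using m0[OF m(2)] by simp
    qed
    also have "M.prob ?E2 \<le> \<eta> / 2"
    proof -
      have exc0: "0 \<le> ?exc A x" for x by simp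
      have int: "integrable P1 (?exc A)"
        by (rule Bochner_Integration.integrable_bound[OF int_lnL]) (auto simp: max_def)
      have "(\<integral>\<^sup>+\<omega>. ennreal (\<Sum>i=Suc \<nu>..\<nu>+m. ?exc A (obs i \<omega>)) \<partial>?M) = (\<integral>\<^sup>+\<omega>. (\<Sum>i=Suc \<nu>..\<nu>+m. ennreal (?exc A (obs i \<omega>))) \<partial>?M)"
        by (intro nn_integral_cong sum_ennreal[symmetric] exc0)
      also have "\<dots> = (\<Sum>i=Suc \<nu>..\<nu>+m. \<integral>\<^sup>+\<omega>. ennreal (?exc A (obs i \<omega>)) \<partial>?M)"
        by (intro nn_integral_sum measurable_compose[OF obs]) auto
      also have "\<dots> = (\<Sum>i=Suc \<nu>..\<nu>+m. \<integral>\<^sup>+x. ennreal (?exc A x) \<partial>P1)"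
        by (intro sum.cong refl nn_integral_change_law_obs) auto
      also have "\<dots> = ennreal (real m * (\<integral>x. ?exc A x \<partial>P1))"
        using int by (subst nn_integral_eq_integral) (auto simp: ennreal_mult ennreal_of_nat_eq_real_of_nat)
      finally have ex: "(\<integral>\<^sup>+\<omega>. ennreal (\<Sum>i=Suc \<nu>..\<nu>+m. ?exc A (obs i \<omega>)) \<partial>?M) = ennreal (real m * (\<integral>x. ?exc A x \<partial>P1))" .
      \<comment> \<open>Markov's inequality: mean excess below \<eta> \<delta> / 4 per step against
        the threshold \<delta> / 2 leaves probability at most \<eta> / 2.\<close>
      have "ennreal (real m * (\<delta>/2) * M.prob ?E2) = ennreal (real m * (\<delta>/2)) * emeasure ?M ?E2"
        unfolding M.emeasure_eq_measure using \<delta> by (intro ennreal_mult) auto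
      also have "\<dots> = (\<integral>\<^sup>+\<omega>. ennreal (real m * (\<delta>/2)) * indicator ?E2 \<omega> \<partial>?M)"
        using E by (simp add: nn_integral_cmult_indicator)
      also have "\<dots> \<le> (\<integral>\<^sup>+\<omega>. ennreal (\<Sum>i=Suc \<nu>..\<nu>+m. ?exc A (obs i \<omega>)) \<partial>?M)"
        by (intro nn_integral_mono) (auto simp: indicator_def intro: ennreal_leI)
      finally have "ennreal (real m * (\<delta>/2) * M.prob ?E2) \<le> ennreal (real m * (\<integral>x. ?exc A x \<partial>P1))"
        unfolding ex .
      then have "real m * (\<delta>/2) * M.prob ?E2 \<le> real m * (\<integral>x. ?exc A x \<partial>P1)"
        by (subst (asm) ennreal_le_iff) auto
      then have "(\<delta>/2) * M.prob ?E2 \<le> \<eta> * \<delta> / 4"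
        using A(2) m by (simp add: mult.assoc)
      then show ?thesis using \<delta> by (simp add: field_simps)
    qed
    finally show "measure ?M {\<omega>\<in>space ?M. (\<Sum>i=Suc \<nu>..\<nu>+m. ?Y (obs i \<omega>)) \<ge> real m * (D + \<delta>)} \<le> \<eta>" by simp
  qed
qed

end

section \<open>Lower bound on the detection delay\<close>

lemma measurable_coord_filtration:
  assumes "i \<in> times_upto t"
  shows "(\<lambda>\<omega>. \<omega> i) \<in> rand_filtration P0 t \<rightarrow>\<^sub>M P0 \<Otimes>\<^sub>M borel"
proof -
  let ?g = "\<lambda>\<omega>. \<lambda>i\<in>times_upto t. (obs i \<omega>, rnd i \<omega>)"
  have "?g \<in> space (null_law P0) \<rightarrow> space (PiM (times_upto t) (\<lambda>_. P0 \<Otimes>\<^sub>M borel))"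
    by (auto simp: space_null_law space_PiM PiE_iff space_pair_measure times_upto_def)
  then have "?g \<in> rand_filtration P0 t \<rightarrow>\<^sub>M PiM (times_upto t) (\<lambda>_. P0 \<Otimes>\<^sub>M borel)"
    unfolding rand_filtration_def by (rule measurable_vimage_algebra1)
  from measurable_compose[OF this measurable_component_singleton[OF assms]]
  show ?thesis using assms by simp
qed

lemma measurable_obs_filtration:
  assumes "1 \<le> i" "i \<le> n" shows "obs i \<in> rand_filtration P0 (enat n) \<rightarrow>\<^sub>M P0"
  by (rule measurable_compose[OF measurable_coord_filtration measurable_fst]) (use assms in \<open>simp add: times_upto_enat\<close>)

lemma rand_filtration_mono:
  assumes A: "A \<in> sets (rand_filtration P0 (enat n))" and n: "n \<le> n'"
  shows "A \<in> sets (rand_filtration P0 (enat n'))"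
proof -
  obtain B where B: "B \<in> sets (PiM {1..n} (\<lambda>_. P0 \<Otimes>\<^sub>M unif01))"
    "A = (\<lambda>\<omega>. restrict \<omega> {1..n}) -` B \<inter> space (null_law P0)"
    using A unfolding sets_rand_filtration by auto
  let ?B' = "(\<lambda>\<omega>. restrict \<omega> {1..n}) -` B \<inter> space (PiM {1..n'} (\<lambda>_. P0 \<Otimes>\<^sub>M unif01))"
  have "?B' \<in> sets (PiM {1..n'} (\<lambda>_. P0 \<Otimes>\<^sub>M unif01))"
    by (rule measurable_sets[OF measurable_restrict_subset B(1)]) (use n in auto)
  moreover have "A = (\<lambda>\<omega>. restrict \<omega> {1..n'}) -` ?B' \<inter> space (null_law P0)"
  proof -
    have "restrict (restrict \<omega> {1..n'}) {1..n} = restrict \<omega> {1..n}" for \<omega> :: "'a path"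
      using n by (auto simp: restrict_def fun_eq_iff)
    then show ?thesis
      unfolding B(2) using measurable_space[OF measurable_restrict_null_law[of n' P0]] by auto
  qed
  ultimately show ?thesis unfolding sets_rand_filtration by blast
qed

lemma T_rand_le_sets:
  assumes "\<tau> \<in> T_rand P0"
  shows "{\<omega>\<in>space (null_law P0). \<tau> \<omega> \<le> enat n} \<in> sets (rand_filtration P0 (enat n))"
  using assms stopping_timeD[of "rand_filtration P0" \<tau> "enat n"]
  unfolding T_rand_def by (simp add: pred_def)

lemma T_rand_less_sets:
  assumes "\<tau> \<in> T_rand P0"
  shows "{\<omega>\<in>space (null_law P0). enat n < \<tau> \<omega>} \<in> sets (rand_filtration P0 (enat n))"
  using assms stopping_timeD2[of "rand_filtration P0" \<tau> "enat n"]
  unfolding T_rand_def by (simp add: pred_def)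

lemma T_rand_sets_null_law:
  assumes "\<tau> \<in> T_rand P0"
  shows "{\<omega>\<in>space (null_law P0). \<tau> \<omega> \<le> enat n} \<in> sets (null_law P0)"
    and "{\<omega>\<in>space (null_law P0). enat n < \<tau> \<omega>} \<in> sets (null_law P0)"
  by (rule subsetD[OF sets_rand_filtration_subset T_rand_le_sets[OF assms]])
    (rule subsetD[OF sets_rand_filtration_subset T_rand_less_sets[OF assms]])

text \<open>A finite time t lies in (\<nu>, \<nu> + m] for at most m values of \<nu>, and for none
  of the listed ones if t > n + m.\<close>

lemma sum_window_le:
  fixes \<tau> :: enat
  shows "(\<Sum>\<nu>\<in>{a..n}. of_bool (enat \<nu> < \<tau> \<and> \<tau> \<le> enat (\<nu> + m)) :: ennreal) \<le> of_nat m * of_bool (\<tau> \<le> enat (n + m))"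
proof (cases \<tau>)
  case (enat t)
  have "{\<nu>\<in>{a..n}. \<nu> < t \<and> t \<le> \<nu> + m} \<subseteq> {t-m..<t}" by auto
  from card_mono[OF _ this] have c: "card {\<nu>\<in>{a..n}. \<nu> < t \<and> t \<le> \<nu> + m} \<le> m" by simp
  have e: "(\<Sum>\<nu>\<in>{a..n}. of_bool (enat \<nu> < \<tau> \<and> \<tau> \<le> enat (\<nu> + m)) :: ennreal) = of_nat (card {\<nu>\<in>{a..n}. \<nu> < t \<and> t \<le> \<nu> + m})"
    by (simp add: enat Int_def)
  show ?thesis
  proof (cases "t \<le> n + m")
    case True
    then have "of_bool (\<tau> \<le> enat (n + m)) = (1::ennreal)" by (simp add: enat)
    then show ?thesis unfolding e using of_nat_mono[OF c, where 'a=ennreal] by (simp only: mult_1_right)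
  next
    case False
    then have "{\<nu>\<in>{a..n}. \<nu> < t \<and> t \<le> \<nu> + m} = {}" by auto
    then show ?thesis unfolding e by (simp only: card.empty of_nat_0 zero_le)
  qed
qed simp

text \<open>Allows the lower bound to drop the conditioning probability, including the degenerate
  value 0.\<close>

lemma le_divide_ennreal:
  assumes "d \<le> 1" shows "x \<le> x / (d :: ennreal)"
proof -
  obtain r where r: "d = ennreal r" "0 \<le> r" "r \<le> 1"
    using assms by (cases d) (auto simp: top_unique)
  have "1 \<le> inverse d"
  proof (cases "r = 0")
    case False
    then have "1 \<le> inverse r" using r by (simp add: one_le_inverse)
    then show ?thesis
      using False r by (simp add: inverse_ennreal)
  qed (simp add: r)
  then have "x * 1 \<le> x * inverse d" by (rule mult_left_mono) simp
  then show ?thesis by (simp add: divide_ennreal_def)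
qed

context change_point
begin

text \<open>The minimum over the window is at most the average. The window has at least (1 -
  \<kappa>) n points and m \<le> n gives n + m \<le> 2 n, so \<open>n\<close> cancels and the
  constant 2 remains.\<close>

lemma exists_quiet_window:
  assumes \<tau>: "\<tau> \<in> C_lin P0 \<gamma> (T_rand P0)" and \<gamma>: "0 < \<gamma>" and \<kappa>: "0 < \<kappa>" "\<kappa> < 1" and n: "1 \<le> n" "m \<le> n"
  shows "\<exists>\<nu>\<in>change_window n \<kappa>. measure (null_law P0) {\<omega>\<in>space (null_law P0). enat \<nu> < \<tau> \<omega> \<and> \<tau> \<omega> \<le> enat (\<nu> + m)}
     \<le> 2 * real m / ((1 - \<kappa>) * \<gamma>)"
proof -
  interpret N: prob_space "null_law P0" by (rule prob_space_null_law[OF P0])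
  define a where "a = nat \<lceil>\<kappa> * real n\<rceil>"
  have W: "change_window n \<kappa> = {a..n}" by (simp add: change_window_def a_def)
  have "real a = of_int \<lceil>\<kappa> * real n\<rceil>" using \<kappa> unfolding a_def by simp
  then have a: "real a < \<kappa> * real n + 1" by linarith
  have "\<kappa> * real n < real n" using \<kappa> n by simp
  then have an: "a \<le> n" using a by linarith
  let ?A = "\<lambda>\<nu>. {\<omega>\<in>space (null_law P0). enat \<nu> < \<tau> \<omega> \<and> \<tau> \<omega> \<le> enat (\<nu> + m)}"
  have \<tau>T: "\<tau> \<in> T_rand P0" using \<tau> by (simp add: C_lin_def)
  have As: "?A \<nu> \<in> sets (null_law P0)" for \<nu>
  proof -
    have "?A \<nu> = {\<omega>\<in>space (null_law P0). enat \<nu> < \<tau> \<omega>} \<inter> {\<omega>\<in>space (null_law P0). \<tau> \<omega> \<le> enat (\<nu> + m)}" by auto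
    then show ?thesis
      using sets.Int[OF T_rand_sets_null_law(2,1)[OF \<tau>T], of \<nu> "\<nu> + m"] by simp
  qed
  let ?B = "{\<omega>\<in>space (null_law P0). \<tau> \<omega> \<le> enat (n + m)}"
  have Bs: "?B \<in> sets (null_law P0)" by (rule T_rand_sets_null_law(1)[OF \<tau>T])
  have "(\<Sum>\<nu>\<in>{a..n}. emeasure (null_law P0) (?A \<nu>)) = (\<integral>\<^sup>+\<omega>. (\<Sum>\<nu>\<in>{a..n}. indicator (?A \<nu>) \<omega>) \<partial>null_law P0)"
    using As by (simp add: nn_integral_sum)
  also have "\<dots> \<le> (\<integral>\<^sup>+\<omega>. of_nat m * indicator ?B \<omega> \<partial>null_law P0)"
  proof (rule nn_integral_mono)
    fix \<omega> assume "\<omega> \<in> space (null_law P0)"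
    then show "(\<Sum>\<nu>\<in>{a..n}. indicator (?A \<nu>) \<omega>) \<le> of_nat m * (indicator ?B \<omega> :: ennreal)"
      using sum_window_le[of "\<tau> \<omega>" m a n] by (simp add: indicator_def of_bool_def cong: sum.cong)
  qed
  also have "\<dots> = of_nat m * emeasure (null_law P0) ?B" using Bs by (rule nn_integral_cmult_indicator)
  finally have "(\<Sum>\<nu>\<in>{a..n}. N.prob (?A \<nu>)) \<le> real m * N.prob ?B"
    by (simp add: N.emeasure_eq_measure ennreal_of_nat_eq_real_of_nat ennreal_mult[symmetric] sum_nonneg)
  also have "N.prob ?B \<le> real (n + m) / \<gamma>"
    using \<tau> unfolding C_lin_def by blast
  finally have sum: "(\<Sum>\<nu>\<in>{a..n}. N.prob (?A \<nu>)) \<le> real m * (real (n + m) / \<gamma>)" by (simp add: mult_left_mono)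
  have ne: "{a..n} \<noteq> {}" using an by simp
  define p where "p = Min ((\<lambda>\<nu>. N.prob (?A \<nu>)) ` {a..n})"
  have "p \<in> (\<lambda>\<nu>. N.prob (?A \<nu>)) ` {a..n}" unfolding p_def using ne by (intro Min_in) auto
  then obtain \<nu> where \<nu>: "\<nu> \<in> {a..n}" "p = N.prob (?A \<nu>)" by auto
  have "real (card {a..n}) * p \<le> (\<Sum>\<nu>\<in>{a..n}. N.prob (?A \<nu>))"
    by (rule sum_bounded_below) (auto simp: p_def)
  also note sum
  also have "real m * (real (n + m) / \<gamma>) \<le> real m * (2 * real n / \<gamma>)"
    using n \<gamma> by (intro mult_left_mono divide_right_mono) auto
  finally have cp: "real (card {a..n}) * p \<le> real m * (2 * real n / \<gamma>)" .
  have "0 \<le> p" unfolding \<nu>(2) by simp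
  \<comment> \<open>The extra point of the closed interval makes up for the ceiling in its left
    end.\<close>
  moreover have "(1 - \<kappa>) * real n \<le> real (card {a..n})"
    using a an by (simp add: algebra_simps)
  ultimately have "(1 - \<kappa>) * real n * p \<le> real m * (2 * real n / \<gamma>)"
    using cp by (meson mult_right_mono order_trans)
  then have "(1 - \<kappa>) * real n * p * \<gamma> \<le> real m * (2 * real n)"
    using \<gamma> by (simp add: pos_le_divide_eq)
  then have "real n * (p * ((1 - \<kappa>) * \<gamma>)) \<le> real n * (2 * real m)" by (simp add: ac_simps)
  then have "p * ((1 - \<kappa>) * \<gamma>) \<le> 2 * real m" using n by (subst (asm) mult_le_cancel_left_pos) auto
  then have "p \<le> 2 * real m / ((1 - \<kappa>) * \<gamma>)"
    using \<kappa> \<gamma> by (simp add: pos_le_divide_eq)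
  then show ?thesis using \<nu> unfolding W by auto
qed

text \<open>Markov's inequality, after dropping the conditioning, which can only lower the
  value.\<close>

lemma cond_delay_ge:
  assumes \<tau>: "\<tau> \<in> T_rand P0"
  shows "ennreal (real m * measure (law \<nu>) {\<omega>\<in>space (null_law P0). enat (\<nu> + m) < \<tau> \<omega>}) \<le> cond_delay P0 \<nu> P1 \<tau>"
proof -
  let ?M = "law \<nu>"
  interpret M: prob_space ?M by (rule prob_space_change_law)
  let ?E = "{\<omega>\<in>space (null_law P0). enat (\<nu> + m) < \<tau> \<omega>}"
  have E: "?E \<in> sets ?M"
    unfolding sets_change_law by (rule T_rand_sets_null_law(2)[OF \<tau>])
  let ?n = "(\<integral>\<^sup>+\<omega>. ennreal_of_enat (\<tau> \<omega> - enat \<nu>) * indicator {\<omega>. enat \<nu> < \<tau> \<omega>} \<omega> \<partial>?M)"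
  have "ennreal (real m * M.prob ?E) = (\<integral>\<^sup>+\<omega>. of_nat m * indicator ?E \<omega> \<partial>?M)"
    using E by (simp add: nn_integral_cmult_indicator M.emeasure_eq_measure ennreal_mult ennreal_of_nat_eq_real_of_nat)
  also have "\<dots> \<le> ?n"
  proof (rule nn_integral_mono)
    fix \<omega>
    show "of_nat m * indicator ?E \<omega> \<le> ennreal_of_enat (\<tau> \<omega> - enat \<nu>) * indicator {\<omega>. enat \<nu> < \<tau> \<omega>} \<omega>"
    proof (cases "\<omega> \<in> ?E")
      case True
      then have l: "enat (\<nu> + m) < \<tau> \<omega>" by simp
      then have "enat m \<le> \<tau> \<omega> - enat \<nu>" by (cases "\<tau> \<omega>") auto
      then have "of_nat m \<le> ennreal_of_enat (\<tau> \<omega> - enat \<nu>)"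
        by (metis ennreal_of_enat_enat ennreal_of_enat_le_iff)
      moreover have "enat \<nu> < \<tau> \<omega>" using l by (cases "\<tau> \<omega>") auto
      ultimately show ?thesis using True by simp
    qed simp
  qed
  also have "?n \<le> cond_delay P0 \<nu> P1 \<tau>"
  proof -
    let ?d = "emeasure ?M {\<omega>\<in>space ?M. enat \<nu> < \<tau> \<omega>}"
    have "?n \<le> ?n / ?d" by (rule le_divide_ennreal[OF M.emeasure_le_1])
    then show ?thesis unfolding cond_delay_def .
  qed
  finally show ?thesis .
qed

text \<open>At the quiet \<nu> there are three ways not to survive until \<nu> + m: stopping by
  \<nu>, stopping in the window while the likelihood ratio is at most \<open>K\<close>, and a
  likelihood ratio above \<open>K\<close>. They account for the three subtracted terms.\<close>

lemma J_delay_lower: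
  assumes \<tau>: "\<tau> \<in> C_lin P0 \<gamma> (T_rand P0)" and \<gamma>: "0 < \<gamma>" and \<kappa>: "0 < \<kappa>" "\<kappa> < 1" and n: "1 \<le> n" "m \<le> n"
    and K: "0 \<le> K" and \<eta>: "\<And>\<nu>. measure (law \<nu>) {\<omega>\<in>space (null_law P0). (\<Prod>i=Suc \<nu>..\<nu>+m. L (obs i \<omega>)) > K} \<le> \<eta>"
  shows "ennreal (real m * (1 - real n / \<gamma> - K * (2 * real m / ((1 - \<kappa>) * \<gamma>)) - \<eta>)) \<le> J_delay P0 P1 n \<kappa> \<tau>"
proof -
  obtain \<nu> where \<nu>: "\<nu> \<in> change_window n \<kappa>"
    and quiet: "measure (null_law P0) {\<omega>\<in>space (null_law P0). enat \<nu> < \<tau> \<omega> \<and> \<tau> \<omega> \<le> enat (\<nu> + m)} \<le> 2 * real m / ((1 - \<kappa>) * \<gamma>)"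
    using exists_quiet_window[OF \<tau> \<gamma> \<kappa> n] by auto
  let ?q = "K * (2 * real m / ((1 - \<kappa>) * \<gamma>))"
  let ?M = "law \<nu>" and ?S = "space (null_law P0)"
  interpret N: prob_space "null_law P0" by (rule prob_space_null_law[OF P0])
  interpret M: prob_space ?M by (rule prob_space_change_law)
  have \<tau>T: "\<tau> \<in> T_rand P0" using \<tau> by (simp add: C_lin_def)
  let ?F = "rand_filtration P0 (enat (\<nu> + m))"
  let ?A = "{\<omega>\<in>?S. enat \<nu> < \<tau> \<omega> \<and> \<tau> \<omega> \<le> enat (\<nu> + m)}"
  let ?G = "{\<omega>\<in>?S. (\<Prod>i=Suc \<nu>..\<nu>+m. L (obs i \<omega>)) > K}"
  have "?A = {\<omega>\<in>?S. enat \<nu> < \<tau> \<omega>} \<inter> {\<omega>\<in>?S. \<tau> \<omega> \<le> enat (\<nu> + m)}" by auto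
  then have A: "?A \<in> sets ?F"
    using rand_filtration_mono[OF T_rand_less_sets[OF \<tau>T, of \<nu>], of "\<nu> + m"] T_rand_le_sets[OF \<tau>T, of "\<nu> + m"] by simp
  have "(\<lambda>\<omega>. \<Prod>i=Suc \<nu>..\<nu>+m. L (obs i \<omega>)) \<in> borel_measurable ?F"
    by (intro borel_measurable_prod measurable_compose[OF measurable_obs_filtration L_meas]) auto
  then have "{\<omega>\<in>space ?F. (\<Prod>i=Suc \<nu>..\<nu>+m. L (obs i \<omega>)) > K} \<in> sets ?F" by measurable
  then have G: "?G \<in> sets ?F" by simp
  have sub: "X \<in> sets ?F \<Longrightarrow> X \<in> sets ?M" "X \<in> sets ?F \<Longrightarrow> X \<in> sets (null_law P0)" for X
    using sets_rand_filtration_subset[of P0 "\<nu> + m"] sets_change_law by auto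
  \<comment> \<open>Off \<open>?G\<close> the likelihood ratio is at most \<open>K\<close>, so
    passing from the null law costs at most this factor.\<close>
  have "emeasure ?M (?A - ?G) = (\<integral>\<^sup>+\<omega>. (\<Prod>i=Suc \<nu>..\<nu>+m. ennreal (L (obs i \<omega>))) * indicator (?A - ?G) \<omega> \<partial>null_law P0)"
    using A G by (intro change_of_measure) auto
  also have "\<dots> \<le> (\<integral>\<^sup>+\<omega>. ennreal K * indicator ?A \<omega> \<partial>null_law P0)"
  proof (rule nn_integral_mono)
    fix \<omega> assume \<omega>: "\<omega> \<in> ?S"
    have "0 \<le> L (obs i \<omega>)" if "i \<in> {Suc \<nu>..\<nu>+m}" for i
      using that measurable_space[OF measurable_obs \<omega>, of i] by (intro L_nonneg) auto
    then have "(\<Prod>i=Suc \<nu>..\<nu>+m. ennreal (L (obs i \<omega>))) = ennreal (\<Prod>i=Suc \<nu>..\<nu>+m. L (obs i \<omega>))"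
      by (rule prod_ennreal)
    then show "(\<Prod>i=Suc \<nu>..\<nu>+m. ennreal (L (obs i \<omega>))) * indicator (?A - ?G) \<omega> \<le> ennreal K * indicator ?A \<omega>"
      using \<omega> by (auto simp: indicator_def not_less intro: ennreal_leI)
  qed
  also have "\<dots> = ennreal K * emeasure (null_law P0) ?A"
    using sub(2)[OF A] by (rule nn_integral_cmult_indicator)
  finally have "M.prob (?A - ?G) \<le> K * N.prob ?A"
    using K by (simp add: M.emeasure_eq_measure N.emeasure_eq_measure ennreal_mult[symmetric])
  also have "\<dots> \<le> ?q" using quiet K by (rule mult_left_mono)
  finally have AG: "M.prob (?A - ?G) \<le> ?q" .
  have "M.prob ?A \<le> M.prob (?A - ?G) + M.prob ?G"
  proof -
    have "?A \<subseteq> (?A - ?G) \<union> ?G" by blast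
    moreover have "?A - ?G \<in> sets ?M" "?G \<in> sets ?M" by (intro sub sets.Diff A G)+
    ultimately show ?thesis
      by (intro order.trans[OF M.finite_measure_mono measure_Un_le] sets.Un)
  qed
  then have Abd: "M.prob ?A \<le> ?q + \<eta>" using AG \<eta>[of \<nu>] by linarith
  let ?C = "{\<omega>\<in>?S. \<tau> \<omega> \<le> enat \<nu>}"
  have C: "?C \<in> sets ?M" using sub(1)[OF rand_filtration_mono[OF T_rand_le_sets[OF \<tau>T, of \<nu>]]] by simp
  have "M.prob ?C = N.prob ?C"
    using change_law_before[OF T_rand_le_sets[OF \<tau>T]] by (simp add: measure_def)
  also have "\<dots> \<le> real \<nu> / \<gamma>" using \<tau> unfolding C_lin_def by blast
  also have "\<dots> \<le> real n / \<gamma>" using \<nu> \<gamma> by (intro divide_right_mono) (auto simp: change_window_def)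
  finally have Cbd: "M.prob ?C \<le> real n / \<gamma>" .
  let ?E = "{\<omega>\<in>?S. enat (\<nu> + m) < \<tau> \<omega>}"
  have E: "?E \<in> sets ?M" using sub(1)[OF T_rand_less_sets[OF \<tau>T]] .
  have "?S = ?C \<union> ?A \<union> ?E" by auto
  then have "1 = M.prob (?C \<union> ?A \<union> ?E)" using M.prob_space space_change_law[of \<nu>] by simp
  also have "\<dots> \<le> M.prob (?C \<union> ?A) + M.prob ?E" using C sub(1)[OF A] E by (intro measure_Un_le) auto
  also have "M.prob (?C \<union> ?A) \<le> M.prob ?C + M.prob ?A" using C sub(1)[OF A] by (intro measure_Un_le) auto
  finally have "1 - real n / \<gamma> - ?q - \<eta> \<le> M.prob ?E"
    using Abd Cbd by linarith
  then have "ennreal (real m * (1 - real n / \<gamma> - ?q - \<eta>)) \<le> ennreal (real m * M.prob ?E)"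
    by (intro ennreal_leI mult_left_mono) auto
  also have "\<dots> \<le> cond_delay P0 \<nu> P1 \<tau>" by (rule cond_delay_ge[OF \<tau>T])
  also have "\<dots> \<le> J_delay P0 P1 n \<kappa> \<tau>" unfolding J_delay_def using \<nu> by (rule SUP_upper)
  finally show ?thesis .
qed

end

context change_point_kl
begin

text \<open>With c < c' < 1 / D, windows of length about c' ln \<gamma> and the threshold
  \<open>exp (s * ln \<gamma>)\<close> with s < 1 bring each of the three losses below \<eta>; the
  passage from c to c' pays for the factor 1 - 3 \<eta>.\<close>

lemma R_lin_lower:
  assumes c: "0 < c" "c < 1 / D" and \<kappa>: "0 < \<kappa>" "\<kappa> < 1"
    and N_log: "(\<lambda>\<gamma>. ln \<gamma>) \<in> o[at_top](\<lambda>\<gamma>. real (N \<gamma>))"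
    and N_small: "(\<lambda>\<gamma>. real (N \<gamma>)) \<in> o[at_top](\<lambda>\<gamma>. \<gamma>)"
  shows "\<forall>\<^sub>F \<gamma> in at_top. ennreal (c * ln \<gamma>) \<le> R_lin P0 P1 (N \<gamma>) \<kappa> \<gamma> (T_rand P0)"
proof -
  define c' where "c' = (c + 1 / D) / 2"
  have c': "c < c'" "c' < 1 / D" "0 < c'" using c by (auto simp: c'_def)
  \<comment> \<open>Chosen so that \<open>c' * (1 - 3 * \<eta>)\<close> is the midpoint of c and
    c'.\<close>
  define \<eta> where "\<eta> = (c' - c) / (6 * c')"
  have \<eta>: "0 < \<eta>" using c' c by (simp add: \<eta>_def)
  have c\<eta>: "c < c' * (1 - 3 * \<eta>)"
    using c' by (simp add: \<eta>_def field_simps)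
  \<comment> \<open>Half the gap between 1 / c' and D, which makes s = (1 + c' D) / 2.\<close>
  define \<delta> where "\<delta> = (1 / c' - D) / 2"
  have "c' * D < 1" using c' D_pos by (simp add: field_simps)
  then have \<delta>: "0 < \<delta>" using c' by (simp add: \<delta>_def field_simps)
  define s where "s = c' * (D + \<delta>)"
  have s: "s < 1" using \<open>c' * D < 1\<close> c' by (simp add: s_def \<delta>_def field_simps)
  obtain m0 where m0: "\<And>m \<nu>. m \<ge> m0 \<Longrightarrow> measure (law \<nu>)
     {\<omega>\<in>space (law \<nu>). (\<Sum>i=Suc \<nu>..\<nu>+m. ln (L (obs i \<omega>))) \<ge> real m * (D + \<delta>)} \<le> \<eta>"
    using lr_tail[OF \<delta> \<eta>] by blast
  define m where "m \<gamma> = nat \<lfloor>c' * ln \<gamma>\<rfloor>" for \<gamma> :: real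
  have ev1: "\<forall>\<^sub>F \<gamma> in at_top. real m0 + 1 \<le> c' * ln \<gamma>" using c'(3) by real_asymp
  have ev2: "\<forall>\<^sub>F \<gamma> in at_top. \<gamma> > (1::real)" by (rule eventually_gt_at_top)
  have ev3: "\<forall>\<^sub>F \<gamma> in at_top. c' * ln \<gamma> \<le> real (N \<gamma>)"
    using landau_o.smallD[OF N_log zero_less_divide_1_iff[THEN iffD2, OF c'(3)]] ev2
    by eventually_elim (use c' in \<open>simp add: field_simps\<close>)
  have ev4: "\<forall>\<^sub>F \<gamma> in at_top. real (N \<gamma>) / \<gamma> \<le> \<eta>"
    using landau_o.smallD[OF N_small \<eta>] ev2
    by eventually_elim (use \<eta> in \<open>simp add: field_simps\<close>)
  \<comment> \<open>The threshold is the power s < 1 of \<gamma>, so it loses against the 1 /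
    \<gamma> of the quiet window even with the logarithmic factor.\<close>
  have "((\<lambda>\<gamma>. exp (s * ln \<gamma>) * (2 * (c' * ln \<gamma>) / ((1 - \<kappa>) * \<gamma>))) \<longlongrightarrow> 0) at_top"
    using s \<kappa> c' by real_asymp
  then have ev5: "\<forall>\<^sub>F \<gamma> in at_top. exp (s * ln \<gamma>) * (2 * (c' * ln \<gamma>) / ((1 - \<kappa>) * \<gamma>)) < \<eta>"
    using \<eta> by (intro order_tendstoD) auto
  \<comment> \<open>The \<open>- 1\<close> is the loss from rounding the window length down.\<close>
  have ev6: "\<forall>\<^sub>F \<gamma> in at_top. c * ln \<gamma> \<le> (c' * ln \<gamma> - 1) * (1 - 3 * \<eta>)"
  proof -
    have "\<forall>\<^sub>F \<gamma> in at_top. (1 - 3 * \<eta>) \<le> (c' * (1 - 3 * \<eta>) - c) * ln \<gamma>" using c\<eta> by real_asymp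
    then show ?thesis by eventually_elim (simp add: algebra_simps)
  qed
  have \<eta>1: "0 \<le> 1 - 3 * \<eta>" using c\<eta> c c' by (smt (verit) mult_pos_neg)
  show ?thesis
    using ev1 ev2 ev3 ev4 ev5 ev6
  proof eventually_elim
    case (elim \<gamma>)
    have lnp: "0 < ln \<gamma>" using elim by simp
    have fl: "real (m \<gamma>) = of_int \<lfloor>c' * ln \<gamma>\<rfloor>" unfolding m_def using elim(1) by simp
    have m: "real (m \<gamma>) \<le> c' * ln \<gamma>" "c' * ln \<gamma> - 1 \<le> real (m \<gamma>)" unfolding fl by linarith+
    have mm: "m0 \<le> m \<gamma>" "m \<gamma> \<le> N \<gamma>" "1 \<le> N \<gamma>" using m elim(1,3) by linarith+
    show ?case
      unfolding R_lin_def
    proof (rule INF_greatest)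
      fix \<tau> assume \<tau>: "\<tau> \<in> C_lin P0 \<gamma> (T_rand P0)"
      let ?K = "exp (s * ln \<gamma>)"
      have tail: "measure (law \<nu>) {\<omega>\<in>space (null_law P0). (\<Prod>i=Suc \<nu>..\<nu>+m \<gamma>. L (obs i \<omega>)) > ?K} \<le> \<eta>" for \<nu>
      proof -
        let ?M = "law \<nu>"
        let ?X = "{\<omega>\<in>space (null_law P0). (\<Prod>i=Suc \<nu>..\<nu>+m \<gamma>. L (obs i \<omega>)) > ?K}" and ?Y = "{\<omega>\<in>space ?M. (\<Sum>i=Suc \<nu>..\<nu>+m \<gamma>. ln (L (obs i \<omega>))) \<ge> real (m \<gamma>) * (D + \<delta>)}"
        interpret M: prob_space ?M by (rule prob_space_change_law)
        have "(\<lambda>\<omega>. \<Sum>i=Suc \<nu>..\<nu>+m \<gamma>. ln (L (obs i \<omega>))) \<in> borel_measurable (null_law P0)"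
          by (intro borel_measurable_sum measurable_compose[OF measurable_compose[OF measurable_obs L_meas] borel_measurable_ln]) auto
        then have ms: "?Y \<in> sets ?M"
          unfolding sets_change_law space_change_law by measurable
        have "AE \<omega> in ?M. \<omega> \<in> ?X \<longrightarrow>
           \<omega> \<in> ?Y"
          using AE_change_law_L_pos
        proof eventually_elim
          fix \<omega> assume pos: "\<forall>i>\<nu>. 0 < L (obs i \<omega>)"
          show "\<omega> \<in> ?X \<longrightarrow>
             \<omega> \<in> ?Y"
          proof safe
            assume "(\<Prod>i=Suc \<nu>..\<nu>+m \<gamma>. L (obs i \<omega>)) > ?K"
            moreover have "(\<Prod>i=Suc \<nu>..\<nu>+m \<gamma>. L (obs i \<omega>)) = exp (\<Sum>i=Suc \<nu>..\<nu>+m \<gamma>. ln (L (obs i \<omega>)))"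
              unfolding exp_sum[OF finite_atLeastAtMost] using pos by (intro prod.cong) auto
            ultimately have "s * ln \<gamma> < (\<Sum>i=Suc \<nu>..\<nu>+m \<gamma>. ln (L (obs i \<omega>)))" by simp
            moreover have "real (m \<gamma>) * (D + \<delta>) \<le> c' * ln \<gamma> * (D + \<delta>)"
              using m D_pos \<delta> by (intro mult_right_mono) auto
            ultimately show "real (m \<gamma>) * (D + \<delta>) \<le> (\<Sum>i=Suc \<nu>..\<nu>+m \<gamma>. ln (L (obs i \<omega>)))"
              by (simp add: s_def algebra_simps)
          qed (simp add: space_change_law)
        qed
        then have "M.prob ?X
           \<le> M.prob ?Y"
          using ms by (rule M.finite_measure_mono_AE)
        then show ?thesis using m0[OF mm(1), of \<nu>] by linarith
      qed
      have "c * ln \<gamma> \<le> (c' * ln \<gamma> - 1) * (1 - 3 * \<eta>)" by (rule elim(6))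
      also have "\<dots> \<le> real (m \<gamma>) * (1 - 3 * \<eta>)" using m \<eta>1 by (intro mult_right_mono) auto
      also have "\<dots> \<le> real (m \<gamma>) * (1 - real (N \<gamma>) / \<gamma> - ?K * (2 * real (m \<gamma>) / ((1 - \<kappa>) * \<gamma>)) - \<eta>)"
      proof (rule mult_left_mono)
        have "?K * (2 * real (m \<gamma>) / ((1 - \<kappa>) * \<gamma>)) \<le> ?K * (2 * (c' * ln \<gamma>) / ((1 - \<kappa>) * \<gamma>))"
          using m \<kappa> elim(2) by (intro mult_left_mono divide_right_mono) auto
        then show "1 - 3 * \<eta> \<le> 1 - real (N \<gamma>) / \<gamma> - ?K * (2 * real (m \<gamma>) / ((1 - \<kappa>) * \<gamma>)) - \<eta>"
          using elim(4,5) by linarith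
      qed simp
      finally have "ennreal (c * ln \<gamma>) \<le> ennreal (real (m \<gamma>) * (1 - real (N \<gamma>) / \<gamma> - ?K * (2 * real (m \<gamma>) / ((1 - \<kappa>) * \<gamma>)) - \<eta>))"
        by (rule ennreal_leI)
      also have "\<dots> \<le> J_delay P0 P1 (N \<gamma>) \<kappa> \<tau>"
        by (rule J_delay_lower[OF \<tau> _ \<kappa> mm(3,2) _ tail]) (use elim(2) in auto)
      finally show "ennreal (c * ln \<gamma>) \<le> J_delay P0 P1 (N \<gamma>) \<kappa> \<tau>" .
    qed
  qed
qed

end

section \<open>The probability integral transform of the likelihood ratio\<close>

context cdf_distribution
begin

text \<open>\<open>I u\<close> is the least point where \<open>C\<close> reaches \<open>u\<close>.
  If \<open>C\<close> exceeded \<open>u\<close> there, continuity would make it exceed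
  \<open>u\<close> slightly to the left, against minimality.\<close>

lemma cdf_quantile:
  assumes cont: "continuous_on UNIV C" and u: "0 < u" "u < 1"
  shows "C (I u) = u"
proof (rule antisym)
  show "C (I u) \<le> u"
  proof (rule ccontr)
    assume "\<not> C (I u) \<le> u"
    then have "u < C (I u)" by simp
    moreover have "(C \<longlongrightarrow> C (I u)) (at_left (I u))"
      using cont by (metis UNIV_I continuous_on_def filterlim_at_split)
    ultimately have "\<forall>\<^sub>F x in at_left (I u). u < C x" by (rule order_tendstoD(1)[rotated])
    moreover have "\<forall>\<^sub>F x in at_left (I u). x < I u" by (auto simp: eventually_at_left_field intro: exI[of _ "I u - 1"])
    ultimately have "\<forall>\<^sub>F x in at_left (I u). False"
    proof eventually_elim
      case (elim x)
      then have "I u \<le> x" using pseudoinverse[OF u, of x] by simp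
      then show False using elim by simp
    qed
    then show False by simp
  qed
  show "u \<le> C (I u)" using pseudoinverse[OF u, of "I u"] by simp
qed

text \<open>\<open>I\<close> is controlled only on the open unit interval; the value 0 elsewhere
  makes it a total Borel function.\<close>

definition quantile :: "real \<Rightarrow> real" where
  "quantile u = (if u \<in> {0<..<1} then I u else 0)"

lemma quantile_measurable [measurable]: "quantile \<in> borel_measurable borel"
  unfolding quantile_def using measurable_CI
  by (subst (asm) measurable_restrict_space_iff) auto

text \<open>\<open>M\<close> is the image of Lebesgue measure on (0,1) under \<open>I\<close>, and
  \<open>C\<close> undoes \<open>I\<close> by \<open>cdf_quantile\<close>.\<close>

lemma distr_cdf:
  assumes cont: "continuous_on UNIV C"
  shows "distr M borel C = unif01"
proof (rule measure_eqI)
  let ?N = "restrict_space lborel {0<..<1::real}"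
  have "sets ?N = sets (restrict_space borel {0<..<1})" by (rule sets_restrict_space_cong) simp
  then have mI: "I \<in> ?N \<rightarrow>\<^sub>M borel" using measurable_CI by (simp cong: measurable_cong_sets)
  fix A assume "A \<in> sets (distr M borel C)"
  then have A[measurable]: "A \<in> sets borel" by simp
  have "emeasure (distr M borel C) A = emeasure M (C -` A)"
    by (subst emeasure_distr) auto
  also have "\<dots> = emeasure (distr ?N borel I) (C -` A)"
    by (simp only: distr_I_eq_M)
  also have "\<dots> = emeasure ?N (I -` C -` A \<inter> space ?N)"
    by (rule emeasure_distr[OF mI]) (use measurable_sets[OF measurable_C A] in simp)
  also have "I -` C -` A \<inter> space ?N = A \<inter> {0<..<1}"
    using cdf_quantile[OF cont] by (auto simp: space_restrict_space)
  also have "emeasure ?N (A \<inter> {0<..<1}) = emeasure lborel (A \<inter> {0<..<1})"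
    by (subst emeasure_restrict_space) auto
  also have "\<dots> = emeasure lborel ({0..1} \<inter> A)"
  proof (rule emeasure_eq_AE)
    show "AE x in lborel. (x \<in> A \<inter> {0<..<1}) = (x \<in> {0..1} \<inter> A)"
      using AE_lborel_singleton[of "0::real"] AE_lborel_singleton[of "1::real"] by eventually_elim auto
  qed auto
  also have "\<dots> = emeasure unif01 A"
    unfolding unif01_def by (subst emeasure_uniform_measure) (auto simp: divide_ennreal_def)
  finally show "emeasure (distr M borel C) A = emeasure unif01 A" .
qed simp

text \<open>\<open>C\<close> may be flat on intervals and so need not be injective, but
  \<open>M\<close> is carried by the values of \<open>I\<close>, where \<open>quantile\<close>
  inverts it.\<close>

lemma AE_quantile_cdf:
  assumes cont: "continuous_on UNIV C"
  shows "AE y in M. quantile (C y) = y"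
proof -
  let ?N = "restrict_space lborel {0<..<1::real}"
  have "sets ?N = sets (restrict_space borel {0<..<1})" by (rule sets_restrict_space_cong) simp
  then have mI: "I \<in> ?N \<rightarrow>\<^sub>M borel" using measurable_CI by (simp cong: measurable_cong_sets)
  have "AE u in ?N. quantile (C (I u)) = I u"
    by (rule AE_I2) (simp add: space_restrict_space cdf_quantile[OF cont] quantile_def)
  then have "AE y in distr ?N borel I. quantile (C y) = y"
    using mI by (subst AE_distr_iff) auto
  then show ?thesis by (simp only: distr_I_eq_M)
qed

end

lemma cdf_distribution_distr:
  assumes "prob_space P" "s \<in> borel_measurable P"
  shows "cdf_distribution (distr P borel s)"
proof -
  interpret prob_space "distr P borel s" using assms by (rule prob_space.prob_space_distr)
  show ?thesis by unfold_locales simp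
qed

context change_point
begin

abbreviation pit :: "'a \<Rightarrow> real" where
  "pit x \<equiv> cdf (distr P0 borel L) (L x)"

context
  assumes cont: "continuous_on UNIV (cdf (distr P0 borel L))"
begin

interpretation C: cdf_distribution "distr P0 borel L"
  by (rule cdf_distribution_distr[OF P0 L_meas])

lemma pit_measurable [measurable]: "pit \<in> borel_measurable P0"
  by measurable

lemma pit_range: "0 \<le> pit x" "pit x \<le> 1"
  by (rule C.cdf_nonneg) (rule C.cdf_bounded_prob)

lemma distr_pit: "distr P0 borel pit = unif01"
  using C.distr_cdf[OF cont] by (subst (asm) distr_distr) (auto simp: comp_def)

text \<open>Since \<open>L\<close> is a function of \<open>pit\<close>, passing to the probability integral transform loses no information.\<close>
lemma AE_density_pit:
  assumes h[measurable]: "h \<in> borel_measurable borel" and pos: "\<And>u. u \<in> {0..1} \<Longrightarrow> 0 < h u"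
    and dens: "density unif01 (\<lambda>u. ennreal (h u)) = pit_law P0 P1 L"
  shows "AE x in P1. h (pit x) = L x"
proof -
  interpret U: prob_space unif01 by (rule prob_space_unif01)
  have q: "AE x in P0. C.quantile (pit x) = L x"
    by (rule AE_distrD[OF L_meas]) (rule C.AE_quantile_cdf[OF cont])
  \<comment> \<open>As \<open>L\<close> is \<open>quantile\<close> of \<open>pit\<close> up to a
    null set, the density of \<open>P1\<close> factors through \<open>pit\<close>. Hence
    \<open>quantile\<close> is another density of the transformed law and agrees with
    \<open>h\<close> almost everywhere.\<close>
  have "density unif01 (\<lambda>u. ennreal (C.quantile u)) = distr (density P0 (\<lambda>x. ennreal (C.quantile (pit x)))) borel pit"
    unfolding distr_pit[symmetric] by (rule density_distr) auto
  also have "density P0 (\<lambda>x. ennreal (C.quantile (pit x))) = P1"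
    unfolding L_dens[symmetric] using q by (intro density_cong) auto
  also have "distr P1 borel pit = density unif01 (\<lambda>u. ennreal (h u))"
    unfolding dens pit_law_def ..
  finally have "AE u in unif01. ennreal (C.quantile u) = ennreal (h u)"
    by (intro U.density_unique) auto
  then have "AE x in P0. ennreal (C.quantile (pit x)) = ennreal (h (pit x))"
    unfolding distr_pit[symmetric] by (subst (asm) AE_distr_iff) auto
  with q have "AE x in P0. h (pit x) = L x"
    using AE_space
  proof eventually_elim
    case (elim x)
    then show ?case using pos[of "pit x"] L_nonneg[of x] pit_range by simp
  qed
  then show ?thesis
    unfolding L_dens[symmetric] by (subst AE_density) (auto elim: eventually_mono)
qed

lemma integral_indicator_pit:
  assumes "0 \<le> v" "v \<le> 1"
  shows "(\<integral>x. indicator {..<v} (pit x) \<partial>P0) = v"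
proof -
  have "(\<integral>x. indicator {..<v} (pit x) \<partial>P0) = (\<integral>u. (indicator {..<v} u :: real) \<partial>distr P0 borel pit)"
    by (subst integral_distr) auto
  also have "\<dots> = measure unif01 {..<v}" unfolding distr_pit by simp
  also have "\<dots> = measure lborel ({0..1} \<inter> {..<v})"
    unfolding unif01_def by (subst measure_uniform_measure) auto
  also have "{0..1} \<inter> {..<v} = {0..<v}" using assms by auto
  finally show ?thesis using assms by simp
qed

end

end

section \<open>Upper bound on the detection delay\<close>

lemma sum_of_bool_mono:
  "(\<And>i. i \<in> A \<Longrightarrow> P i \<Longrightarrow> Q i) \<Longrightarrow> (\<Sum>i\<in>A. of_bool (P i)) \<le> (\<Sum>i\<in>A. of_bool (Q i) :: real)"
  by (intro sum_mono) auto

text \<open>A randomizer in [0,1] places the rank between the strict and the weak count, whatever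
  the ties.\<close>

lemma conf_p_bounds:
  assumes t: "1 \<le> t" and rnd: "rnd t \<omega> \<in> {0..1}"
  shows "(\<Sum>i=1..t. of_bool (s (obs i \<omega>) < s (obs t \<omega>))) \<le> real t * conf_p s t \<omega>"
    and "real t * conf_p s t \<omega> \<le> (\<Sum>i=1..t. of_bool (s (obs i \<omega>) \<le> s (obs t \<omega>)))"
    and "conf_p s t \<omega> \<in> {0..1}"
proof -
  let ?l = "\<Sum>i=1..t. of_bool (s (obs i \<omega>) < s (obs t \<omega>)) :: real" and ?e = "\<Sum>i=1..t. of_bool (s (obs i \<omega>) = s (obs t \<omega>)) :: real"
  have t0: "0 < real t" using t by simp
  have eq: "real t * conf_p s t \<omega> = ?l + rnd t \<omega> * ?e" using t0 by (simp add: conf_p_def)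
  have e0: "0 \<le> ?e" and l0: "0 \<le> ?l" by (auto intro!: sum_nonneg simp del: sum_of_bool_eq)
  have "rnd t \<omega> * ?e \<le> 1 * ?e" using rnd e0 by (intro mult_right_mono) auto
  moreover have "?l + ?e = (\<Sum>i=1..t. of_bool (s (obs i \<omega>) \<le> s (obs t \<omega>)))"
    by (simp only: sum.distrib[symmetric]) (intro sum.cong, auto)
  ultimately show ub: "real t * conf_p s t \<omega> \<le> (\<Sum>i=1..t. of_bool (s (obs i \<omega>) \<le> s (obs t \<omega>)))"
    unfolding eq by linarith
  show lb: "?l \<le> real t * conf_p s t \<omega>" unfolding eq using rnd e0 by simp
  have "(\<Sum>i=1..t. of_bool (s (obs i \<omega>) \<le> s (obs t \<omega>)) :: real) \<le> (\<Sum>i=1..t. 1)" by (intro sum_mono) auto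
  then have "real t * conf_p s t \<omega> \<le> real t * 1" using ub by simp
  moreover have "real t * 0 \<le> real t * conf_p s t \<omega>" using lb l0 by simp
  ultimately show "conf_p s t \<omega> \<in> {0..1}" using t0 by (simp only: mult_le_cancel_left_pos atLeastAtMost_iff)
qed

text \<open>
  Control of the empirical distribution function of the first \<open>\<nu>\<close> values on the grid \<open>k / G\<close> controls every
  later conformal p-value, because at most \<open>r\<close> later values enter the ranks.
\<close>
lemma conf_p_close:
  fixes V :: "'a \<Rightarrow> real"
  assumes V: "\<And>x. V x \<in> {0..1}" and mono: "\<And>x y. V x < V y \<Longrightarrow> s x < s y"
    and G: "1 \<le> G" and \<nu>: "1 \<le> \<nu>" and t: "\<nu> < t" "t \<le> \<nu> + r" and rnd: "rnd t \<omega> \<in> {0..1}"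
    and grid: "\<And>k. k \<le> G \<Longrightarrow> \<bar>(\<Sum>i=1..\<nu>. of_bool (V (obs i \<omega>) < real k / real G)) - real \<nu> * (real k / real G)\<bar> \<le> real \<nu> * \<delta>"
    and \<delta>: "0 \<le> \<delta>"
  shows "\<bar>conf_p s t \<omega> - V (obs t \<omega>)\<bar> \<le> 1 / real G + \<delta> + real r / real \<nu>"
proof -
  let ?u = "V (obs t \<omega>)" and ?e = "1 / real G + \<delta>"
  let ?n = "\<lambda>v. \<Sum>i=1..\<nu>. of_bool (V (obs i \<omega>) < v) :: real"
  \<comment> \<open>The grid cell [k / G, (k + 1) / G) that contains the transform of the current
    score.\<close>
  define k where "k = nat \<lfloor>?u * real G\<rfloor>"
  have u: "0 \<le> ?u" "?u \<le> 1" using V[of "obs t \<omega>"] by auto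
  have G0: "0 < real G" and n0: "0 < real \<nu>" using G \<nu> by auto
  have fl: "real k = of_int \<lfloor>?u * real G\<rfloor>" unfolding k_def using u G0 by simp
  have k: "real k \<le> ?u * real G" "?u * real G < real k + 1" unfolding fl by linarith+
  have "?u * real G \<le> 1 * real G" using u G0 by (intro mult_right_mono) auto
  then have kG: "k \<le> G" using k by simp
  have Sk: "real (Suc k) / real G = real k / real G + 1 / real G" by (simp add: add_divide_distrib)
  have "real k / real G \<le> ?u" "?u < real (Suc k) / real G"
    using k G0 by (simp_all add: pos_divide_le_eq pos_less_divide_eq)
  then have kl: "real k / real G \<le> ?u" "?u - 1 / real G \<le> real k / real G" "?u < real (Suc k) / real G" "real (Suc k) / real G \<le> ?u + 1 / real G"
    unfolding Sk by linarith+
  have tsplit: "{1..t} = {1..\<nu>} \<union> {Suc \<nu>..t}" using t by auto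
  have sum_split: "(\<Sum>i=1..t. g i) = (\<Sum>i=1..\<nu>. g i) + (\<Sum>i=Suc \<nu>..t. g i)" for g :: "nat \<Rightarrow> real"
    unfolding tsplit by (intro sum.union_disjoint) auto
  have t1: "1 \<le> t" using t by simp
  have t0: "0 < real t" using t by simp
  have tr: "real t \<le> real \<nu> + real r" using t by linarith
  have r\<nu>: "real \<nu> * (real r / real \<nu>) = real r" using n0 by simp
  have rt: "real r \<le> real t * (real r / real \<nu>)"
  proof -
    have "real \<nu> * (real r / real \<nu>) \<le> real t * (real r / real \<nu>)" using t by (intro mult_right_mono) auto
    then show ?thesis unfolding r\<nu> .
  qed
  have low: "?u - ?e - real r / real \<nu> \<le> conf_p s t \<omega>"
  proof -
    have "real \<nu> * (real k / real G) - real \<nu> * \<delta> \<le> ?n (real k / real G)" using grid[OF kG] by linarith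
    also have "\<dots> \<le> (\<Sum>i=1..\<nu>. of_bool (s (obs i \<omega>) < s (obs t \<omega>)))"
      using mono kl(1) by (intro sum_of_bool_mono) (auto intro: less_le_trans)
    also have "\<dots> \<le> (\<Sum>i=1..t. of_bool (s (obs i \<omega>) < s (obs t \<omega>)))"
      unfolding sum_split by (simp del: sum_of_bool_eq add: sum_nonneg)
    also have "\<dots> \<le> real t * conf_p s t \<omega>" by (rule conf_p_bounds(1)[where s=s and \<omega>=\<omega> and t=t, OF t1 rnd])
    finally have a: "real \<nu> * (real k / real G) - real \<nu> * \<delta> \<le> real t * conf_p s t \<omega>" .
    have "real \<nu> * (?u - ?e) \<le> real \<nu> * (real k / real G - \<delta>)" using kl(2) by (intro mult_left_mono) auto
    with a have b: "real \<nu> * (?u - ?e) \<le> real t * conf_p s t \<omega>" by (simp add: right_diff_distrib)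
    \<comment> \<open>Passing from \<nu> to t observations adds at most r terms; this is the source
      of r / \<nu> in the bound.\<close>
    have "(real t - real \<nu>) * (?u - ?e) \<le> real r * 1"
    proof (cases "0 \<le> ?u - ?e")
      case True
      have "?u - ?e \<le> 1" using u \<delta> G0 by (smt (verit) divide_nonneg_pos)
      then show ?thesis using True tr t by (intro mult_mono) auto
    next
      case False
      then have "(real t - real \<nu>) * (?u - ?e) \<le> 0" using t by (intro mult_nonneg_nonpos) auto
      then show ?thesis by simp
    qed
    then have "real t * (?u - ?e) \<le> real t * conf_p s t \<omega> + real t * (real r / real \<nu>)"
      using b rt by (simp add: left_diff_distrib)
    then have "real t * (?u - ?e - real r / real \<nu>) \<le> real t * conf_p s t \<omega>" by (simp add: right_diff_distrib)
    then show ?thesis using t0 by (simp only: mult_le_cancel_left_pos)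
  qed
  have up: "conf_p s t \<omega> \<le> ?u + ?e + real r / real \<nu>"
  proof -
    have nb: "?n (real (Suc k) / real G) \<le> real \<nu> * (?u + ?e)"
    proof (cases "Suc k \<le> G")
      case True
      have "?n (real (Suc k) / real G) \<le> real \<nu> * (real (Suc k) / real G + \<delta>)" using grid[OF True] by (simp only: distrib_left)
      also have "\<dots> \<le> real \<nu> * (?u + ?e)" using kl(4) by (intro mult_left_mono) auto
      finally show ?thesis .
    next
      case False
      \<comment> \<open>Only grid points up to 1 are controlled. Here the transform equals 1, and
        the trivial bound \<nu> on the count suffices.\<close>
      then have "real G \<le> real k" by simp
      then have "1 * real G \<le> ?u * real G" using k(1) by simp
      then have "1 \<le> ?u" using G0 by (simp only: mult_le_cancel_right_pos)
      moreover have "0 \<le> ?e" using G0 \<delta> by simp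
      ultimately have "real \<nu> * 1 \<le> real \<nu> * (?u + ?e)" by (intro mult_left_mono) auto
      moreover have "?n (real (Suc k) / real G) \<le> (\<Sum>i=1..\<nu>. 1)" by (intro sum_mono) auto
      ultimately show ?thesis by simp
    qed
    have "real t * conf_p s t \<omega> \<le> (\<Sum>i=1..t. of_bool (s (obs i \<omega>) \<le> s (obs t \<omega>)))"
      by (rule conf_p_bounds(2)[where s=s and \<omega>=\<omega> and t=t, OF t1 rnd])
    also have "\<dots> \<le> (\<Sum>i=1..\<nu>. of_bool (s (obs i \<omega>) \<le> s (obs t \<omega>))) + (\<Sum>i=Suc \<nu>..t. 1)"
      unfolding sum_split by (intro add_left_mono sum_mono) auto
    also have "(\<Sum>i=1..\<nu>. of_bool (s (obs i \<omega>) \<le> s (obs t \<omega>)) :: real) \<le> ?n (real (Suc k) / real G)"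
    proof (rule sum_of_bool_mono)
      fix i assume "s (obs i \<omega>) \<le> s (obs t \<omega>)"
      then have "V (obs i \<omega>) \<le> ?u" using mono[of "obs t \<omega>" "obs i \<omega>"] by (force simp: not_less[symmetric])
      then show "V (obs i \<omega>) < real (Suc k) / real G" using kl(3) by simp
    qed
    also note nb
    also have "(\<Sum>i=Suc \<nu>..t. (1::real)) \<le> real r" using t by simp
    finally have a: "real t * conf_p s t \<omega> \<le> real \<nu> * (?u + ?e) + real r" by simp
    have "real \<nu> * (?u + ?e) \<le> real t * (?u + ?e)" using t u G0 \<delta> by (intro mult_right_mono) auto
    then have "real t * conf_p s t \<omega> \<le> real t * (?u + ?e + real r / real \<nu>)"
      using a rt by (simp add: distrib_left)
    then show ?thesis using t0 by (simp only: mult_le_cancel_left_pos)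
  qed
  show ?thesis using low up by (simp add: abs_le_iff)
qed

lemma mix_lik_shift: "mix_lik Pr f {Suc \<nu>..\<nu>+r} z = mix_lik Pr f {1..r} (\<lambda>i. z (\<nu> + i))"
proof -
  have "(\<Prod>j=Suc \<nu>..\<nu>+r. f \<theta> (z j)) = (\<Prod>i=1..r. f \<theta> (z (\<nu> + i)))" for \<theta>
    using prod.shift_bounds_cl_nat_ivl[of "\<lambda>j. f \<theta> (z j)" 1 \<nu> r] by (simp add: add.commute)
  then show ?thesis unfolding mix_lik_def by simp
qed

lemma ln_ennreal_leD:
  assumes "ereal x \<le> ln_ennreal y" shows "ennreal (exp x) \<le> y"
proof (cases "y = \<infinity> \<or> y = 0")
  case True
  then show ?thesis using assms by (auto simp: ln_ennreal_def)
next
  case False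
  then have y: "y \<noteq> 0" "y \<noteq> \<infinity>" by auto
  then have p: "0 < enn2real y" by (simp add: enn2real_positive_iff top.not_eq_extremum zero_less_iff_neq_zero)
  have "x \<le> ln (enn2real y)" using assms y by (simp add: ln_ennreal_def)
  then have "exp x \<le> enn2real y" using p by (metis exp_le_cancel_iff exp_ln)
  then have "ennreal (exp x) \<le> ennreal (enn2real y)" by (rule ennreal_leI)
  moreover have "ennreal (enn2real y) = y" using y by (simp add: ennreal_enn2real_if)
  ultimately show ?thesis by (simp only:)
qed

lemma sets_abs_gt:
  fixes S :: "'a \<Rightarrow> real"
  assumes [measurable]: "S \<in> borel_measurable M"
  shows "{x\<in>space M. \<not> \<bar>S x - u\<bar> \<le> v} \<in> sets M"
  by measurable

text \<open>\<open>support\<close> is the local KL condition with the logarithm removed;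
  \<open>B\<close> is kept positive so that Hoeffding's range from -B to B is nondegenerate.\<close>

locale local_KL = change_point_kl +
  fixes h :: "real \<Rightarrow> real" and Pr :: "'th measure" and f :: "'th \<Rightarrow> real \<Rightarrow> real"
    and \<rho> B Kl a c :: real and w :: "nat \<Rightarrow> real"
  assumes cont: "continuous_on UNIV (cdf (distr P0 borel L))"
    and h_meas [measurable]: "h \<in> borel_measurable borel"
    and h_pos: "\<And>u. u \<in> {0..1} \<Longrightarrow> 0 < h u"
    and h_dens: "density unif01 (\<lambda>u. ennreal (h u)) = pit_law P0 P1 L"
    and h_bd: "\<And>u. u \<in> {0..1} \<Longrightarrow> \<bar>ln (h u)\<bar> \<le> B" and B: "0 < B"
    and h_lip: "\<And>u v. u \<in> {0..1} \<Longrightarrow> v \<in> {0..1} \<Longrightarrow> \<bar>ln (h u) - ln (h v)\<bar> \<le> Kl * \<bar>u - v\<bar>" and Kl: "0 \<le> Kl" and a: "0 \<le> a"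
    and support: "\<And>r z. 1 \<le> r \<Longrightarrow> (\<And>i. i \<in> {1..r} \<Longrightarrow> z i \<in> {0..1}) \<Longrightarrow>
      ennreal (exp ((\<Sum>i=1..r. ln (h (z i))) - a * ln (real r) - c)) \<le> mix_lik Pr f {1..r} z"
    and Pr: "prob_space Pr" and fam: "density_family Pr f" and \<rho>: "0 < \<rho>" "\<rho> < 1" and w: "\<forall>k\<ge>1. w k = 1"
begin

abbreviation \<tau>\<^sub>S :: "real \<Rightarrow> 'a path \<Rightarrow> enat" where
  "\<tau>\<^sub>S b \<equiv> tau_bar Pr f L w \<rho> b"

abbreviation survival :: "nat \<Rightarrow> nat \<Rightarrow> real \<Rightarrow> real" where
  "survival \<nu> n b \<equiv> measure (law \<nu>) {\<omega>\<in>space (null_law P0). enat n < \<tau>\<^sub>S b \<omega>}"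

lemma pit_unit: "pit x \<in> {0..1}"
  using pit_range[OF cont, of x] by simp

lemma pit_meas1 [measurable]: "pit \<in> borel_measurable P1"
  using pit_measurable[OF cont] sets_eq by (simp cong: measurable_cong_sets)

lemma pit_less: "pit x < pit y \<Longrightarrow> L x < L y"
proof (rule ccontr)
  interpret C: cdf_distribution "distr P0 borel L" by (rule cdf_distribution_distr[OF P0 L_meas])
  assume "pit x < pit y" "\<not> L x < L y"
  then show False using C.cdf_nondecreasing[of "L y" "L x"] by simp
qed

lemma integral_ln_h: "(\<integral>x. ln (h (pit x)) \<partial>P1) = D"
proof -
  have "AE x in P1. h (pit x) = L x"
    by (rule AE_density_pit[OF cont h_meas h_pos h_dens])
  then have "(\<integral>x. ln (h (pit x)) \<partial>P1) = (\<integral>x. ln (L x) \<partial>P1)"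
    by (intro integral_cong_AE) (auto elim: eventually_mono)
  then show ?thesis by (simp add: D_eq)
qed

text \<open>A finite grid replaces uniform convergence of the empirical distribution function:
  Hoeffding at G + 1 points and a union bound are enough.\<close>

definition grid_ok :: "nat \<Rightarrow> nat \<Rightarrow> real \<Rightarrow> 'a path \<Rightarrow> bool" where
  "grid_ok \<nu> G \<delta> \<omega> \<longleftrightarrow> (\<forall>k\<le>G. \<bar>(\<Sum>i=1..\<nu>. of_bool (pit (obs i \<omega>) < real k / real G)) - real \<nu> * (real k / real G)\<bar> \<le> real \<nu> * \<delta>)"

text \<open>The component started right after the change is the relevant one. Replacing each p-value
  by the transform of its score costs at most \<open>Kl\<close> times the closeness bound per step,
  by the Lipschitz property of ln h.\<close>

lemma M_stat_ge:
  assumes \<nu>: "1 \<le> \<nu>" and r: "1 \<le> r" and G: "1 \<le> G" and \<delta>: "0 \<le> \<delta>"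
    and rnd: "\<And>i. 1 \<le> i \<Longrightarrow> rnd i \<omega> \<in> {0..1}" and grid: "grid_ok \<nu> G \<delta> \<omega>"
    and lik: "real r * (D - \<delta>') \<le> (\<Sum>i=Suc \<nu>..\<nu>+r. ln (h (pit (obs i \<omega>))))"
  shows "ennreal (exp (real r * (D - \<delta>' - Kl * (1 / real G + \<delta> + real r / real \<nu>)) - a * ln (real r) - c)) \<le> M_stat Pr f L (Suc \<nu>) (\<nu> + r) \<omega>"
proof -
  let ?e = "1 / real G + \<delta> + real r / real \<nu>"
  let ?p = "\<lambda>t. conf_p L t \<omega>"
  have p01: "?p t \<in> {0..1}" if "1 \<le> t" for t
    by (rule conf_p_bounds(3)[where s=L and \<omega>=\<omega> and t=t, OF that rnd[OF that]])
  have close: "ln (h (pit (obs t \<omega>))) - Kl * ?e \<le> ln (h (?p t))" if t: "t \<in> {Suc \<nu>..\<nu>+r}" for t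
  proof -
    have "\<bar>?p t - pit (obs t \<omega>)\<bar> \<le> ?e"
      by (rule conf_p_close[where V=pit and s=L and \<nu>=\<nu> and G=G and \<delta>=\<delta> and r=r and t=t and \<omega>=\<omega>, OF pit_unit pit_less G \<nu>])
        (use t rnd grid \<delta> in \<open>auto simp: grid_ok_def simp del: sum_of_bool_eq\<close>)
    then have "Kl * \<bar>pit (obs t \<omega>) - ?p t\<bar> \<le> Kl * ?e" using Kl by (intro mult_left_mono) (auto simp: abs_minus_commute)
    moreover have "\<bar>ln (h (pit (obs t \<omega>))) - ln (h (?p t))\<bar> \<le> Kl * \<bar>pit (obs t \<omega>) - ?p t\<bar>"
      by (rule h_lip[OF pit_unit p01]) (use t in auto)
    ultimately show ?thesis by linarith
  qed
  have "real r * (D - \<delta>' - Kl * ?e) = real r * (D - \<delta>') - real r * (Kl * ?e)" by (simp add: right_diff_distrib)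
  also have "\<dots> \<le> (\<Sum>t=Suc \<nu>..\<nu>+r. ln (h (pit (obs t \<omega>)))) - (\<Sum>t=Suc \<nu>..\<nu>+r. Kl * ?e)" using lik by simp
  also have "\<dots> = (\<Sum>t=Suc \<nu>..\<nu>+r. ln (h (pit (obs t \<omega>))) - Kl * ?e)" by (simp only: sum_subtractf)
  also have "\<dots> \<le> (\<Sum>t=Suc \<nu>..\<nu>+r. ln (h (?p t)))" using close by (rule sum_mono)
  also have "\<dots> = (\<Sum>i=1..r. ln (h (?p (\<nu> + i))))"
    using sum.shift_bounds_cl_nat_ivl[of "\<lambda>t. ln (h (?p t))" 1 \<nu> r] by (simp add: add.commute)
  finally have "ennreal (exp (real r * (D - \<delta>' - Kl * ?e) - a * ln (real r) - c))
      \<le> ennreal (exp ((\<Sum>i=1..r. ln (h (?p (\<nu> + i)))) - a * ln (real r) - c))"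
    by (intro ennreal_leI) simp
  also have "\<dots> \<le> mix_lik Pr f {1..r} (\<lambda>i. ?p (\<nu> + i))"
    using r p01 by (intro support) auto
  also have "\<dots> = M_stat Pr f L (Suc \<nu>) (\<nu> + r) \<omega>"
    unfolding M_stat_def mix_lik_shift ..
  finally show ?thesis .
qed

text \<open>The summand k = \<nu> + 1 alone exceeds the threshold; its weight 1 - \<rho> appears as
  the term \<open>ln (1 - \<rho>)\<close>.\<close>

lemma tau_bar_stops:
  assumes \<nu>: "1 \<le> \<nu>" and r: "1 \<le> r" and G: "1 \<le> G" and \<delta>: "0 \<le> \<delta>" and b: "0 < b"
    and rnd: "\<And>i. 1 \<le> i \<Longrightarrow> rnd i \<omega> \<in> {0..1}" and grid: "grid_ok \<nu> G \<delta> \<omega>"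
    and lik: "real r * (D - \<delta>') \<le> (\<Sum>i=Suc \<nu>..\<nu>+r. ln (h (pit (obs i \<omega>))))"
    and suff: "ln b \<le> real r * (D - \<delta>' - Kl * (1 / real G + \<delta> + real r / real \<nu>)) - a * ln (real r) - c + ln (1 - \<rho>)"
  shows "\<not> enat (\<nu> + r) < \<tau>\<^sub>S b \<omega>"
proof -
  let ?x = "real r * (D - \<delta>' - Kl * (1 / real G + \<delta> + real r / real \<nu>)) - a * ln (real r) - c"
  have "b = exp (ln b)" using b by simp
  also have "\<dots> \<le> exp (?x + ln (1 - \<rho>))" using suff by simp
  also have "\<dots> = (1 - \<rho>) * exp ?x" using \<rho> by (simp add: exp_add)
  finally have "ennreal b \<le> ennreal (1 - \<rho>) * ennreal (exp ?x)"
    using \<rho> by (subst ennreal_mult[symmetric]) (auto intro: ennreal_leI)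
  also have "\<dots> \<le> ennreal (1 - \<rho>) * M_stat Pr f L (Suc \<nu>) (\<nu> + r) \<omega>"
    by (intro mult_left_mono M_stat_ge assms) auto
  also have "\<dots> \<le> M_bar Pr f L \<rho> (Suc \<nu>) (\<nu> + r) \<omega>" unfolding M_bar_def by simp
  also have "\<dots> = ennreal (w (Suc \<nu>)) * M_bar Pr f L \<rho> (Suc \<nu>) (\<nu> + r) \<omega>" using w by simp
  also have "\<dots> \<le> S_bar Pr f L w \<rho> (\<nu> + r) \<omega>"
    unfolding S_bar_def by (rule member_le_sum[where f="\<lambda>k. ennreal (w k) * M_bar Pr f L \<rho> k (\<nu> + r) \<omega>"]) (use r in auto)
  finally show ?thesis
    unfolding less_tau_bar_iff using r by (auto simp: not_less[symmetric])
qed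

lemma AE_rnd: "AE \<omega> in law \<nu>. \<forall>i\<ge>1. rnd i \<omega> \<in> {0..1}"
proof -
  have "AE \<omega> in law \<nu>. rnd i \<omega> \<in> {0..1}" if i: "1 \<le> i" for i
  proof -
    let ?P = "if i \<le> \<nu> then P0 else P1"
    have P: "prob_space ?P" by (simp add: P0 P1)
    interpret U: prob_space unif01 by (rule prob_space_unif01)
    interpret P: prob_space ?P by (rule P)
    interpret pair_sigma_finite ?P unif01 ..
    have "AE x in ?P \<Otimes>\<^sub>M unif01. snd x \<in> {0..1}"
    proof (rule AE_pair_measure)
      have "{x\<in>space (?P \<Otimes>\<^sub>M unif01). snd x \<in> {0..1}} = snd -` {0..1} \<inter> space (?P \<Otimes>\<^sub>M unif01)" by auto
      then show "{x\<in>space (?P \<Otimes>\<^sub>M unif01). snd x \<in> {0..1}} \<in> sets (?P \<Otimes>\<^sub>M unif01)"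
        using measurable_sets[OF measurable_snd, of "{0..1}" unif01 ?P] by simp
      show "AE x in ?P. AE y in unif01. snd (x, y) \<in> {0..1}"
        using AE_unif01 by simp
    qed
    then show ?thesis
      unfolding change_law_def using i
      by (intro AE_PiM_component[of "{1..}" "\<lambda>i. (if i \<le> \<nu> then P0 else P1) \<Otimes>\<^sub>M unif01" i "\<lambda>x. snd x \<in> {0..1}"]
          prob_space_pair_unif01) (simp_all add: P0 P1)
  qed
  then show ?thesis by (subst AE_all_countable) (auto intro: AE_impI)
qed

lemma measurable_obs_change:
  assumes "1 \<le> i" and g: "g \<in> borel_measurable P0"
  shows "(\<lambda>\<omega>. g (obs i \<omega>)) \<in> borel_measurable (law \<nu>)"
  using measurable_compose[OF measurable_obs[OF assms(1)] g] by (simp cong: measurable_cong_sets add: sets_change_law)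

lemma prob_count:
  assumes \<nu>: "1 \<le> \<nu>" and \<delta>: "0 \<le> \<delta>" and v: "0 \<le> v" "v \<le> 1"
  shows "measure (law \<nu>) {\<omega>\<in>space (law \<nu>).
     \<not> \<bar>(\<Sum>i=1..\<nu>. of_bool (pit (obs i \<omega>) < v)) - real \<nu> * v\<bar> \<le> real \<nu> * \<delta>} \<le> 2 * exp (- 2 * real \<nu> * \<delta>\<^sup>2)"
proof -
  let ?M = "law \<nu>" and ?Q = "\<lambda>i. (if i \<le> \<nu> then P0 else P1) \<Otimes>\<^sub>M unif01"
  interpret M: prob_space ?M by (rule prob_space_change_law)
  let ?g = "\<lambda>x. indicator {..<v} (pit x) :: real"
  have gm0: "?g \<in> borel_measurable P0" using pit_measurable[OF cont] by measurable
  have gm: "(\<lambda>x. ?g (fst x)) \<in> borel_measurable (P0 \<Otimes>\<^sub>M unif01)" using measurable_compose[OF measurable_fst gm0] .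
  have ob: "of_bool (pit (obs i \<omega>) < v) = ?g (obs i \<omega>)" for i and \<omega> :: "'a path" by (simp add: indicator_def)
  have c: "card {1..\<nu>} = \<nu>" by simp
  have Qp: "prob_space (?Q i)" for i by (simp add: prob_space_pair_unif01 P0 P1)
  have J: "finite {1..\<nu>}" "{1..\<nu>} \<noteq> {}" "{1..\<nu>} \<subseteq> {1..}" using \<nu> by auto
  have Q: "?Q i = P0 \<Otimes>\<^sub>M unif01" if "i \<in> {1..\<nu>}" for i using that by auto
  have bd: "0 \<le> ?g (fst x) \<and> ?g (fst x) \<le> 1" for x :: "'a \<times> real" by (simp add: indicator_def)
  have 01: "(0::real) < 1" by simp
  note H = Hoeffding_PiM[of "{1..}" ?Q "{1..\<nu>}", OF Qp J Q gm bd 01 \<delta>,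
      unfolded c integral_fst_unif01[OF gm0] integral_indicator_pit[OF cont v], folded change_law_def]
  let ?E1 = "{\<omega>\<in>space ?M. (\<Sum>i\<in>{1..\<nu>}. ?g (obs i \<omega>)) \<ge> real \<nu> * (v + \<delta>)}"
  let ?E2 = "{\<omega>\<in>space ?M. (\<Sum>i\<in>{1..\<nu>}. ?g (obs i \<omega>)) \<le> real \<nu> * (v - \<delta>)}"
  have "(\<lambda>\<omega>. \<Sum>i\<in>{1..\<nu>}. ?g (obs i \<omega>)) \<in> borel_measurable ?M"
    by (intro borel_measurable_sum measurable_obs_change gm0) auto
  then have E: "?E1 \<in> sets ?M" "?E2 \<in> sets ?M" by simp_all
  have "{\<omega>\<in>space ?M. \<not> \<bar>(\<Sum>i=1..\<nu>. of_bool (pit (obs i \<omega>) < v)) - real \<nu> * v\<bar> \<le> real \<nu> * \<delta>} \<subseteq> ?E1 \<union> ?E2"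
    unfolding ob by (auto simp: algebra_simps abs_le_iff)
  then have "M.prob {\<omega>\<in>space ?M. \<not> \<bar>(\<Sum>i=1..\<nu>. of_bool (pit (obs i \<omega>) < v)) - real \<nu> * v\<bar> \<le> real \<nu> * \<delta>} \<le> M.prob ?E1 + M.prob ?E2"
    using E by (intro order.trans[OF M.finite_measure_mono measure_Un_le] sets.Un)
  also have "\<dots> \<le> 2 * exp (- 2 * real \<nu> * \<delta>\<^sup>2)" using H by simp
  finally show ?thesis .
qed

lemma prob_not_grid_ok:
  assumes \<nu>: "1 \<le> \<nu>" and \<delta>: "0 \<le> \<delta>" and G: "1 \<le> G"
  shows "{\<omega>\<in>space (law \<nu>). \<not> grid_ok \<nu> G \<delta> \<omega>} \<in> sets (law \<nu>)" (is ?meas)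
    and "measure (law \<nu>) {\<omega>\<in>space (law \<nu>). \<not> grid_ok \<nu> G \<delta> \<omega>} \<le> 2 * real (Suc G) * exp (- 2 * real \<nu> * \<delta>\<^sup>2)"
proof -
  let ?M = "law \<nu>"
  interpret M: prob_space ?M by (rule prob_space_change_law)
  let ?E = "\<lambda>k. {\<omega>\<in>space ?M. \<not> \<bar>(\<Sum>i=1..\<nu>. of_bool (pit (obs i \<omega>) < real k / real G)) - real \<nu> * (real k / real G)\<bar> \<le> real \<nu> * \<delta>}"
  have E: "?E k \<in> sets ?M" for k
  proof -
    have g: "(\<lambda>x. of_bool (pit x < real k / real G) :: real) \<in> borel_measurable P0"
      using pit_measurable[OF cont] unfolding of_bool_def by measurable
    have "(\<lambda>\<omega>. \<Sum>i=1..\<nu>. of_bool (pit (obs i \<omega>) < real k / real G) :: real) \<in> borel_measurable ?M"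
      by (rule borel_measurable_sum, rule measurable_obs_change[OF _ g]) simp
    then show ?thesis by (rule sets_abs_gt)
  qed
  have eq: "{\<omega>\<in>space ?M. \<not> grid_ok \<nu> G \<delta> \<omega>} = (\<Union>k\<in>{..G}. ?E k)" unfolding grid_ok_def by auto
  show ?meas unfolding eq by (rule sets.finite_UN, rule finite_atMost, rule E)
  have "M.prob (\<Union>k\<in>{..G}. ?E k) \<le> (\<Sum>k\<in>{..G}. M.prob (?E k))"
    by (rule M.finite_measure_subadditive_finite, rule finite_atMost) (use E in blast)
  also have "\<dots> \<le> (\<Sum>k\<in>{..G}. 2 * exp (- 2 * real \<nu> * \<delta>\<^sup>2))"
    using G by (intro sum_mono prob_count[OF \<nu> \<delta>]) (simp_all add: divide_le_eq_1)
  also have "\<dots> = 2 * real (Suc G) * exp (- 2 * real \<nu> * \<delta>\<^sup>2)" by simp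
  finally show "M.prob {\<omega>\<in>space ?M. \<not> grid_ok \<nu> G \<delta> \<omega>} \<le> 2 * real (Suc G) * exp (- 2 * real \<nu> * \<delta>\<^sup>2)" unfolding eq .
qed

text \<open>Survival needs one of two failures: miscalibrated ranks from before the change, or an
  atypically small log-likelihood sum after it. The two terms bound their probabilities.\<close>

lemma prob_tau_bar_gt:
  assumes \<nu>: "1 \<le> \<nu>" and r: "1 \<le> r" and G: "1 \<le> G" and \<delta>: "0 \<le> \<delta>" and b: "0 < b" and \<delta>': "0 \<le> \<delta>'"
    and suff: "ln b \<le> real r * (D - \<delta>' - Kl * (1 / real G + \<delta> + real r / real \<nu>)) - a * ln (real r) - c + ln (1 - \<rho>)"
  shows "survival \<nu> (\<nu> + r) b
    \<le> 2 * real (Suc G) * exp (- 2 * real \<nu> * \<delta>\<^sup>2) + exp (- real r * \<delta>'\<^sup>2 / (2 * B\<^sup>2))"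
proof -
  let ?M = "law \<nu>"
  interpret M: prob_space ?M by (rule prob_space_change_law)
  let ?E1 = "{\<omega>\<in>space ?M. \<not> grid_ok \<nu> G \<delta> \<omega>}"
  let ?E2 = "{\<omega>\<in>space ?M. (\<Sum>i=Suc \<nu>..\<nu>+r. ln (h (pit (obs i \<omega>)))) \<le> real r * (D - \<delta>')}"
  have g0: "(\<lambda>x. ln (h (pit x))) \<in> borel_measurable P0" using pit_measurable[OF cont] by measurable
  have "(\<lambda>\<omega>. \<Sum>i=Suc \<nu>..\<nu>+r. ln (h (pit (obs i \<omega>)))) \<in> borel_measurable ?M"
    by (rule borel_measurable_sum, rule measurable_obs_change[OF _ g0]) auto
  then have E2: "?E2 \<in> sets ?M" by measurable
  note E1 = prob_not_grid_ok(1)[OF \<nu> \<delta> G]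
  have "AE \<omega> in ?M. \<omega> \<in> {\<omega>\<in>space (null_law P0). enat (\<nu> + r) < \<tau>\<^sub>S b \<omega>} \<longrightarrow> \<omega> \<in> ?E1 \<union> ?E2"
    using AE_rnd[of \<nu>]
  proof eventually_elim
    fix \<omega> :: "'a path" assume rnd: "\<forall>i\<ge>1. rnd i \<omega> \<in> {0..1}"
    show "\<omega> \<in> {\<omega>\<in>space (null_law P0). enat (\<nu> + r) < \<tau>\<^sub>S b \<omega>} \<longrightarrow> \<omega> \<in> ?E1 \<union> ?E2"
      using tau_bar_stops[OF \<nu> r G \<delta> b, of \<omega> \<delta>'] rnd suff
      by (auto simp: space_change_law intro: linear[THEN disjE])
  qed
  then have "M.prob {\<omega>\<in>space (null_law P0). enat (\<nu> + r) < \<tau>\<^sub>S b \<omega>} \<le> M.prob (?E1 \<union> ?E2)"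
    using E1 E2 by (intro M.finite_measure_mono_AE sets.Un)
  also have "\<dots> \<le> M.prob ?E1 + M.prob ?E2" using E1 E2 by (rule measure_Un_le)
  also have "\<dots> \<le> 2 * real (Suc G) * exp (- 2 * real \<nu> * \<delta>\<^sup>2) + exp (- real r * \<delta>'\<^sup>2 / (2 * B\<^sup>2))"
  proof (rule add_mono[OF prob_not_grid_ok(2)[OF \<nu> \<delta> G]])
    have "M.prob ?E2 \<le> exp (- 2 * real r * \<delta>'\<^sup>2 / (B - - B)\<^sup>2)"
      unfolding integral_ln_h[symmetric]
    proof (rule Hoeffding_change_law(2))
      show "(\<lambda>x. ln (h (pit x))) \<in> borel_measurable P1" by measurable
      show "- B \<le> ln (h (pit x)) \<and> ln (h (pit x)) \<le> B" for x using h_bd[OF pit_unit, of x] by linarith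
    qed (use B \<delta>' r in auto)
    \<comment> \<open>The range of ln h has length 2 B, so Hoeffding's exponent 2 r \<delta>'^2 / (2
      B)^2 is r \<delta>'^2 / (2 B^2).\<close>
    also have "\<dots> = exp (- real r * \<delta>'\<^sup>2 / (2 * B\<^sup>2))"
      by (simp add: power2_eq_square field_simps)
    finally show "M.prob ?E2 \<le> exp (- real r * \<delta>'\<^sup>2 / (2 * B\<^sup>2))" .
  qed
  finally show ?thesis .
qed

end

section \<open>The detector as a randomized stopping time, and its mean delay\<close>

text \<open>Setting later coordinates to 0 makes the whole p-value sequence measurable at time
  \<open>n\<close>; the event of running up to \<open>n\<close> does not see the difference.\<close>

lemma measurable_trunc_conf_path:
  assumes s: "s \<in> borel_measurable P0"
  shows "(\<lambda>\<omega>. \<lambda>j\<in>{1..}. if j \<le> n then conf_p s j \<omega> else 0) \<in> rand_filtration P0 (enat n) \<rightarrow>\<^sub>M unif_law"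
  unfolding unif_law_def
proof (rule measurable_restrict)
  fix j :: nat assume j: "j \<in> {1..}"
  have "conf_p s j \<in> borel_measurable (rand_filtration P0 (enat n))" if "j \<le> n"
  proof (rule measurable_conf_p_general[OF s])
    show "obs i \<in> rand_filtration P0 (enat n) \<rightarrow>\<^sub>M P0" if "1 \<le> i" "i \<le> j" for i
      using that \<open>j \<le> n\<close> by (intro measurable_obs_filtration) auto
    have "j \<in> times_upto (enat n)" using that j by (simp add: times_upto_enat)
    from measurable_compose[OF measurable_coord_filtration[OF this, of P0] measurable_snd]
    show "rnd j \<in> borel_measurable (rand_filtration P0 (enat n))" by simp
  qed (use j in simp)
  then show "(\<lambda>\<omega>. if j \<le> n then conf_p s j \<omega> else 0) \<in> rand_filtration P0 (enat n) \<rightarrow>\<^sub>M unif01"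
    by (cases "j \<le> n") (simp_all cong: measurable_cong_sets)
qed

lemma tau_bar_T_rand:
  assumes s: "s \<in> borel_measurable P0" and w: "\<forall>k\<ge>1. w k = 1"
    and Pr: "prob_space Pr" and fam: "density_family Pr f" and \<rho>: "0 < \<rho>" "\<rho> < 1"
  shows "tau_bar Pr f s w \<rho> b \<in> T_rand P0"
  unfolding T_rand_def
proof (intro CollectI conjI ballI stopping_timeI)
  fix \<omega> :: "'a path"
  have "enat 0 < tau_bar Pr f s w \<rho> b \<omega>" unfolding less_tau_bar_iff by simp
  then show "1 \<le> tau_bar Pr f s w \<rho> b \<omega>" by (simp add: Suc_ile_eq one_enat_def)
next
  fix t :: enat
  show "Measurable.pred (rand_filtration P0 t) (\<lambda>\<omega>. tau_bar Pr f s w \<rho> b \<omega> \<le> t)"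
  proof (cases t)
    case (enat n)
    let ?Z = "\<lambda>\<omega>. \<lambda>j\<in>{1..}. if j \<le> n then conf_p s j \<omega> else 0"
    have "{\<omega>\<in>space (null_law P0). tau_bar Pr f s w \<rho> b \<omega> \<le> enat n} = space (null_law P0) - (?Z -` running Pr f \<rho> b n \<inter> space (rand_filtration P0 (enat n)))"
    proof -
      have "?Z \<omega> \<in> running Pr f \<rho> b n \<longleftrightarrow> enat n < tau_bar Pr f s w \<rho> b \<omega>" if "\<omega> \<in> space (null_law P0)" for \<omega>
      proof -
        have "e_sum Pr f \<rho> t (?Z \<omega>) = S_bar Pr f s w \<rho> t \<omega>" if "t \<in> {1..n}" for t
          unfolding S_bar_eq_e_sum[OF w] using that by (intro e_sum_cong) (auto simp: conf_path_def)
        moreover have "?Z \<omega> \<in> space unif_law"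
          using measurable_space[OF measurable_trunc_conf_path[OF s]] that by simp
        ultimately show ?thesis unfolding running_def less_tau_bar_iff by auto
      qed
      then show ?thesis by (simp add: set_eq_iff linorder_not_le[symmetric]) blast
    qed
    moreover have "?Z -` running Pr f \<rho> b n \<inter> space (rand_filtration P0 (enat n)) \<in> sets (rand_filtration P0 (enat n))"
      by (rule measurable_sets[OF measurable_trunc_conf_path[OF s] running_sets[OF Pr fam \<rho>]])
    ultimately have "{\<omega>\<in>space (null_law P0). tau_bar Pr f s w \<rho> b \<omega> \<le> enat n} \<in> sets (rand_filtration P0 (enat n))"
      using sets.compl_sets[of _ "rand_filtration P0 (enat n)"] by simp
    then show ?thesis by (simp add: pred_def enat)
  qed simp
qed

text \<open>The delay is at most r1, or at most r2 if r1 is exceeded, or at most T if r2 is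
  exceeded. Taking expectations, only two survival probabilities are needed.\<close>

lemma enat_delay_bound:
  assumes "\<tau> \<le> enat T"
  shows "ennreal_of_enat (\<tau> - enat \<nu>) * of_bool (enat \<nu> < \<tau>)
    \<le> of_nat r1 + of_nat r2 * of_bool (enat (\<nu> + r1) < \<tau>) + of_nat T * of_bool (enat (\<nu> + r2) < \<tau>)"
proof -
  obtain t where t: "\<tau> = enat t" "t \<le> T" using assms by (cases \<tau>) auto
  have "(t - \<nu>) * of_bool (\<nu> < t) \<le> r1 + r2 * of_bool (\<nu> + r1 < t) + T * of_bool (\<nu> + r2 < t)"
    using t(2) by (auto simp: of_bool_def)
  then have "(of_nat ((t - \<nu>) * of_bool (\<nu> < t)) :: ennreal) \<le> of_nat (r1 + r2 * of_bool (\<nu> + r1 < t) + T * of_bool (\<nu> + r2 < t))"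
    by (rule of_nat_mono)
  then show ?thesis by (simp add: t)
qed

lemma divide_mono_ennreal:
  assumes "x \<le> (y :: ennreal)" "ennreal d \<le> e" "0 < d" shows "x / e \<le> y / ennreal d"
proof -
  have "inverse e \<le> inverse (ennreal d)"
  proof (cases e)
    case (real r)
    then show ?thesis using assms by (simp add: inverse_ennreal ennreal_le_iff2 le_imp_inverse_le)
  qed simp
  then show ?thesis unfolding divide_ennreal_def using assms(1) by (intro mult_mono) auto
qed

context local_KL
begin

context
  fixes \<kappa> :: real and N :: "real \<Rightarrow> nat"
  assumes \<kappa>: "0 < \<kappa>" "\<kappa> < 1"
    and N_log: "(\<lambda>\<gamma>. ln \<gamma>) \<in> o[at_top](\<lambda>\<gamma>. real (N \<gamma>))"
begin

lemma window_ge: "\<nu> \<in> change_window n \<kappa> \<Longrightarrow> \<kappa> * real n \<le> real \<nu>"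
  unfolding change_window_def by (simp add: nat_le_iff ceiling_le_iff)

text \<open>\<open>gain\<close> says that \<beta> ln \<gamma> steps collect more than ln \<gamma>,
  with \<delta>' set aside for Hoeffding and \<epsilon> for the p-value approximation. The surplus
  is a multiple of ln \<gamma> and absorbs the O(ln ln \<gamma>) penalty of the mixture.\<close>

lemma tail_asymptotics:
  assumes \<beta>: "0 < \<beta>" and \<delta>': "0 < \<delta>'" and \<epsilon>: "0 < \<epsilon>" and gain: "1 < \<beta> * (D - \<delta>' - \<epsilon>)"
  shows "\<exists>C\<ge>0. \<forall>\<^sub>F \<gamma> in at_top. \<forall>\<nu>\<in>change_window (N \<gamma>) \<kappa>.
    survival \<nu> (\<nu> + nat \<lceil>\<beta> * ln \<gamma>\<rceil>) \<gamma>
     \<le> C * exp (- 2 * ln \<gamma>) + exp (- (\<beta> * \<delta>'\<^sup>2 / (2 * B\<^sup>2)) * ln \<gamma>)"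
proof -
  \<comment> \<open>The approximation error has three parts (grid mesh, empirical frequencies,
    contaminated ranks), each held below \<delta>; \<open>Kl + 1\<close> avoids dividing by
    0.\<close>
  define \<delta> where "\<delta> = \<epsilon> / (3 * (Kl + 1))"
  have \<delta>: "0 < \<delta>" using \<epsilon> Kl by (simp add: \<delta>_def)
  have Kl\<delta>: "Kl * (3 * \<delta>) \<le> \<epsilon>"
  proof -
    have "Kl * (3 * \<delta>) \<le> (Kl + 1) * (3 * \<delta>)" using \<delta> by (intro mult_right_mono) auto
    also have "\<dots> = \<epsilon>"
    proof -
      have "Kl + 1 \<noteq> 0" using Kl by simp
      then show ?thesis unfolding \<delta>_def by (simp add: field_simps)
    qed
    finally show ?thesis .
  qed
  define G where "G = nat \<lceil>1 / \<delta>\<rceil>"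
  have G1: "1 \<le> G" using \<delta> unfolding G_def by (simp add: Suc_le_eq)
  have "1 / \<delta> \<le> real G" unfolding G_def by (rule real_nat_ceiling_ge)
  then have G\<delta>: "1 / real G \<le> \<delta>" using \<delta> G1 by (simp add: field_simps)
  define q where "q = \<beta> * (D - \<delta>' - \<epsilon>) - 1"
  have q: "0 < q" using gain by (simp add: q_def)
  have \<eta>0: "0 < D - \<delta>' - \<epsilon>" using gain \<beta> by (smt (verit) mult_nonneg_nonpos)
  have ev1: "\<forall>\<^sub>F \<gamma> in at_top. \<gamma> > (1::real)" by (rule eventually_gt_at_top)
  have e1: "0 < \<delta> * \<kappa> / (\<beta> + 1)" using \<delta> \<kappa> \<beta> by simp
  \<comment> \<open>The coefficient \<beta> + 1 covers the rounding up of r once ln \<gamma> \<ge>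
    1. This gives r / \<nu> \<le> \<delta> throughout the change window.\<close>
  have ev2: "\<forall>\<^sub>F \<gamma> in at_top. (\<beta> + 1) * ln \<gamma> \<le> \<delta> * (\<kappa> * real (N \<gamma>))"
    using landau_o.smallD[OF N_log e1] ev1
  proof eventually_elim
    case (elim \<gamma>)
    then have "ln \<gamma> \<le> \<delta> * \<kappa> / (\<beta> + 1) * real (N \<gamma>)" by simp
    then have "(\<beta> + 1) * ln \<gamma> \<le> (\<beta> + 1) * (\<delta> * \<kappa> / (\<beta> + 1) * real (N \<gamma>))" using \<beta> by (intro mult_left_mono) auto
    then show ?case using \<beta> by simp
  qed
  have ev3: "\<forall>\<^sub>F \<gamma> in at_top. 1 \<le> ln (\<gamma>::real)" by real_asymp
  have e4: "0 < \<delta>\<^sup>2 * \<kappa>" using \<delta> \<kappa> by simp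
  \<comment> \<open>Ensures \<nu> \<delta>^2 \<ge> ln \<gamma>, so that the grid fails with
    probability of order \<gamma>^(-2).\<close>
  have ev4: "\<forall>\<^sub>F \<gamma> in at_top. ln \<gamma> \<le> \<delta>\<^sup>2 * (\<kappa> * real (N \<gamma>))"
    using landau_o.smallD[OF N_log e4] ev1 by eventually_elim (simp add: mult.assoc)
  have ev5: "\<forall>\<^sub>F \<gamma> in at_top. a * ln (\<beta> * ln \<gamma> + 1) + c - ln (1 - \<rho>) \<le> q * ln \<gamma>"
    using q \<beta> by real_asymp
  show ?thesis
  proof (intro exI[of _ "2 * real (Suc G)"] conjI)
    show "\<forall>\<^sub>F \<gamma> in at_top. \<forall>\<nu>\<in>change_window (N \<gamma>) \<kappa>.
      survival \<nu> (\<nu> + nat \<lceil>\<beta> * ln \<gamma>\<rceil>) \<gamma>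
      \<le> 2 * real (Suc G) * exp (- 2 * ln \<gamma>) + exp (- (\<beta> * \<delta>'\<^sup>2 / (2 * B\<^sup>2)) * ln \<gamma>)"
      using ev1 ev2 ev3 ev4 ev5
    proof eventually_elim
      case (elim \<gamma>)
      define r where "r = nat \<lceil>\<beta> * ln \<gamma>\<rceil>"
      have ln0: "0 < ln \<gamma>" using elim by simp
      have \<beta>ln: "0 < \<beta> * ln \<gamma>" using \<beta> ln0 by simp
      then have ri: "real r = of_int \<lceil>\<beta> * ln \<gamma>\<rceil>" unfolding r_def by simp
      have r: "\<beta> * ln \<gamma> \<le> real r" "real r \<le> \<beta> * ln \<gamma> + 1" unfolding ri by linarith+
      have r1: "1 \<le> r" using r(1) \<beta>ln by linarith
      show ?case
        unfolding r_def[symmetric]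
      proof
        fix \<nu> assume "\<nu> \<in> change_window (N \<gamma>) \<kappa>"
        then have \<nu>N: "\<kappa> * real (N \<gamma>) \<le> real \<nu>" by (rule window_ge)
        have "real r \<le> (\<beta> + 1) * ln \<gamma>" using r(2) elim(3) by (simp add: distrib_right)
        also have "\<dots> \<le> \<delta> * (\<kappa> * real (N \<gamma>))" by (rule elim(2))
        also have "\<dots> \<le> \<delta> * real \<nu>" using \<nu>N \<delta> by (intro mult_left_mono) auto
        finally have r\<nu>: "real r \<le> \<delta> * real \<nu>" .
        have \<nu>1: "1 \<le> \<nu>"
        proof (rule ccontr)
          assume "\<not> 1 \<le> \<nu>"
          then have "\<nu> = 0" by simp
          then show False using r\<nu> r1 by simp
        qed
        have rd: "real r / real \<nu> \<le> \<delta>" using r\<nu> \<nu>1 by (simp add: pos_divide_le_eq)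
        let ?gain = "real r * (D - \<delta>' - Kl * (1 / real G + \<delta> + real r / real \<nu>))"
        have "Kl * (1 / real G + \<delta> + real r / real \<nu>) \<le> Kl * (3 * \<delta>)"
          using G\<delta> rd Kl by (intro mult_left_mono) auto
        then have e: "D - \<delta>' - \<epsilon> \<le> D - \<delta>' - Kl * (1 / real G + \<delta> + real r / real \<nu>)" using Kl\<delta> by linarith
        have "ln \<gamma> + (a * ln (\<beta> * ln \<gamma> + 1) + c - ln (1 - \<rho>)) \<le> ln \<gamma> + q * ln \<gamma>" using elim(5) by simp
        also have "\<dots> = \<beta> * ln \<gamma> * (D - \<delta>' - \<epsilon>)" by (simp add: q_def algebra_simps)
        also have "\<dots> \<le> real r * (D - \<delta>' - \<epsilon>)" using r \<eta>0 by (intro mult_right_mono) auto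
        also have "\<dots> \<le> ?gain" using e by (intro mult_left_mono) auto
        finally have "ln \<gamma> + (a * ln (\<beta> * ln \<gamma> + 1) + c - ln (1 - \<rho>)) \<le> ?gain" .
        moreover have "a * ln (real r) \<le> a * ln (\<beta> * ln \<gamma> + 1)"
          using r r1 a by (intro mult_left_mono) auto
        ultimately have suff: "ln \<gamma> \<le> ?gain - a * ln (real r) - c + ln (1 - \<rho>)"
          by linarith
        have "survival \<nu> (\<nu> + r) \<gamma>
          \<le> 2 * real (Suc G) * exp (- 2 * real \<nu> * \<delta>\<^sup>2) + exp (- real r * \<delta>'\<^sup>2 / (2 * B\<^sup>2))"
          by (rule prob_tau_bar_gt[OF \<nu>1 r1 G1 _ _ _ suff]) (use \<delta> \<delta>' elim(1) in auto)
        also have "\<dots> \<le> 2 * real (Suc G) * exp (- 2 * ln \<gamma>) + exp (- (\<beta> * \<delta>'\<^sup>2 / (2 * B\<^sup>2)) * ln \<gamma>)"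
        proof (intro add_mono mult_left_mono)
          have "\<delta>\<^sup>2 * (\<kappa> * real (N \<gamma>)) \<le> \<delta>\<^sup>2 * real \<nu>" using \<nu>N by (intro mult_left_mono) auto
          then show "exp (- 2 * real \<nu> * \<delta>\<^sup>2) \<le> exp (- 2 * ln \<gamma>)" using elim(4) by (simp add: mult.commute)
          have "\<beta> * ln \<gamma> * (\<delta>'\<^sup>2 / (2 * B\<^sup>2)) \<le> real r * (\<delta>'\<^sup>2 / (2 * B\<^sup>2))" using r by (intro mult_right_mono) auto
          then show "exp (- real r * \<delta>'\<^sup>2 / (2 * B\<^sup>2)) \<le> exp (- (\<beta> * \<delta>'\<^sup>2 / (2 * B\<^sup>2)) * ln \<gamma>)" by (simp add: ac_simps)
        qed auto
        finally show "survival \<nu> (\<nu> + r) \<gamma>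
          \<le> 2 * real (Suc G) * exp (- 2 * ln \<gamma>) + exp (- (\<beta> * \<delta>'\<^sup>2 / (2 * B\<^sup>2)) * ln \<gamma>)" .
      qed
    qed
  qed simp
qed

end

text \<open>The numerator comes from \<open>enat_delay_bound\<close> with T the deterministic bound,
  at most \<gamma> / \<rho> + 1. In the denominator, survival past \<nu> is decided by time \<nu>,
  so its null probability may be used.\<close>

lemma cond_delay_tau_bar_le:
  assumes \<gamma>: "1 < \<gamma>" and \<nu>: "real \<nu> < \<gamma>"
    and p1: "survival \<nu> (\<nu> + r1) \<gamma> \<le> p1"
    and p2: "survival \<nu> (\<nu> + r2) \<gamma> \<le> p2"
  shows "cond_delay P0 \<nu> P1 (\<tau>\<^sub>S \<gamma>) \<le> ennreal ((real r1 + real r2 * p1 + (\<gamma> / \<rho> + 1) * p2) / (1 - real \<nu> / \<gamma>))"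
proof -
  let ?M = "law \<nu>" and ?S = "space (null_law P0)"
  interpret M: prob_space ?M by (rule prob_space_change_law)
  interpret N: prob_space "null_law P0" by (rule prob_space_null_law[OF P0])
  have T: "\<tau>\<^sub>S \<gamma> \<in> T_rand P0" by (rule tau_bar_T_rand[OF L_meas w Pr fam \<rho>])
  let ?E = "\<lambda>n. {\<omega>\<in>?S. enat n < \<tau>\<^sub>S \<gamma> \<omega>}"
  have E: "?E n \<in> sets ?M" for n unfolding sets_change_law by (rule T_rand_sets_null_law(2)[OF T])
  define T where "T = nat \<lceil>\<gamma> / \<rho>\<rceil>"
  have g\<rho>: "0 < \<gamma> / \<rho>" using \<gamma> \<rho> by simp
  then have Ti: "real T = of_int \<lceil>\<gamma> / \<rho>\<rceil>" unfolding T_def by simp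
  have Tb: "\<gamma> / \<rho> \<le> real T" "real T \<le> \<gamma> / \<rho> + 1" unfolding Ti by linarith+
  have T1: "1 \<le> T" using Tb g\<rho> by linarith
  have "\<gamma> \<le> \<rho> * real T" using Tb \<rho> by (simp add: pos_divide_le_eq mult.commute)
  note \<tau>T = tau_bar_le[OF Pr fam \<rho> P0 L_meas cont w T1 this]
  have pp: "0 \<le> p1" "0 \<le> p2" using p1 p2 measure_nonneg order_trans by blast+
  let ?num = "\<integral>\<^sup>+\<omega>. ennreal_of_enat (\<tau>\<^sub>S \<gamma> \<omega> - enat \<nu>) * indicator {\<omega>. enat \<nu> < \<tau>\<^sub>S \<gamma> \<omega>} \<omega> \<partial>?M"
  have "?num \<le> (\<integral>\<^sup>+\<omega>. of_nat r1 + of_nat r2 * indicator (?E (\<nu> + r1)) \<omega> + of_nat T * indicator (?E (\<nu> + r2)) \<omega> \<partial>?M)"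
  proof (rule nn_integral_mono)
    fix \<omega> assume "\<omega> \<in> space ?M"
    then have \<omega>: "\<omega> \<in> ?S" by (simp add: space_change_law)
    have i: "indicator (?E n) \<omega> = (of_bool (enat n < \<tau>\<^sub>S \<gamma> \<omega>) :: ennreal)" for n using \<omega> by (simp add: indicator_def)
    have i': "indicator {\<omega>. enat \<nu> < \<tau>\<^sub>S \<gamma> \<omega>} \<omega> = (of_bool (enat \<nu> < \<tau>\<^sub>S \<gamma> \<omega>) :: ennreal)" by (simp add: indicator_def)
    show "ennreal_of_enat (\<tau>\<^sub>S \<gamma> \<omega> - enat \<nu>) * indicator {\<omega>. enat \<nu> < \<tau>\<^sub>S \<gamma> \<omega>} \<omega>
      \<le> of_nat r1 + of_nat r2 * indicator (?E (\<nu> + r1)) \<omega> + of_nat T * indicator (?E (\<nu> + r2)) \<omega>"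
      unfolding i i' by (rule enat_delay_bound[OF \<tau>T])
  qed
  also have "\<dots> = of_nat r1 + of_nat r2 * emeasure ?M (?E (\<nu> + r1)) + of_nat T * emeasure ?M (?E (\<nu> + r2))"
    using E by (simp add: nn_integral_add nn_integral_cmult_indicator M.emeasure_space_1)
  also have "\<dots> = ennreal (real r1 + real r2 * M.prob (?E (\<nu> + r1)) + real T * M.prob (?E (\<nu> + r2)))"
    by (simp add: M.emeasure_eq_measure ennreal_of_nat_eq_real_of_nat ennreal_mult)
  also have "\<dots> \<le> ennreal (real r1 + real r2 * p1 + (\<gamma> / \<rho> + 1) * p2)"
    using p1 p2 pp Tb g\<rho> by (intro ennreal_leI add_mono mult_mono order.refl) auto
  finally have num: "?num \<le> ennreal (real r1 + real r2 * p1 + (\<gamma> / \<rho> + 1) * p2)" .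
  have den0: "0 < 1 - real \<nu> / \<gamma>" using \<gamma> \<nu> by simp
  have "N.prob {\<omega>\<in>?S. \<tau>\<^sub>S \<gamma> \<omega> \<le> enat \<nu>} \<le> real \<nu> / \<gamma>"
    by (rule tau_bar_null(3)[OF Pr fam \<rho> P0 L_meas cont w \<gamma>])
  moreover have "N.prob {\<omega>\<in>?S. \<tau>\<^sub>S \<gamma> \<omega> \<le> enat \<nu>} = 1 - N.prob (?E \<nu>)"
  proof -
    have "{\<omega>\<in>?S. \<tau>\<^sub>S \<gamma> \<omega> \<le> enat \<nu>} = ?S - ?E \<nu>" by auto
    then show ?thesis using N.prob_compl[OF T_rand_sets_null_law(2)[OF T]] by simp
  qed
  moreover have "emeasure ?M (?E \<nu>) = emeasure (null_law P0) (?E \<nu>)"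
    by (rule change_law_before[OF T_rand_less_sets[OF T]])
  ultimately have den: "ennreal (1 - real \<nu> / \<gamma>) \<le> emeasure ?M {\<omega>\<in>space ?M. enat \<nu> < \<tau>\<^sub>S \<gamma> \<omega>}"
    unfolding space_change_law by (simp add: N.emeasure_eq_measure)
  have "cond_delay P0 \<nu> P1 (\<tau>\<^sub>S \<gamma>) \<le> ennreal (real r1 + real r2 * p1 + (\<gamma> / \<rho> + 1) * p2) / ennreal (1 - real \<nu> / \<gamma>)"
    unfolding cond_delay_def by (rule divide_mono_ennreal[OF num den den0])
  also have "\<dots> = ennreal ((real r1 + real r2 * p1 + (\<gamma> / \<rho> + 1) * p2) / (1 - real \<nu> / \<gamma>))"
    using pp den0 \<gamma> \<rho> by (intro divide_ennreal) auto
  finally show ?thesis .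
qed

end

context local_KL
begin

lemma delay_upper:
  assumes \<kappa>: "0 < \<kappa>" "\<kappa> < 1"
    and N_log: "(\<lambda>\<gamma>. ln \<gamma>) \<in> o[at_top](\<lambda>\<gamma>. real (N \<gamma>))"
    and N_small: "(\<lambda>\<gamma>. real (N \<gamma>)) \<in> o[at_top](\<lambda>\<gamma>. \<gamma>)"
    and c0: "1 / D < c0"
  shows "\<forall>\<^sub>F \<gamma> in at_top. J_delay P0 P1 (N \<gamma>) \<kappa> (\<tau>\<^sub>S \<gamma>) \<le> ennreal (c0 * ln \<gamma>)"
proof -
  define \<beta>1 where "\<beta>1 = (c0 + 1 / D) / 2"
  have \<beta>1: "1 / D < \<beta>1" "\<beta>1 < c0" using c0 by (auto simp: \<beta>1_def)
  have \<beta>10: "0 < \<beta>1" using \<beta>1 D_pos by (meson less_trans zero_less_divide_1_iff)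
  \<comment> \<open>A quarter of the gap between D and 1 / \<beta>1, used once for Hoeffding and
    once for the approximation; the gain is then (\<beta>1 D + 1) / 2.\<close>
  define \<delta>1 where "\<delta>1 = (D - 1 / \<beta>1) / 4"
  have b1D: "1 < \<beta>1 * D" using \<beta>1 D_pos by (simp add: pos_divide_less_eq)
  then have \<delta>1: "0 < \<delta>1" using \<beta>10 by (simp add: \<delta>1_def field_simps)
  have "\<beta>1 * (D - \<delta>1 - \<delta>1) = (\<beta>1 * D + 1) / 2" using \<beta>10 by (simp add: \<delta>1_def field_simps)
  then have gain1: "1 < \<beta>1 * (D - \<delta>1 - \<delta>1)" using b1D by simp
  \<comment> \<open>The first summand already yields gain 2 at margins D / 4; the second raises the
    Hoeffding exponent to at least 2.\<close>
  define \<beta>2 where "\<beta>2 = 4 / D + 64 * B\<^sup>2 / D\<^sup>2"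
  have \<beta>20: "0 < \<beta>2" using D_pos by (simp add: \<beta>2_def add_pos_nonneg)
  have D4: "0 < D / 4" using D_pos by simp
  have "\<beta>2 * (D - D/4 - D/4) = 2 + 32 * B\<^sup>2 / D" using D_pos by (simp add: \<beta>2_def field_simps power2_eq_square)
  moreover have "0 \<le> 32 * B\<^sup>2 / D" using D_pos by simp
  ultimately have gain2: "1 < \<beta>2 * (D - D/4 - D/4)" by linarith
  have "\<beta>2 * (D/4)\<^sup>2 / (2 * B\<^sup>2) = D / (8 * B\<^sup>2) + 2"
    using D_pos B by (simp add: \<beta>2_def field_simps power2_eq_square)
  moreover have "0 \<le> D / (8 * B\<^sup>2)" using D_pos by simp
  ultimately have rate2: "2 \<le> \<beta>2 * (D/4)\<^sup>2 / (2 * B\<^sup>2)" by linarith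
  define q where "q = \<beta>1 * \<delta>1\<^sup>2 / (2 * B\<^sup>2)"
  have q: "0 < q" using \<beta>10 \<delta>1 B by (simp add: q_def)
  obtain C1 where C1: "0 \<le> C1" and ev1: "\<forall>\<^sub>F \<gamma> in at_top. \<forall>\<nu>\<in>change_window (N \<gamma>) \<kappa>.
      survival \<nu> (\<nu> + nat \<lceil>\<beta>1 * ln \<gamma>\<rceil>) \<gamma>
      \<le> C1 * exp (- 2 * ln \<gamma>) + exp (- q * ln \<gamma>)"
    using tail_asymptotics[OF \<kappa> N_log \<beta>10 \<delta>1 \<delta>1 gain1] unfolding q_def by auto
  obtain C2 where C2: "0 \<le> C2" and ev2: "\<forall>\<^sub>F \<gamma> in at_top. \<forall>\<nu>\<in>change_window (N \<gamma>) \<kappa>.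
      survival \<nu> (\<nu> + nat \<lceil>\<beta>2 * ln \<gamma>\<rceil>) \<gamma>
      \<le> C2 * exp (- 2 * ln \<gamma>) + exp (- (\<beta>2 * (D/4)\<^sup>2 / (2 * B\<^sup>2)) * ln \<gamma>)"
    using tail_asymptotics[OF \<kappa> N_log \<beta>20 D4 D4 gain2] by auto
  let ?P1 = "\<lambda>\<gamma>. C1 * exp (- 2 * ln \<gamma>) + exp (- q * ln \<gamma>)" and ?P2 = "\<lambda>\<gamma>. C2 * exp (- 2 * ln \<gamma>) + exp (- 2 * ln \<gamma>)"
  \<comment> \<open>The step from \<beta>1 to c3 absorbs bounded terms, and the step from c3 to c0
    absorbs the denominator, which is eventually at least c3 / c0.\<close>
  define c3 where "c3 = (\<beta>1 + c0) / 2"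
  have c3: "\<beta>1 < c3" "c3 < c0" using \<beta>1 by (auto simp: c3_def)
  have c30: "0 < c3" "0 < c0" using c3 \<beta>10 by auto
  have ev3: "\<forall>\<^sub>F \<gamma> in at_top. 1 < (\<gamma>::real)" by (rule eventually_gt_at_top)
  have e4: "0 < 1 - c3 / c0" using c3 c30 by simp
  have ev4: "\<forall>\<^sub>F \<gamma> in at_top. real (N \<gamma>) / \<gamma> \<le> 1 - c3 / c0"
    using landau_o.smallD[OF N_small e4] ev3 by eventually_elim (simp add: pos_divide_le_eq)
  have ev5: "\<forall>\<^sub>F \<gamma> in at_top. \<beta>1 * ln \<gamma> + 1 + (\<beta>2 * ln \<gamma> + 1) * ?P1 \<gamma>
      + (\<gamma> / \<rho> + 1) * ?P2 \<gamma> \<le> c3 * ln \<gamma>"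
  proof -
    have "((\<lambda>\<gamma>. (\<beta>2 * ln \<gamma> + 1) * ?P1 \<gamma>) \<longlongrightarrow> 0) at_top"
    proof -
      have "((\<lambda>\<gamma>. C1 * ((\<beta>2 * ln \<gamma> + 1) * exp (- 2 * ln \<gamma>)) + (\<beta>2 * ln \<gamma> + 1) * exp (- q * ln \<gamma>)) \<longlongrightarrow> C1 * 0 + 0) at_top"
        using q \<beta>20 by (intro tendsto_add tendsto_mult tendsto_const; real_asymp)
      then show ?thesis by (simp add: algebra_simps)
    qed
    then have a: "\<forall>\<^sub>F \<gamma> in at_top. (\<beta>2 * ln \<gamma> + 1) * ?P1 \<gamma> < 1"
      by (rule order_tendstoD) simp
    have "((\<lambda>\<gamma>. (C2 + 1) * ((\<gamma> / \<rho> + 1) * exp (- 2 * ln \<gamma>))) \<longlongrightarrow> (C2 + 1) * 0) at_top"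
      using \<rho> by (intro tendsto_mult tendsto_const; real_asymp)
    moreover have "(C2 + 1) * (x * e) = x * (C2 * e + e)" for x e by (simp add: algebra_simps)
    ultimately have "((\<lambda>\<gamma>. (\<gamma> / \<rho> + 1) * ?P2 \<gamma>) \<longlongrightarrow> 0) at_top"
      by (simp only: mult_zero_right)
    then have b: "\<forall>\<^sub>F \<gamma> in at_top. (\<gamma> / \<rho> + 1) * ?P2 \<gamma> < 1"
      by (rule order_tendstoD) simp
    have "0 < c3 - \<beta>1" using c3 by simp
    then have c: "\<forall>\<^sub>F \<gamma> in at_top. 3 \<le> (c3 - \<beta>1) * ln \<gamma>" by real_asymp
    \<comment> \<open>The 3 collects the rounding of the first horizon and the two vanishing tail
      terms, each below 1.\<close>
    have gen: "\<beta>1 * l + 1 + x + y \<le> c3 * l" if "x < 1" "y < 1" "3 \<le> (c3 - \<beta>1) * l" for x y l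
      using that by (simp add: left_diff_distrib)
    show ?thesis using a b c by eventually_elim (rule gen)
  qed
  show ?thesis
    using ev1 ev2 ev3 ev4 ev5
  proof eventually_elim
    case (elim \<gamma>)
    have ln0: "0 < ln \<gamma>" using elim(3) by simp
    have cl: "real (nat \<lceil>\<beta> * ln \<gamma>\<rceil>) \<le> \<beta> * ln \<gamma> + 1" if "0 < \<beta>" for \<beta>
    proof -
      have "0 < \<beta> * ln \<gamma>" using that ln0 by simp
      then have "real (nat \<lceil>\<beta> * ln \<gamma>\<rceil>) = of_int \<lceil>\<beta> * ln \<gamma>\<rceil>" by simp
      then show ?thesis by linarith
    qed
    show ?case
      unfolding J_delay_def
    proof (rule SUP_least)
      fix \<nu> assume \<nu>: "\<nu> \<in> change_window (N \<gamma>) \<kappa>"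
      then have "\<nu> \<le> N \<gamma>" by (simp add: change_window_def)
      then have "real \<nu> / \<gamma> \<le> real (N \<gamma>) / \<gamma>" using elim(3) by (intro divide_right_mono) auto
      then have \<nu>\<gamma>: "real \<nu> / \<gamma> \<le> 1 - c3 / c0" using elim(4) by linarith
      have c3c0: "0 < c3 / c0" using c30 by simp
      then have "real \<nu> / \<gamma> < 1" using \<nu>\<gamma> by linarith
      then have \<nu>1: "real \<nu> < \<gamma>" using elim(3) by simp
      let ?r1 = "nat \<lceil>\<beta>1 * ln \<gamma>\<rceil>" and ?r2 = "nat \<lceil>\<beta>2 * ln \<gamma>\<rceil>"
      let ?p1 = "?P1 \<gamma>" and ?p2 = "?P2 \<gamma>"
      have p10: "0 \<le> ?p1" and p20: "0 \<le> ?p2" using C1 C2 by auto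
      have p1: "survival \<nu> (\<nu> + ?r1) \<gamma> \<le> ?p1"
        using elim(1) \<nu> by blast
      have "2 * ln \<gamma> \<le> \<beta>2 * (D/4)\<^sup>2 / (2 * B\<^sup>2) * ln \<gamma>" using rate2 ln0 by (intro mult_right_mono) auto
      then have "exp (- (\<beta>2 * (D/4)\<^sup>2 / (2 * B\<^sup>2)) * ln \<gamma>) \<le> exp (- 2 * ln \<gamma>)" by simp
      then have p2: "survival \<nu> (\<nu> + ?r2) \<gamma> \<le> ?p2"
        using elim(2) \<nu> by (meson add_left_mono order_trans)
      have "cond_delay P0 \<nu> P1 (\<tau>\<^sub>S \<gamma>) \<le> ennreal ((real ?r1 + real ?r2 * ?p1 + (\<gamma> / \<rho> + 1) * ?p2) / (1 - real \<nu> / \<gamma>))"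
        by (rule cond_delay_tau_bar_le[OF elim(3) \<nu>1 p1 p2])
      also have "\<dots> \<le> ennreal (c0 * ln \<gamma>)"
      proof (rule ennreal_leI)
        have "real ?r2 * ?p1 \<le> (\<beta>2 * ln \<gamma> + 1) * ?p1" using cl[OF \<beta>20] p10 by (rule mult_right_mono)
        then have X: "real ?r1 + real ?r2 * ?p1 + (\<gamma> / \<rho> + 1) * ?p2 \<le> c3 * ln \<gamma>"
          using cl[OF \<beta>10] elim(5) by linarith
        have "c3 * ln \<gamma> = c0 * ln \<gamma> * (c3 / c0)" using c30 by simp
        also have "\<dots> \<le> c0 * ln \<gamma> * (1 - real \<nu> / \<gamma>)" using \<nu>\<gamma> c30 ln0 by (intro mult_left_mono) auto
        finally have "real ?r1 + real ?r2 * ?p1 + (\<gamma> / \<rho> + 1) * ?p2 \<le> c0 * ln \<gamma> * (1 - real \<nu> / \<gamma>)" using X by linarith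
        then show "(real ?r1 + real ?r2 * ?p1 + (\<gamma> / \<rho> + 1) * ?p2) / (1 - real \<nu> / \<gamma>) \<le> c0 * ln \<gamma>"
          using \<nu>\<gamma> c3c0 by (subst pos_divide_le_eq) auto
      qed
      finally show "cond_delay P0 \<nu> P1 (\<tau>\<^sub>S \<gamma>) \<le> ennreal (c0 * ln \<gamma>)" .
    qed
  qed
qed

end

section \<open>From eventual bounds to limits\<close>

text \<open>Since an infimum over fewer procedures is larger, this reduces the lower bound for both
  classes to \<open>T_rand\<close>.\<close>

lemma T_raw_subset_T_rand: "T_raw P0 \<subseteq> T_rand P0"
proof
  fix \<tau> assume \<tau>: "\<tau> \<in> T_raw P0"
  have id: "(\<lambda>\<omega>. \<omega>) \<in> rand_filtration P0 t \<rightarrow>\<^sub>M raw_filtration P0 t" for t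
    unfolding raw_filtration_def
  proof (rule measurable_vimage_algebra2)
    show "(\<lambda>\<omega>. \<omega>) \<in> space (rand_filtration P0 t) \<rightarrow> space (null_law P0)" by simp
    show "(\<lambda>\<omega>. \<lambda>i\<in>times_upto t. obs i \<omega>) \<in> rand_filtration P0 t \<rightarrow>\<^sub>M (\<Pi>\<^sub>M i\<in>times_upto t. P0)"
      by (rule measurable_restrict) (rule measurable_compose[OF measurable_coord_filtration measurable_fst])
  qed
  have "stopping_time (rand_filtration P0) \<tau>"
  proof (rule stopping_timeI)
    fix t
    have "Measurable.pred (raw_filtration P0 t) (\<lambda>\<omega>. \<tau> \<omega> \<le> t)"
      using \<tau> unfolding T_raw_def by (auto dest: stopping_timeD)
    from measurable_compose[OF id this] show "Measurable.pred (rand_filtration P0 t) (\<lambda>\<omega>. \<tau> \<omega> \<le> t)" by simp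
  qed
  then show "\<tau> \<in> T_rand P0" using \<tau> unfolding T_raw_def T_rand_def by simp
qed

lemma R_lin_antimono: "S \<subseteq> T \<Longrightarrow> R_lin P0 P1 n \<kappa> \<gamma> T \<le> R_lin P0 P1 n \<kappa> \<gamma> S"
  unfolding R_lin_def C_lin_def by (rule INF_superset_mono) auto

lemma Liminf_div_ln_ge:
  fixes g :: "real \<Rightarrow> ennreal"
  assumes g: "\<And>c. 0 < c \<Longrightarrow> c < d \<Longrightarrow> \<forall>\<^sub>F \<gamma> in at_top. ennreal (c * ln \<gamma>) \<le> g \<gamma>"
  shows "ennreal d \<le> Liminf at_top (\<lambda>\<gamma>. g \<gamma> / ennreal (ln \<gamma>))"
  unfolding le_Liminf_iff
proof (intro allI impI)
  fix y assume "y < ennreal d"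
  then obtain r where r: "y = ennreal r" "0 \<le> r" "r < d"
    by (cases y) (auto simp: ennreal_less_iff)
  define c where "c = (r + d) / 2"
  have c: "r < c" "c < d" using r by (auto simp: c_def)
  have "\<forall>\<^sub>F \<gamma> in at_top. ennreal (c * ln \<gamma>) \<le> g \<gamma>" using g[of c] c r by simp
  then show "\<forall>\<^sub>F \<gamma> in at_top. y < g \<gamma> / ennreal (ln \<gamma>)"
    using eventually_gt_at_top[of 1]
  proof eventually_elim
    case (elim \<gamma>)
    then have l: "0 < ln \<gamma>" by simp
    have "y < ennreal c" using r c by (simp add: ennreal_less_iff)
    also have "ennreal c = ennreal (c * ln \<gamma>) / ennreal (ln \<gamma>)"
      using l r c by (subst divide_ennreal) auto
    also have "\<dots> \<le> g \<gamma> / ennreal (ln \<gamma>)" using elim(1) by (rule divide_right_mono_ennreal)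
    finally show ?case .
  qed
qed

lemma Limsup_div_ln_le:
  fixes g :: "real \<Rightarrow> ennreal"
  assumes d: "0 \<le> d" and g: "\<And>c. d < c \<Longrightarrow> \<forall>\<^sub>F \<gamma> in at_top. g \<gamma> \<le> ennreal (c * ln \<gamma>)"
  shows "Limsup at_top (\<lambda>\<gamma>. g \<gamma> / ennreal (ln \<gamma>)) \<le> ennreal d"
  unfolding Limsup_le_iff
proof (intro allI impI)
  fix y assume "ennreal d < y"
  then obtain z where z: "ennreal d < z" "z < y" using dense by blast
  then obtain c where c: "z = ennreal c" "0 \<le> c" by (cases z) auto
  have "d < c" using z(1) d unfolding c(1) by (simp add: ennreal_less_iff)
  from g[OF this] show "\<forall>\<^sub>F \<gamma> in at_top. g \<gamma> / ennreal (ln \<gamma>) < y"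
    using eventually_gt_at_top[of 1]
  proof eventually_elim
    case (elim \<gamma>)
    then have l: "0 < ln \<gamma>" by simp
    have "g \<gamma> / ennreal (ln \<gamma>) \<le> ennreal (c * ln \<gamma>) / ennreal (ln \<gamma>)" using elim(1) by (rule divide_right_mono_ennreal)
    also have "\<dots> = z" using l c by (simp add: divide_ennreal)
    finally show ?case using z(2) by (rule le_less_trans)
  qed
qed

lemma tendsto_of_Liminf_Limsup:
  fixes g :: "'b \<Rightarrow> ennreal"
  assumes F: "F \<noteq> bot" and low: "l \<le> Liminf F g" and up: "Limsup F g \<le> l"
  shows "(g \<longlongrightarrow> l) F"
proof -
  have "Liminf F g \<le> Limsup F g" using F by (rule Liminf_le_Limsup)
  then have "Liminf F g = l" "Limsup F g = l" using low up by auto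
  then show ?thesis using F by (simp add: tendsto_iff_Liminf_eq_Limsup)
qed

text \<open>The Radon-Nikodym derivative is determined only up to a P0-null set; since
  \<open>P1\<close> has a density with respect to \<open>P0\<close>, the identity carries over to
  \<open>P1\<close>.\<close>

lemma AE_entropy_density:
  fixes L :: "'a \<Rightarrow> real"
  assumes P0: "prob_space P0" and L: "L \<in> borel_measurable P0" and L0: "\<forall>x\<in>space P0. 0 \<le> L x"
    and dens: "density P0 (\<lambda>x. ennreal (L x)) = P1"
  shows "AE x in P1. entropy_density (exp 1) P0 P1 x = ln (L x)"
proof -
  interpret prob_space P0 by fact
  have "AE x in P0. ennreal (L x) = RN_deriv P0 P1 x"
    by (rule RN_deriv_unique[OF _ dens]) (use L in measurable)
  then have "AE x in P0. entropy_density (exp 1) P0 P1 x = ln (L x)"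
    using AE_space
  proof eventually_elim
    case (elim x)
    have "enn2real (RN_deriv P0 P1 x) = L x" using elim L0 by (metis enn2real_ennreal)
    then show ?case by (simp add: entropy_density_def log_def)
  qed
  then show ?thesis
    unfolding dens[symmetric] using L by (subst AE_density) (auto elim: eventually_mono)
qed

lemma change_point_kl_intro:
  assumes P0: "prob_space P0" and P1: "prob_space P1" and sets_eq: "sets P1 = sets P0"
    and L: "L \<in> borel_measurable P0" and L0: "\<forall>x\<in>space P0. 0 \<le> L x"
    and dens: "density P0 (\<lambda>x. ennreal (L x)) = P1"
    and D: "D = kl_div P1 P0" and kl: "kl_finite_pos P1 P0"
  shows "change_point_kl P0 P1 L D"
proof -
  note e = AE_entropy_density[OF P0 L L0 dens]
  have L1: "L \<in> borel_measurable P1" using L sets_eq by (simp cong: measurable_cong_sets)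
  have int: "integrable P1 (entropy_density (exp 1) P0 P1)" using kl by (simp add: kl_finite_pos_def)
  have "integrable P1 (\<lambda>x. ln (L x)) \<longleftrightarrow> integrable P1 (entropy_density (exp 1) P0 P1)"
    using e L1 int by (intro integrable_cong_AE) (auto elim: eventually_mono)
  moreover have "(\<integral>x. ln (L x) \<partial>P1) = (\<integral>x. entropy_density (exp 1) P0 P1 x \<partial>P1)"
    using e L1 int by (intro integral_cong_AE) (auto elim: eventually_mono)
  moreover have "D = (\<integral>x. entropy_density (exp 1) P0 P1 x \<partial>P1)" "0 < D"
    using D kl by (simp_all add: kl_div_def KL_divergence_def kl_finite_pos_def)
  ultimately have "change_point_kl_axioms P1 L D"
    using int by (intro change_point_kl_axioms.intro) simp_all
  moreover have "change_point P0 P1 L"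
    using P0 P1 sets_eq L L0 dens by (intro change_point.intro) simp_all
  ultimately show ?thesis by (rule change_point_kl.intro[rotated])
qed

lemma local_KL_intro:
  fixes w :: "nat \<Rightarrow> real"
  assumes kl: "change_point_kl P0 P1 L D"
    and Pr: "prob_space Pr" and fam: "density_family Pr f"
    and cont: "continuous_on UNIV (cdf (distr P0 borel L))"
    and sup: "local_KL_support (pit_law P0 P1 L) Pr f"
    and \<rho>: "0 < \<rho>" "\<rho> < 1" and w: "\<forall>k\<ge>1. w k = 1"
  shows "\<exists>h B Kl a c. local_KL P0 P1 L D h Pr f \<rho> B Kl a c w"
proof -
  from sup obtain h K a c where h: "h \<in> borel_measurable borel" "\<And>u. u \<in> {0..1} \<Longrightarrow> 0 < h u"
      "density unif01 (\<lambda>u. ennreal (h u)) = pit_law P0 P1 L" "bounded ((\<lambda>u. ln (h u)) ` {0..1})"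
    and K: "K-lipschitz_on {0..1} (\<lambda>u. ln (h u))" and a: "0 \<le> a"
    and ac: "\<And>r z. 1 \<le> r \<Longrightarrow> (\<forall>i\<in>{1..r}. z i \<in> {0..1}) \<Longrightarrow>
       ereal ((\<Sum>i=1..r. ln (h (z i))) - a * ln (real r) - c) \<le> ln_ennreal (mix_lik Pr f {1..r} z)"
    unfolding local_KL_support_def by blast
  obtain B where B: "\<And>u. u \<in> {0..1} \<Longrightarrow> \<bar>ln (h u)\<bar> \<le> B"
    using h(4) unfolding bounded_iff by (auto simp del: atLeastAtMost_iff)
  \<comment> \<open>\<open>max B 1\<close> because the bound obtained from boundedness need not be
    positive.\<close>
  have "local_KL_axioms P0 P1 L h Pr f \<rho> (max B 1) K a c w"
  proof (rule local_KL_axioms.intro)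
    show "\<bar>ln (h u)\<bar> \<le> max B 1" if "u \<in> {0..1}" for u using B[OF that] by linarith
    show "\<bar>ln (h u) - ln (h v)\<bar> \<le> K * \<bar>u - v\<bar>" if "u \<in> {0..1}" "v \<in> {0..1}" for u v
      using lipschitz_onD[OF K that] by (simp add: dist_real_def)
    show "0 \<le> K" by (rule lipschitz_on_nonneg[OF K])
    show "ennreal (exp ((\<Sum>i=1..r. ln (h (z i))) - a * ln (real r) - c)) \<le> mix_lik Pr f {1..r} z"
      if "1 \<le> r" "\<And>i. i \<in> {1..r} \<Longrightarrow> z i \<in> {0..1}" for r z
      by (rule ln_ennreal_leD[OF ac]) (use that in auto)
    show "0 < max B 1" by simp
    show "0 < h u" if "u \<in> {0..1}" for u using h(2)[OF that] .
  qed (rule cont h(1) h(3) a Pr fam \<rho> w)+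
  then have "local_KL P0 P1 L D h Pr f \<rho> (max B 1) K a c w" by (rule local_KL.intro[OF kl])
  then show ?thesis by blast
qed

theorem theorem3p10:
  fixes P0 P1 :: "'a measure" and L :: "'a \<Rightarrow> real" and D \<kappa> :: real and N :: "real \<Rightarrow> nat"
    and Pr :: "'th measure" and f :: "'th \<Rightarrow> real \<Rightarrow> real" and \<rho> :: real and w :: "nat \<Rightarrow> real"
  assumes P0: "prob_space P0" and P1: "prob_space P1" and sets_eq: "sets P1 = sets P0"
    and ac: "absolutely_continuous P0 P1"
    and L_meas: "L \<in> borel_measurable P0" and L_nonneg: "\<forall>x\<in>space P0. 0 \<le> L x"
    and L_dens: "density P0 (\<lambda>x. ennreal (L x)) = P1"
    and D_def: "D = kl_div P1 P0" and D_pos_fin: "kl_finite_pos P1 P0"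
    and \<kappa>: "0 < \<kappa>" "\<kappa> < 1"
    and N_top: "filterlim N at_top at_top"
    and N_log: "(\<lambda>\<gamma>. ln \<gamma>) \<in> o[at_top](\<lambda>\<gamma>. real (N \<gamma>))"
    and N_small: "(\<lambda>\<gamma>. real (N \<gamma>)) \<in> o[at_top](\<lambda>\<gamma>. \<gamma>)"
  shows
    "(\<forall>T\<in>{T_raw P0, T_rand P0}.
        ennreal (1 / D) \<le> Liminf at_top (\<lambda>\<gamma>. R_lin P0 P1 (N \<gamma>) \<kappa> \<gamma> T / ennreal (ln \<gamma>)))
     \<and>
     (prob_space Pr \<and> density_family Pr f \<and>
      continuous_on UNIV (cdf (distr P0 borel L)) \<and>
      local_KL_support (pit_law P0 P1 L) Pr f \<and>
      0 < \<rho> \<and> \<rho> < 1 \<and> (\<forall>k\<ge>1. w k = 1)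
      \<longrightarrow>
      (\<forall>\<gamma>>1. tau_bar Pr f L w \<rho> \<gamma> \<in> C_lin P0 \<gamma> (T_rand P0) \<and>
         ennreal \<gamma> \<le> null_mean P0 (tau_bar Pr f L w \<rho> \<gamma>) \<and>
         null_mean P0 (tau_bar Pr f L w \<rho> \<gamma>) \<le> ennreal (of_int \<lceil>\<gamma> / \<rho>\<rceil>)) \<and>
      Limsup at_top
        (\<lambda>\<gamma>. (SUP \<nu>\<in>change_window (N \<gamma>) \<kappa>. cond_delay P0 \<nu> P1 (tau_bar Pr f L w \<rho> \<gamma>))
               / ennreal (ln \<gamma>)) \<le> ennreal (1 / D) \<and>
      ((\<lambda>\<gamma>. R_lin P0 P1 (N \<gamma>) \<kappa> \<gamma> (T_rand P0) / ennreal (ln \<gamma>)) \<longlongrightarrow> ennreal (1 / D)) at_top \<and>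
      ((\<lambda>\<gamma>. J_delay P0 P1 (N \<gamma>) \<kappa> (tau_bar Pr f L w \<rho> \<gamma>) / ennreal (ln \<gamma>))
         \<longlongrightarrow> ennreal (1 / D)) at_top)"
proof -
  interpret change_point_kl P0 P1 L D
    by (rule change_point_kl_intro[OF P0 P1 sets_eq L_meas L_nonneg L_dens D_def D_pos_fin])
  let ?R = "\<lambda>\<gamma>. R_lin P0 P1 (N \<gamma>) \<kappa> \<gamma> (T_rand P0) / ennreal (ln \<gamma>)"
  have low: "ennreal (1 / D) \<le> Liminf at_top ?R"
    by (rule Liminf_div_ln_ge) (rule R_lin_lower[OF _ _ \<kappa> N_log N_small])
  have lower: "ennreal (1 / D) \<le> Liminf at_top (\<lambda>\<gamma>. R_lin P0 P1 (N \<gamma>) \<kappa> \<gamma> T / ennreal (ln \<gamma>))"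
    if "T \<in> {T_raw P0, T_rand P0}" for T
  proof -
    have "T \<subseteq> T_rand P0" using that T_raw_subset_T_rand by auto
    then have "Liminf at_top ?R
      \<le> Liminf at_top (\<lambda>\<gamma>. R_lin P0 P1 (N \<gamma>) \<kappa> \<gamma> T / ennreal (ln \<gamma>))"
      by (intro Liminf_mono always_eventually allI divide_right_mono_ennreal R_lin_antimono)
    with low show ?thesis by (rule order.trans)
  qed
  show ?thesis
  proof (intro conjI ballI impI lower)
    assume A: "prob_space Pr \<and> density_family Pr f \<and> continuous_on UNIV (cdf (distr P0 borel L)) \<and>
      local_KL_support (pit_law P0 P1 L) Pr f \<and> 0 < \<rho> \<and> \<rho> < 1 \<and> (\<forall>k\<ge>1. w k = 1)"
    then have Pr: "prob_space Pr" and fam: "density_family Pr f" and cont: "continuous_on UNIV (cdf (distr P0 borel L))"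
      and \<rho>: "0 < \<rho>" "\<rho> < 1" and w: "\<forall>k\<ge>1. w k = 1" and sup: "local_KL_support (pit_law P0 P1 L) Pr f" by auto
    obtain h B Kl a c where "local_KL P0 P1 L D h Pr f \<rho> B Kl a c w"
      using local_KL_intro[OF change_point_kl_axioms Pr fam cont sup \<rho> w] by blast
    then interpret K: local_KL P0 P1 L D h Pr f \<rho> B Kl a c w .
    let ?\<tau> = "\<lambda>\<gamma>. tau_bar Pr f L w \<rho> \<gamma>"
    let ?J = "\<lambda>\<gamma>. J_delay P0 P1 (N \<gamma>) \<kappa> (?\<tau> \<gamma>) / ennreal (ln \<gamma>)"
    note null = tau_bar_null[OF Pr fam \<rho> P0 L_meas cont w]
    have C: "?\<tau> \<gamma> \<in> C_lin P0 \<gamma> (T_rand P0)" if "1 < \<gamma>" for \<gamma>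
      using null[OF that] tau_bar_T_rand[OF L_meas w Pr fam \<rho>]
      by (auto simp: C_lin_def intro: le_less_trans[OF _ ennreal_less_top])
    have up: "Limsup at_top ?J \<le> ennreal (1 / D)"
      using D_pos by (intro Limsup_div_ln_le K.delay_upper[OF \<kappa> N_log N_small]) auto
    \<comment> \<open>For \<gamma> > 1 the detector is admissible, so the optimal delay lies below
      its delay. The lower bound for the former and the upper bound for the latter then determine
      both limits.\<close>
    have RJ: "\<forall>\<^sub>F \<gamma> in at_top. ?R \<gamma> \<le> ?J \<gamma>"
      using eventually_gt_at_top[of 1]
      by eventually_elim (auto simp: R_lin_def intro!: divide_right_mono_ennreal INF_lower C)
    have bot: "at_top \<noteq> (bot :: real filter)" by simp
    show "Limsup at_top (\<lambda>\<gamma>. (SUP \<nu>\<in>change_window (N \<gamma>) \<kappa>. cond_delay P0 \<nu> P1 (?\<tau> \<gamma>)) / ennreal (ln \<gamma>)) \<le> ennreal (1 / D)"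
      using up unfolding J_delay_def .
    have upR: "Limsup at_top ?R \<le> ennreal (1 / D)"
      using Limsup_mono[OF RJ] up by (rule order.trans)
    have lowJ: "ennreal (1 / D) \<le> Liminf at_top ?J"
      using low Liminf_mono[OF RJ] by (rule order.trans)
    show "(?R \<longlongrightarrow> ennreal (1 / D)) at_top"
      by (rule tendsto_of_Liminf_Limsup[OF bot low upR])
    show "(?J \<longlongrightarrow> ennreal (1 / D)) at_top"
      by (rule tendsto_of_Liminf_Limsup[OF bot lowJ up])
    show "\<forall>\<gamma>>1. ?\<tau> \<gamma> \<in> C_lin P0 \<gamma> (T_rand P0) \<and> ennreal \<gamma> \<le> null_mean P0 (?\<tau> \<gamma>) \<and>
       null_mean P0 (?\<tau> \<gamma>) \<le> ennreal (of_int \<lceil>\<gamma> / \<rho>\<rceil>)"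
      using C null by blast
  qed
qed

end
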